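(* Let $(\Gamma,v)$ be an infinite one-ended cactus rooted at $v$, and let $\{H_n\}_{n\ge1}$ be an exhaustion of $(\Gamma,v)$ by finite subgraphs containing $v$ such that the internal boundary of each $H_n$ consists of a unique vertex $p^{(n)}$, which is set to be the unique dissipative vertex of $H_n$. Let $\mathcal{CP}_v=\mathcal{C}_1\mathcal{C}_2\dots$ be the infinite block-path in $\Gamma$ starting at $v$ and let $\mathcal{CP}^n_v=\mathcal{C}_1\dots\mathcal{C}_{r_n}\subset\mathcal{CP}_v$ be the finite block-path in $H_n$ joining $v$ to $p^{(n)}$. Suppose that $\sum_{j=1,\,|\mathcal{C}_j|>2}^{r_n}\frac1{|\mathcal{C}_j|}$ converges as $r_n\to\infty$. Suppose moreover that the subgraphs $D(p_i)$, $i\ge1$, satisfy: 1. there exists a constant $c>0$ such that, for any $i$ sufficiently large, $\mathrm{Diam}(D(p_i))\le c|\mathcal{C}_i|$; 2. $\lim_{i\to\infty}\frac{\log d_{i-1}}{\log d_i}=1$. Let $\beta:=\limsup_{i\to\infty}\frac{\log d_i}{\log \mathrm{Diam}(D(p_i))}$ and $\beta':=\liminf_{i\to\infty}\frac{\log d_i}{\log \mathrm{Diam}(D(p_i))}$ (understood to be finite). Then there are constants $C_1,C_2>0$ such that for any $\epsilon$ with $0<\epsilon<\beta'$ there exists $M_0$ such that, for any $M>M_0$ that occurs as the mass of an avalanche, $$C_1\cdot M^{-\frac{2}{\beta'-\epsilon}}\le\lim_{n\to\infty}\mathbb{P}_{\mu_n}(Mav_{H_n}(\cdot,v)=M)\le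 C_2\cdot M^{-\frac{2}{\beta+\epsilon}}.$$ In particular, if $\beta=\beta'$, then the Abelian sandpile model on the sequence $\{H_n\}_{n\ge1}$ approximating $(\Gamma,v)$ is critical with critical exponent $\delta=2/\beta$.
   Context: **Graphs.** Graphs are connected, locally finite, possibly with loops and multiple edges (a loop contributes 2 to the degree). A block is a maximal 2-connected subgraph; a cactus is a separable graph (one having a cut vertex), possibly with loops, all of whose blocks are cycles (possibly of length 2) or single edges. $|\mathcal{C}|$ denotes the number of vertices of a block. A block-path is a sequence of distinct blocks with consecutive blocks intersecting; the block-path joining two vertices is the unique one of minimal length whose first and last blocks contain them. In an infinite one-ended cactus $(\Gamma,v)$ there is a unique infinite block-path $\mathcal{CP}_v=\mathcal{C}_1\mathcal{C}_2\dots$ starting at $v$ (i.e. $v\in\mathcal{C}_1$, $v\notin\mathcal{C}_2$). For $i\ge1$, $p_i$ is the cut vertex between $\mathcal{C}_i$ and $\mathcal{C}_{i+1}$; $D(p_i)$ is the subgraph consisting of the union of all finite connected components of $\Gamma\setminus\{p_i\}$ together with $p_i$; $d_i$ is its number of vertices. The internal boundary of a subgraph $H\subset\Gamma$ is the set of vertices of $H$ having a neighbour in $\Gamma\setminus H$. **Sandpile model.** Let $H$ be a finite connected graph with a nonempty set $P$ of dissipative vertices and $V_0=V(H)\setminus P$. A configuration is $\eta:V_0\to\mathbb{N}$; it is stable if $\eta(w)<\deg(w)$ for all $w\in V_0$. Firing $w\in V_0$ with $\eta(w)\ge\deg(w)$ sends one chip along each edge incident to $w$; chips reaching $P$ disappear.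 Stabilization by finitely many firings always occurs, and the result and number of firings of each vertex are independent of the order. Recurrent configurations are the recurrent states of the Markov chain on stable configurations that adds a chip at a random vertex of $V_0$ (every vertex having positive probability) and stabilizes; equivalently, stable $c$ such that there is no nonempty $U\subset V_0$ with $c(w)<\deg_{H[U]}(w)$ for all $w\in U$. $\mathcal{R}_H$ is the set of recurrent configurations; $Mav_H(c,v)$, the mass of the avalanche, is the number of distinct vertices fired while stabilizing $c+\delta_v$. $\mu_n$ is the uniform distribution on $\mathcal{R}_{H_n}$. **Criticality.** The model on $\{H_n\}$ is critical with critical exponent $\delta>0$ if there are $C_1,C_2>0$ such that for all $\epsilon>0$ there is $M_\epsilon\ge1$ with $C_1M^{-\delta-\epsilon}\le\lim_{n\to\infty}\mathbb{P}_{\mu_n}(Mav_{H_n}(\cdot,v)=M)\le C_2M^{-\delta+\epsilon}$ for all $M>M_\epsilon$ that can be realized as the mass of an avalanche. *)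

theory Defs
  imports "HOL-Probability.Probability"
begin

section \<open>Multigraphs\<close>

text \<open>Undirected graphs with loops and multiple edges: an edge with one end is a loop.\<close>

record ('v, 'e) multigraph =
  verts :: "'v set"
  edges :: "'e set"
  ends :: "'e \<Rightarrow> 'v set"

definition wf_multigraph :: "('v, 'e) multigraph \<Rightarrow> bool" where
  "wf_multigraph G \<longleftrightarrow>
     (\<forall>e\<in>edges G. ends G e \<subseteq> verts G \<and> (card (ends G e) = 1 \<or> card (ends G e) = 2))"

definition locally_finite :: "('v, 'e) multigraph \<Rightarrow> bool" where
  "locally_finite G \<longleftrightarrow> (\<forall>x\<in>verts G. finite {e \<in> edges G. x \<in> ends G e})"

definition vdegree :: "('v, 'e) multigraph \<Rightarrow> 'v \<Rightarrow> nat" where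
  "vdegree G x = card {e \<in> edges G. x \<in> ends G e} + card {e \<in> edges G. ends G e = {x}}"

definition adjacent :: "('v, 'e) multigraph \<Rightarrow> 'v \<Rightarrow> 'v \<Rightarrow> bool" where
  "adjacent G x y \<longleftrightarrow> (\<exists>e\<in>edges G. ends G e = {x, y})"

text \<open>The graph without vertices counts as connected here.\<close>

definition graph_connected :: "('v, 'e) multigraph \<Rightarrow> bool" where
  "graph_connected G \<longleftrightarrow> (\<forall>x\<in>verts G. \<forall>y\<in>verts G. (adjacent G)\<^sup>*\<^sup>* x y)"

definition graph_dist :: "('v, 'e) multigraph \<Rightarrow> 'v \<Rightarrow> 'v \<Rightarrow> nat" where
  "graph_dist G x y = (LEAST n. (adjacent G ^^ n) x y)"

definition graph_diam :: "('v, 'e) multigraph \<Rightarrow> nat" where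
  "graph_diam G = Max {graph_dist G x y | x y. x \<in> verts G \<and> y \<in> verts G}"

text \<open>Subgraphs carry the same incidence function, so that a subgraph is determined by its
  vertices and edges and equality of subgraphs is equality of records.\<close>

definition subgraph :: "('v, 'e) multigraph \<Rightarrow> ('v, 'e) multigraph \<Rightarrow> bool" where
  "subgraph H G \<longleftrightarrow>
     wf_multigraph H \<and> verts H \<subseteq> verts G \<and> edges H \<subseteq> edges G \<and> ends H = ends G"

definition induced :: "('v, 'e) multigraph \<Rightarrow> 'v set \<Rightarrow> ('v, 'e) multigraph" where
  "induced G S = \<lparr>verts = verts G \<inter> S, edges = {e \<in> edges G. ends G e \<subseteq> S}, ends = ends G\<rparr>"

definition delete_verts :: "('v, 'e) multigraph \<Rightarrow> 'v set \<Rightarrow> ('v, 'e) multigraph" where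
  "delete_verts G X = induced G (verts G - X)"

definition graph_components :: "('v, 'e) multigraph \<Rightarrow> 'v set set" where
  "graph_components G = {{y. (adjacent G)\<^sup>*\<^sup>* x y} | x. x \<in> verts G}"

definition cut_vertex :: "('v, 'e) multigraph \<Rightarrow> 'v \<Rightarrow> bool" where
  "cut_vertex G x \<longleftrightarrow> x \<in> verts G \<and> \<not> graph_connected (delete_verts G {x})"

definition one_ended :: "('v, 'e) multigraph \<Rightarrow> bool" where
  "one_ended G \<longleftrightarrow>
     (\<forall>F. finite F \<and> F \<subseteq> verts G \<longrightarrow>
        (\<exists>!S. S \<in> graph_components (delete_verts G F) \<and> infinite S))"

definition internal_boundary :: "('v, 'e) multigraph \<Rightarrow> ('v, 'e) multigraph \<Rightarrow> 'v set" where
  "internal_boundary G H = {x \<in> verts H. \<exists>y \<in> verts G - verts H. adjacent G x y}"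

definition exhaustion :: "('v, 'e) multigraph \<Rightarrow> (nat \<Rightarrow> ('v, 'e) multigraph) \<Rightarrow> bool" where
  "exhaustion G H \<longleftrightarrow>
     (\<forall>n. subgraph (H n) G \<and> finite (verts (H n)) \<and> graph_connected (H n)) \<and>
     (\<forall>n. subgraph (H n) (H (Suc n))) \<and>
     (\<Union>n. verts (H n)) = verts G \<and> (\<Union>n. edges (H n)) = edges G"


section \<open>Blocks and cacti\<close>

text \<open>``2-connected'' has to include single edges (which do occur as blocks of a cactus), so it
  means: connected, nontrivial and without cut vertex. Loops at a vertex never affect
  connectivity; they are kept out of blocks, since otherwise a maximal such subgraph would absorb
  the loops at its vertices and a cycle carrying a loop would not be a cycle block.\<close>

definition two_connected :: "('v, 'e) multigraph \<Rightarrow> bool" where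
  "two_connected B \<longleftrightarrow>
     wf_multigraph B \<and> edges B \<noteq> {} \<and> (\<forall>e\<in>edges B. card (ends B e) = 2) \<and>
     graph_connected B \<and> (\<nexists>x. cut_vertex B x)"

definition is_block :: "('v, 'e) multigraph \<Rightarrow> ('v, 'e) multigraph \<Rightarrow> bool" where
  "is_block G B \<longleftrightarrow>
     subgraph B G \<and> two_connected B \<and>
     (\<forall>B'. subgraph B' G \<and> two_connected B' \<and> subgraph B B' \<longrightarrow> B' = B)"

definition is_cycle :: "('v, 'e) multigraph \<Rightarrow> bool" where
  "is_cycle B \<longleftrightarrow>
     (\<exists>vs es. vs \<noteq> [] \<and> length es = length vs \<and> distinct vs \<and> distinct es \<and>
        verts B = set vs \<and> edges B = set es \<and>
        (\<forall>i<length vs. ends B (es ! i) = {vs ! i, vs ! (Suc i mod length vs)}))"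

definition is_single_edge :: "('v, 'e) multigraph \<Rightarrow> bool" where
  "is_single_edge B \<longleftrightarrow>
     (\<exists>x y e. x \<noteq> y \<and> verts B = {x, y} \<and> edges B = {e} \<and> ends B e = {x, y})"

definition cactus :: "('v, 'e) multigraph \<Rightarrow> bool" where
  "cactus G \<longleftrightarrow>
     wf_multigraph G \<and> locally_finite G \<and> graph_connected G \<and> (\<exists>x. cut_vertex G x) \<and>
     (\<forall>B. is_block G B \<longrightarrow> is_cycle B \<or> is_single_edge B)"

definition block_path :: "('v, 'e) multigraph \<Rightarrow> ('v, 'e) multigraph list \<Rightarrow> bool" where
  "block_path G Bs \<longleftrightarrow>
     Bs \<noteq> [] \<and> distinct Bs \<and> (\<forall>B\<in>set Bs. is_block G B) \<and>
     successively (\<lambda>A B. verts A \<inter> verts B \<noteq> {}) Bs"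

definition block_path_between ::
    "('v, 'e) multigraph \<Rightarrow> 'v \<Rightarrow> 'v \<Rightarrow> ('v, 'e) multigraph list \<Rightarrow> bool" where
  "block_path_between G x y Bs \<longleftrightarrow>
     block_path G Bs \<and> x \<in> verts (hd Bs) \<and> y \<in> verts (last Bs)"

definition joining_block_path ::
    "('v, 'e) multigraph \<Rightarrow> 'v \<Rightarrow> 'v \<Rightarrow> ('v, 'e) multigraph list \<Rightarrow> bool" where
  "joining_block_path G x y Bs \<longleftrightarrow>
     block_path_between G x y Bs \<and>
     (\<forall>Bs'. block_path_between G x y Bs' \<longrightarrow> length Bs \<le> length Bs')"

text \<open>The infinite block-path \<open>C 1, C 2, \<dots>\<close> starting at \<open>v\<close>, with \<open>p i\<close> the vertex shared by
  \<open>C i\<close> and \<open>C (i + 1)\<close>; \<open>C 0\<close> and \<open>p 0\<close> are irrelevant. Distinct consecutively intersecting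
  blocks alone would not determine the path, because it could visit further blocks
  through \<open>p i\<close> on the way; hence its initial segments are required to be the (minimal)
  block-paths joining \<open>v\<close> to \<open>p i\<close>.\<close>

definition infinite_block_path ::
    "('v, 'e) multigraph \<Rightarrow> 'v \<Rightarrow> (nat \<Rightarrow> ('v, 'e) multigraph) \<Rightarrow> (nat \<Rightarrow> 'v) \<Rightarrow> bool" where
  "infinite_block_path G v C p \<longleftrightarrow>
     inj_on C {1..} \<and> (\<forall>i\<ge>1. is_block G (C i)) \<and>
     v \<in> verts (C 1) \<and> v \<notin> verts (C 2) \<and>
     (\<forall>i\<ge>1. verts (C i) \<inter> verts (C (i + 1)) = {p i}) \<and>
     (\<forall>i\<ge>1. joining_block_path G v (p i) (map C [1..<i + 1]))"

definition decoration :: "('v, 'e) multigraph \<Rightarrow> 'v \<Rightarrow> ('v, 'e) multigraph" where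
  "decoration G x =
     induced G (insert x (\<Union>{S \<in> graph_components (delete_verts G {x}). finite S}))"


section \<open>The sandpile model\<close>

text \<open>A configuration on the non-dissipative vertices \<open>verts H - P\<close> is a function that vanishes
  elsewhere.\<close>

type_synonym 'v config = "'v \<Rightarrow> nat"

definition stable_configs :: "('v, 'e) multigraph \<Rightarrow> 'v set \<Rightarrow> 'v config set" where
  "stable_configs H P =
     {c. (\<forall>w \<in> verts H - P. c w < vdegree H w) \<and> (\<forall>w. w \<notin> verts H - P \<longrightarrow> c w = 0)}"

text \<open>The number of chips that \<open>u\<close> receives when \<open>w\<close> fires; a loop returns two chips.\<close>

definition chips :: "('v, 'e) multigraph \<Rightarrow> 'v \<Rightarrow> 'v \<Rightarrow> nat" where
  "chips H w u = (if u = w then 2 else 1) * card {e \<in> edges H. ends H e = {w, u}}"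

definition fire :: "('v, 'e) multigraph \<Rightarrow> 'v set \<Rightarrow> 'v \<Rightarrow> 'v config \<Rightarrow> 'v config" where
  "fire H P w \<eta> =
     (\<lambda>u. if u \<in> verts H - P then \<eta> u - (if u = w then vdegree H w else 0) + chips H w u else 0)"

inductive firing_sequence ::
    "('v, 'e) multigraph \<Rightarrow> 'v set \<Rightarrow> 'v config \<Rightarrow> 'v list \<Rightarrow> 'v config \<Rightarrow> bool"
  for H P where
  Nil: "firing_sequence H P \<eta> [] \<eta>"
| Cons: "w \<in> verts H - P \<Longrightarrow> vdegree H w \<le> \<eta> w \<Longrightarrow> firing_sequence H P (fire H P w \<eta>) ws \<eta>'
    \<Longrightarrow> firing_sequence H P \<eta> (w # ws) \<eta>'"

definition add_chip :: "'v config \<Rightarrow> 'v \<Rightarrow> 'v config" where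
  "add_chip c w = c(w := c w + 1)"

definition stabilization :: "('v, 'e) multigraph \<Rightarrow> 'v set \<Rightarrow> 'v config \<Rightarrow> 'v config" where
  "stabilization H P \<eta> =
     (THE \<eta>'. \<exists>ws. firing_sequence H P \<eta> ws \<eta>' \<and> \<eta>' \<in> stable_configs H P)"

definition avalanche_mass :: "('v, 'e) multigraph \<Rightarrow> 'v set \<Rightarrow> 'v config \<Rightarrow> 'v \<Rightarrow> nat" where
  "avalanche_mass H P c v =
     (THE m. \<exists>ws \<eta>'. firing_sequence H P (add_chip c v) ws \<eta>' \<and> \<eta>' \<in> stable_configs H P \<and>
        m = card (set ws))"

text \<open>\<open>hit_within K y n x\<close> is the probability that the Markov chain with transition kernel \<open>K\<close>
  started at \<open>x\<close> is at \<open>y\<close> at one of the times \<open>1, \<dots>, n\<close>; a state is recurrent if the chain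
  returns to it almost surely. For the sandpile chain this does not depend on the law \<open>q\<close> of the
  vertex receiving a chip, as long as every non-dissipative vertex has positive probability.\<close>

primrec hit_within :: "('s \<Rightarrow> 's pmf) \<Rightarrow> 's \<Rightarrow> nat \<Rightarrow> 's \<Rightarrow> real" where
  "hit_within K y 0 x = 0"
| "hit_within K y (Suc n) x =
     measure_pmf.expectation (K x) (\<lambda>z. if z = y then 1 else hit_within K y n z)"

definition recurrent_state :: "('s \<Rightarrow> 's pmf) \<Rightarrow> 's \<Rightarrow> bool" where
  "recurrent_state K x \<longleftrightarrow> (\<lambda>n. hit_within K x n x) \<longlonglongrightarrow> 1"

definition sandpile_chain ::
    "('v, 'e) multigraph \<Rightarrow> 'v set \<Rightarrow> 'v pmf \<Rightarrow> 'v config \<Rightarrow> 'v config pmf" where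
  "sandpile_chain H P q c = map_pmf (\<lambda>w. stabilization H P (add_chip c w)) q"

definition recurrent_configs :: "('v, 'e) multigraph \<Rightarrow> 'v set \<Rightarrow> 'v config set" where
  "recurrent_configs H P =
     {c \<in> stable_configs H P.
        \<forall>q. set_pmf q = verts H - P \<longrightarrow> recurrent_state (sandpile_chain H P q) c}"

definition avalanche_prob :: "('v, 'e) multigraph \<Rightarrow> 'v set \<Rightarrow> 'v \<Rightarrow> nat \<Rightarrow> real" where
  "avalanche_prob H P v M =
     measure_pmf.prob (pmf_of_set (recurrent_configs H P)) {c. avalanche_mass H P c v = M}"


section \<open>Criticality\<close>

text \<open>In the sequences below, \<open>b n\<close> is the unique dissipative vertex of \<open>H n\<close>.

  A mass is realizable if it occurs in \<open>H n\<close> for infinitely many \<open>n\<close>. Occurrence for a single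
  \<open>n\<close> says nothing about the limit: an avalanche that fires all vertices but \<open>b n\<close> of the cycle
  through which it reaches \<open>b n\<close> stops there in \<open>H n\<close>, while in larger graphs it always fires
  \<open>b n\<close> as well, so the limiting probability of its mass in \<open>H n\<close> can vanish.\<close>

definition realizable_mass ::
    "(nat \<Rightarrow> ('v, 'e) multigraph) \<Rightarrow> (nat \<Rightarrow> 'v) \<Rightarrow> 'v \<Rightarrow> nat \<Rightarrow> bool" where
  "realizable_mass H b v M \<longleftrightarrow>
     (\<exists>\<^sub>F n in sequentially. \<exists>c \<in> recurrent_configs (H n) {b n}. avalanche_mass (H n) {b n} c v = M)"

definition critical_with_exponent ::
    "(nat \<Rightarrow> ('v, 'e) multigraph) \<Rightarrow> (nat \<Rightarrow> 'v) \<Rightarrow> 'v \<Rightarrow> real \<Rightarrow> bool" where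
  "critical_with_exponent H b v \<delta> \<longleftrightarrow>
     \<delta> > 0 \<and>
     (\<exists>C1>0. \<exists>C2>0. \<forall>\<epsilon>>0. \<exists>M\<^sub>\<epsilon>\<ge>1. \<forall>M>M\<^sub>\<epsilon>. realizable_mass H b v M \<longrightarrow>
        (\<exists>L. (\<lambda>n. avalanche_prob (H n) {b n} v M) \<longlonglongrightarrow> L \<and>
           C1 * real M powr (- \<delta> - \<epsilon>) \<le> L \<and> L \<le> C2 * real M powr (- \<delta> + \<epsilon>)))"

end

theory Submission
  imports Defs
begin

text \<open>An avalanche is described by its least stabilizing vector, so everything is decided by
  comparing vectors instead of following firing sequences. Recurrent configurations are the allowed
  stable ones; off the block-path they may be resampled freely, and on each cycle of the block-path
  with \<open>k\<close> vertices they have at most one deficient vertex outside the root, giving \<open>k\<close> equally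
  likely independent states. A large avalanche that fires \<open>p (i - 1)\<close> but not \<open>p i\<close> stops on the
  cycle \<open>C i\<close> at its deficient vertex, whose position is determined up to two choices by the mass,
  and \<open>p i\<close> has to be deficient in \<open>C (i + 1)\<close>: this gives the upper bound
  \<open>2 / (|C i| |C (i + 1)|)\<close>. Conversely such a pair of states does stop the avalanche there
  whenever a single chip arrives at \<open>p (i - 1)\<close>. A single chip at \<open>p (l - 1)\<close> is passed on as a single
  chip to \<open>p l\<close> with probability at least \<open>1 - 2 / |C l|\<close>, and these factors have a positive product
  by the summability hypothesis. Finally \<open>|C i|\<close> is comparable with the diameter of \<open>D (p i)\<close>.\<close>

section \<open>Least stabilizing vectors and allowed configurations\<close>

text \<open>Only interaction weights and degrees enter the model, so the argument runs on an
  abstract weighted graph. The infinite graph and every \<open>H n\<close> are instances, and they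
  agree on a decoration once \<open>H n\<close> contains all edges at it. The infinite graph has no
  sink, so stabilizability inside a decoration is borrowed from a finite \<open>H n\<close>. The
  limit exists for a simple reason: a mass below \<open>card (D (p i))\<close> rules out that p i
  fires, so the event depends only on the configuration inside the decoration of p (i + 1), and its
  probability becomes constant in n. Independence is obtained without counting recurrent
  configurations: overwriting one part of a configuration injects every fibre into every other, so
  all fibres have equal size. The obstacle in the lower bound is a starting point for the product of
  the factors 1 - 2/|C l|: some decoration must pass on a single chip with positive probability. No
  such avalanche is constructed. A large realizable mass itself provides one, and if there is none,
  nothing has to be proved.\<close>

locale wgraph =
  fixes W :: "'v \<Rightarrow> 'v \<Rightarrow> nat" and dg :: "'v \<Rightarrow> nat"
  assumes W_sym: "W x y = W y x"
    and W_finite: "finite {y. W x y \<noteq> 0}"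
    and dg_eq: "dg x = (\<Sum>y | W x y \<noteq> 0. W x y)"
begin

definition inflow :: "'v set \<Rightarrow> ('v \<Rightarrow> nat) \<Rightarrow> 'v \<Rightarrow> nat" where
  "inflow I u w = (\<Sum>y\<in>I. W w y * u y)"

text \<open>Firing every y exactly \<open>u y\<close> times leaves c w + inflow - dg w * u w chips
  at w; the inequality puts this below dg w without using subtraction. Loops cancel, since
  \<open>W w w\<close> occurs both in the inflow and in the degree.\<close>

definition stab_vec :: "'v set \<Rightarrow> 'v config \<Rightarrow> ('v \<Rightarrow> nat) \<Rightarrow> bool" where
  "stab_vec I c u \<longleftrightarrow>
     (\<forall>w. w \<notin> I \<longrightarrow> u w = 0) \<and> (\<forall>w\<in>I. c w + inflow I u w < dg w * Suc (u w))"

definition allowed :: "'v set \<Rightarrow> 'v config \<Rightarrow> bool" where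
  "allowed I c \<longleftrightarrow> (\<forall>U\<subseteq>I. U \<noteq> {} \<longrightarrow> (\<exists>w\<in>U. (\<Sum>u\<in>U. W w u) \<le> c w))"

definition rec_set :: "'v set \<Rightarrow> 'v config set" where
  "rec_set I = {c. (\<forall>w\<in>I. c w < dg w) \<and> (\<forall>w. w \<notin> I \<longrightarrow> c w = 0) \<and> allowed I c}"

text \<open>The minimum is taken at each vertex separately; \<open>odometer_stab_vec\<close> shows
  that the minima fit together to one stabilizing vector.\<close>

definition odometer :: "'v set \<Rightarrow> 'v config \<Rightarrow> 'v \<Rightarrow> nat" where
  "odometer I c w = (LEAST n. \<exists>u. stab_vec I c u \<and> u w = n)"

lemma sum_W_le: "finite U \<Longrightarrow> (\<Sum>u\<in>U. W w u) \<le> dg w"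
proof -
  assume "finite U"
  then have "(\<Sum>u\<in>U. W w u) = (\<Sum>u\<in>U \<inter> {y. W w y \<noteq> 0}. W w u)"
    by (intro sum.mono_neutral_right) auto
  also have "\<dots> \<le> dg w" unfolding dg_eq using W_finite by (intro sum_mono2) auto
  finally show ?thesis .
qed

lemma sum_W_eq:
  assumes "finite U" "\<And>u. u \<notin> U \<Longrightarrow> W w u = 0"
  shows "(\<Sum>u\<in>U. W w u) = dg w"
  unfolding dg_eq using assms by (intro sum.mono_neutral_right) (auto intro: ccontr)

lemma inflow_mono:
  assumes "\<And>y. y \<in> I \<Longrightarrow> u y \<le> u' y"
  shows "inflow I u w \<le> inflow I u' w"
  unfolding inflow_def using assms by (intro sum_mono mult_le_mono) auto

lemma inflow_superset:
  assumes "finite J" "I \<subseteq> J" "\<And>y. y \<in> J - I \<Longrightarrow> W w y = 0 \<or> u y = 0"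
  shows "inflow J u w = inflow I u w"
  unfolding inflow_def using assms by (intro sum.mono_neutral_right) auto

lemma inflow_subset_le:
  assumes "finite J" "I \<subseteq> J"
  shows "inflow I u w \<le> inflow J u w"
  unfolding inflow_def using assms by (intro sum_mono2) auto

lemma W_le_inflow:
  assumes "finite I" "y \<in> I" "u y \<noteq> 0"
  shows "W w y \<le> inflow I u w"
proof -
  have "W w y \<le> W w y * u y" using assms by simp
  also have "\<dots> \<le> inflow I u w"
    unfolding inflow_def using assms by (intro member_le_sum) auto
  finally show ?thesis .
qed

lemma sum_W_le_inflow:
  assumes "finite I" "Y \<subseteq> I" "\<And>y. y \<in> Y \<Longrightarrow> u y \<noteq> 0"
  shows "(\<Sum>y\<in>Y. W w y) \<le> inflow I u w"
proof -
  have "(\<Sum>y\<in>Y. W w y) \<le> (\<Sum>y\<in>Y. W w y * u y)"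
    using assms(3) by (intro sum_mono) (auto simp: Suc_le_eq)
  also have "\<dots> \<le> inflow I u w"
    unfolding inflow_def using assms by (intro sum_mono2) auto
  finally show ?thesis .
qed

lemma odometer_le: "stab_vec I c u \<Longrightarrow> odometer I c w \<le> u w"
  unfolding odometer_def by (rule Least_le) auto

lemma odometer_attained:
  assumes "stab_vec I c u0"
  obtains u where "stab_vec I c u" "odometer I c w = u w"
proof -
  have "\<exists>u. stab_vec I c u \<and> u w = odometer I c w"
    unfolding odometer_def by (rule LeastI[of _ "u0 w"]) (use assms in auto)
  then show ?thesis using that by metis
qed

text \<open>At w take a stabilizing vector that attains the minimum there; passing to the minima
  elsewhere only lowers the inflow into w.\<close>

lemma odometer_stab_vec:
  assumes "stab_vec I c u0"
  shows "stab_vec I c (odometer I c)"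
  unfolding stab_vec_def
proof (intro conjI allI impI ballI)
  fix w assume "w \<notin> I"
  then show "odometer I c w = 0"
    using odometer_le[OF assms, of w] assms unfolding stab_vec_def by simp
next
  fix w assume w: "w \<in> I"
  obtain u where u: "stab_vec I c u" "odometer I c w = u w"
    using odometer_attained[OF assms] .
  have "c w + inflow I (odometer I c) w \<le> c w + inflow I u w"
    using inflow_mono odometer_le[OF u(1)] by simp
  also have "\<dots> < dg w * Suc (u w)" using u w unfolding stab_vec_def by blast
  finally show "c w + inflow I (odometer I c) w < dg w * Suc (odometer I c w)" by (simp add: u)
qed

lemma odometer_eqI:
  assumes "stab_vec I c u" "\<And>u' w. stab_vec I c u' \<Longrightarrow> u w \<le> u' w"
  shows "odometer I c = u"
proof
  fix w
  obtain u' where "stab_vec I c u'" "odometer I c w = u' w"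
    using odometer_attained[OF assms(1)] .
  then show "odometer I c w = u w"
    using assms(2) odometer_le[OF assms(1), of w] by (metis le_antisym)
qed

lemma stab_vec_unfired:
  assumes "stab_vec I c u" "w \<in> I" "u w = 0"
  shows "c w + inflow I u w < dg w"
  using assms unfolding stab_vec_def by fastforce

text \<open>If a set \<open>U\<close> of unfired vertices were nonempty, then the stability of each vertex of \<open>U\<close>
  after the avalanche would make \<open>U\<close> a forbidden subconfiguration.\<close>

lemma fired_spreads:
  assumes c: "allowed I c" "\<And>w. c w \<le> c' w" and u: "stab_vec I c' u" and fin: "finite I"
    and S: "S \<subseteq> I" "x \<in> S" "u x \<noteq> 0"
    and closed: "\<And>w y. w \<in> S \<Longrightarrow> w \<noteq> x \<Longrightarrow> W w y \<noteq> 0 \<Longrightarrow> y \<in> S"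
    and y: "y \<in> S"
  shows "u y \<noteq> 0"
proof
  assume "u y = 0"
  define U where "U = {w\<in>S. u w = 0}"
  have "U \<noteq> {}" "U \<subseteq> I" using y \<open>u y = 0\<close> S(1) unfolding U_def by auto
  then obtain w where w: "w \<in> U" "(\<Sum>y\<in>U. W w y) \<le> c w"
    using c(1) unfolding allowed_def by blast
  have finS: "finite S" using S(1) fin finite_subset by blast
  have "w \<noteq> x" "w \<in> S" "u w = 0" using w(1) S(3) unfolding U_def by auto
  then have "dg w = (\<Sum>y\<in>S. W w y)" using closed finS by (intro sum_W_eq[symmetric]) auto
  also have "\<dots> = (\<Sum>y\<in>U. W w y) + (\<Sum>y\<in>S - U. W w y)"
    using finS by (intro sum.subset_diff[THEN trans[OF _ add.commute]]) (auto simp: U_def)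
  also have "(\<Sum>y\<in>S - U. W w y) \<le> inflow I u w"
    using S(1) fin by (intro sum_W_le_inflow) (auto simp: U_def)
  finally have "dg w \<le> c' w + inflow I u w" using w(2) c(2)[of w] by linarith
  moreover have "c' w + inflow I u w < dg w"
    using stab_vec_unfired[OF u] w(1) S(1) unfolding U_def by blast
  ultimately show False by simp
qed

lemma stab_vec_restrict:
  assumes "stab_vec J c u" "I \<subseteq> J" "finite J" "\<And>w. w \<in> I \<Longrightarrow> c' w = c w"
  shows "stab_vec I c' (\<lambda>w. if w \<in> I then u w else 0)"
  unfolding stab_vec_def
proof (intro conjI allI impI ballI)
  fix w assume w: "w \<in> I"
  have "inflow I (\<lambda>w. if w \<in> I then u w else 0) w = inflow I u w"
    unfolding inflow_def by (rule sum.cong) auto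
  also have "\<dots> \<le> inflow J u w" using assms by (intro inflow_subset_le) auto
  finally show "c' w + inflow I (\<lambda>w. if w \<in> I then u w else 0) w
      < dg w * Suc (if w \<in> I then u w else 0)"
    using assms(1,2,4) w unfolding stab_vec_def by fastforce
qed auto

text \<open>Setting the odometer to 0 outside Z keeps it stabilizing, so minimality makes it vanish
  there. The vertices to check are those outside Z that fired: by \<open>exit\<close> they have no
  neighbour in Z, so they now receive nothing, and they were stable from the start.\<close>

lemma odometer_support:
  assumes ex: "stab_vec I c u0" and fin: "finite I" and Z: "Z \<subseteq> I"
    and stable: "\<And>w. w \<in> I - Z \<Longrightarrow> c w < dg w"
    and exit: "\<And>w y. w \<in> Z \<Longrightarrow> y \<in> I - Z \<Longrightarrow> W w y \<noteq> 0 \<Longrightarrow> odometer I c y = 0"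
    and y: "y \<notin> Z"
  shows "odometer I c y = 0"
proof -
  let ?o = "odometer I c"
  let ?u = "\<lambda>w. if w \<in> Z then ?o w else 0"
  have o: "stab_vec I c ?o" by (rule odometer_stab_vec[OF ex])
  have "stab_vec I c ?u"
    unfolding stab_vec_def
  proof (intro conjI allI impI ballI)
    fix w assume w: "w \<in> I"
    have le: "inflow I ?u w \<le> inflow I ?o w" by (rule inflow_mono) auto
    have ow: "c w + inflow I ?o w < dg w * Suc (?o w)" using o w unfolding stab_vec_def by blast
    show "c w + inflow I ?u w < dg w * Suc (?u w)"
    proof (cases "w \<in> Z \<or> ?o w = 0")
      case True
      then show ?thesis using le ow by (auto simp del: mult_Suc_right)
    next
      case False
      then have "inflow I ?u w = 0"
        unfolding inflow_def using exit[of _ w] w W_sym[of w] by (intro sum.neutral) auto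
      then show ?thesis using False stable w by simp
    qed
  qed (use Z in auto)
  then show ?thesis using odometer_le[of I c ?u y] y by simp
qed

text \<open>A strict supersolution of the Laplacian, read as 0 outside I: an integer certificate
  that I is dissipative. It replaces the Green function. Multiples of it bound odometers and provide
  reverse firings that add chips everywhere, and it shows that the maximal configuration is
  allowed.\<close>

definition superharmonic :: "'v set \<Rightarrow> ('v \<Rightarrow> nat) \<Rightarrow> bool" where
  "superharmonic I h \<longleftrightarrow> (\<forall>w\<in>I. inflow I h w < dg w * h w)"

lemma superharmonic_subset:
  assumes "superharmonic J h" "I \<subseteq> J" "finite J"
  shows "superharmonic I h"
  using assms inflow_subset_le[OF assms(3,2)] unfolding superharmonic_def
  by (meson order.strict_trans1 subsetD)

text \<open>The rank \<open>\<rho>\<close> decreases along some edge at every vertex from which nothing leaks out;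
  the concave function \<open>B ^ (N + 1) - B ^ (N - \<rho>)\<close> of it is superharmonic.\<close>

lemma superharmonic_exists:
  assumes fin: "finite I"
    and rank: "\<And>w. w \<in> I \<Longrightarrow> (\<exists>y. W w y \<noteq> 0 \<and> (y \<notin> I \<or> \<rho> y < (\<rho> w :: nat)))"
  obtains h where "superharmonic I h"
proof -
  define N where "N = Max (insert 0 (\<rho> ` I))"
  \<comment> \<open>B is at least every degree, so the drop along the one good edge outweighs the
    possible gain along all the others.\<close>
  define B where "B = 2 + (\<Sum>w\<in>I. dg w)"
  have \<rho>N: "\<rho> w \<le> N" if "w \<in> I" for w unfolding N_def using that fin by simp
  have dgB: "dg w \<le> B" if "w \<in> I" for w
    using member_le_sum[of w I dg] that fin unfolding B_def by simp
  have B2: "B \<ge> 2" unfolding B_def by simp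
  define h where "h w = B ^ Suc N - B ^ (N - \<rho> w)" for w
  have hle: "B ^ (N - \<rho> w) \<le> B ^ Suc N" for w
    using B2 by (intro power_increasing) auto
  have "inflow I h w < dg w * h w" if w: "w \<in> I" for w
  proof -
    define m where "m = N - \<rho> w"
    obtain y where y: "W w y \<noteq> 0" "y \<notin> I \<or> \<rho> y < \<rho> w" using rank w by blast
    define g where "g z = (if z \<in> I then int (h z) else 0)" for z
    let ?S = "{z. W w z \<noteq> 0}"
    have inv: "int (inflow I h w) = (\<Sum>z\<in>?S. int (W w z) * g z)"
    proof -
      have "int (inflow I h w) = (\<Sum>z\<in>I. int (W w z) * g z)"
        unfolding inflow_def g_def by simp
      also have "\<dots> = (\<Sum>z\<in>I \<inter> ?S. int (W w z) * g z)"
        using fin by (intro sum.mono_neutral_right) auto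
      also have "\<dots> = (\<Sum>z\<in>?S. int (W w z) * g z)"
        using W_finite by (intro sum.mono_neutral_left) (auto simp: g_def)
      finally show ?thesis .
    qed
    have hw: "int (h w) = int B ^ Suc N - int B ^ m"
      using hle[of w] unfolding h_def m_def by (simp add: of_nat_diff)
    have hz: "int (h z) \<le> int (h w) + int B ^ m - 1" for z
    proof -
      have "int (h z) = int B ^ Suc N - int B ^ (N - \<rho> z)"
        using hle[of z] unfolding h_def by (simp add: of_nat_diff)
      moreover have "int B ^ (N - \<rho> z) \<ge> 1" using B2 by simp
      ultimately show ?thesis using hw by linarith
    qed
    have Bm: "int B ^ m \<ge> 1" using B2 by simp
    have gz: "g z \<le> int (h w) + int B ^ m - 1" for z
      using hz[of z] Bm unfolding g_def by auto
    have gy: "g y \<le> int (h w) - (int B - 1) * int B ^ m"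
    proof (cases "y \<in> I")
      case False
      have "int B ^ Suc m \<le> int B ^ Suc N"
        using B2 unfolding m_def by (intro power_increasing) auto
      then show ?thesis using False hw unfolding g_def by (simp add: algebra_simps)
    next
      case True
      then have "\<rho> y < \<rho> w" using y by blast
      then have "Suc m \<le> N - \<rho> y" using \<rho>N[OF w] unfolding m_def by linarith
      then have "int B ^ Suc m \<le> int B ^ (N - \<rho> y)" using B2 by (intro power_increasing) auto
      moreover have "int (h y) = int B ^ Suc N - int B ^ (N - \<rho> y)"
        using hle[of y] unfolding h_def by (simp add: of_nat_diff)
      ultimately show ?thesis using True hw unfolding g_def by (simp add: algebra_simps)
    qed
    \<comment> \<open>An upper bound for all values of g, so that the defects e - g are nonnegative
      and the one at y alone yields the estimate.\<close>
    define e where "e = int (h w) + int B ^ m - 1"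
    have "(\<Sum>z\<in>?S. int (W w z) * (e - g z)) \<ge> int (W w y) * (e - g y)"
      using y(1) W_finite gz unfolding e_def by (intro member_le_sum) (auto intro!: mult_nonneg_nonneg)
    moreover have "int (W w y) * (e - g y) \<ge> 1 * (e - g y)"
      using y(1) gz[of y] unfolding e_def by (intro mult_right_mono) auto
    moreover have "(\<Sum>z\<in>?S. int (W w z) * (e - g z)) = int (dg w) * e - int (inflow I h w)"
      unfolding inv dg_eq by (simp add: right_diff_distrib sum_subtractf sum_distrib_right)
    ultimately have "1 * (e - g y) \<le> int (dg w) * e - int (inflow I h w)"
      by (metis order_trans)
    then have "int (inflow I h w) \<le> int (dg w) * e - (e - g y)"
      by (simp add: algebra_simps)
    also have "\<dots> \<le> int (dg w) * e - (int B * int B ^ m - 1)"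
      using gy unfolding e_def by (simp add: algebra_simps)
    also have "\<dots> = int (dg w) * int (h w) + int (dg w) * (int B ^ m - 1) - (int B * int B ^ m - 1)"
      unfolding e_def by (simp add: algebra_simps)
    also have "\<dots> \<le> int (dg w) * int (h w) + int B * (int B ^ m - 1) - (int B * int B ^ m - 1)"
      using dgB[OF w] Bm B2 by (intro diff_right_mono add_left_mono mult_right_mono) auto
    also have "\<dots> < int (dg w) * int (h w)" using B2 by (simp add: algebra_simps)
    finally show ?thesis by (metis of_nat_less_iff of_nat_mult)
  qed
  then show ?thesis using that unfolding superharmonic_def by blast
qed

lemma superharmonic_scale:
  assumes "superharmonic I h" "w \<in> I"
  shows "inflow I (\<lambda>w. m * h w) w + m \<le> dg w * (m * h w)"
proof -
  have "inflow I (\<lambda>w. m * h w) w = m * inflow I h w"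
    unfolding inflow_def sum_distrib_left by (rule sum.cong) auto
  moreover have "m * (inflow I h w + 1) \<le> m * (dg w * h w)"
    using assms unfolding superharmonic_def by (intro mult_le_mono2) (simp add: Suc_leI)
  ultimately show ?thesis by (simp add: algebra_simps)
qed

text \<open>Scaling h by more than the total number of chips makes its surplus at each vertex absorb
  the chips lying there.\<close>

lemma stab_vec_exists:
  assumes h: "superharmonic I h" and fin: "finite I"
  obtains u where "stab_vec I c u"
proof
  let ?m = "Suc (\<Sum>w\<in>I. c w)"
  show "stab_vec I c (\<lambda>w. if w \<in> I then ?m * h w else 0)"
    unfolding stab_vec_def
  proof (intro conjI allI impI ballI)
    fix w assume w: "w \<in> I"
    have "inflow I (\<lambda>w. if w \<in> I then ?m * h w else 0) w = inflow I (\<lambda>w. ?m * h w) w"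
      unfolding inflow_def by (rule sum.cong) auto
    moreover have "c w \<le> (\<Sum>w\<in>I. c w)" using w fin by (intro member_le_sum) auto
    ultimately show "c w + inflow I (\<lambda>w. if w \<in> I then ?m * h w else 0) w
        < dg w * Suc (if w \<in> I then ?m * h w else 0)"
      using superharmonic_scale[OF h w, of ?m] w by simp
  qed auto
qed

lemma rec_setD:
  assumes "c \<in> rec_set I"
  shows "w \<in> I \<Longrightarrow> c w < dg w" "w \<notin> I \<Longrightarrow> c w = 0" "allowed I c"
  using assms unfolding rec_set_def by auto

text \<open>In a set U the vertex where h is smallest has an edge leaving U, for otherwise its
  inflow would be at least dg times its own value. At this vertex dg - 1 chips are enough.\<close>

lemma max_config_in_rec_set:
  assumes h: "superharmonic I h" and fin: "finite I"
  shows "(\<lambda>w. if w \<in> I then dg w - 1 else 0) \<in> rec_set I"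
proof -
  have pos: "dg w > 0" if "w \<in> I" for w
    using h that unfolding superharmonic_def by (metis gr_zeroI mult_0 not_less_zero)
  have "\<exists>w\<in>U. (\<Sum>u\<in>U. W w u) \<le> (if w \<in> I then dg w - 1 else 0)" if U: "U \<subseteq> I" "U \<noteq> {}" for U
  proof -
    have finU: "finite U" using U fin finite_subset by blast
    obtain w where w: "w \<in> U" "\<And>y. y \<in> U \<Longrightarrow> h w \<le> h y"
      using U(2) finU by (metis arg_min_least arg_min_if_finite(1))
    have "(\<Sum>u\<in>U. W w u) * h w \<le> inflow U h w"
      unfolding inflow_def sum_distrib_right by (intro sum_mono mult_le_mono2 w)
    also have "\<dots> \<le> inflow I h w" by (rule inflow_subset_le[OF fin U(1)])
    also have "\<dots> < dg w * h w" using h w U unfolding superharmonic_def by blast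
    finally have "(\<Sum>u\<in>U. W w u) < dg w" by simp
    then show ?thesis using w U by (intro bexI[of _ w]) auto
  qed
  then show ?thesis using pos unfolding rec_set_def allowed_def by auto
qed

lemma finite_rec_set:
  assumes "finite I"
  shows "finite (rec_set I)"
proof (rule finite_subset)
  show "rec_set I \<subseteq> {c. \<forall>w. (w \<in> I \<longrightarrow> c w \<in> {..(\<Sum>w\<in>I. dg w)}) \<and> (w \<notin> I \<longrightarrow> c w = 0)}"
  proof (clarify, intro conjI impI)
    fix c w assume c: "c \<in> rec_set I" 
    { assume w: "w \<in> I"
      have "c w < dg w" using rec_setD[OF c] w by blast
      also have "dg w \<le> (\<Sum>w\<in>I. dg w)" using w assms by (intro member_le_sum) auto
      finally show "c w \<in> {..(\<Sum>w\<in>I. dg w)}" by simp }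
    { assume "w \<notin> I" then show "c w = 0" using rec_setD[OF c] by blast }
  qed
  show "finite \<dots>" using assms by (intro finite_set_of_finite_funs) auto
qed

text \<open>An allowed configuration is the stabilization of everything obtained from it by reverse
  firing: where the remaining firing numbers are maximal there would be a forbidden
  subconfiguration.\<close>

lemma odometer_reverse_firing:
  assumes c: "c \<in> rec_set I" and fin: "finite I" and g: "\<And>w. w \<notin> I \<Longrightarrow> g w = 0"
    and \<xi>: "\<And>w. w \<in> I \<Longrightarrow> \<xi> w + inflow I g w = c w + dg w * g w"
  shows "odometer I \<xi> = g"
proof (rule odometer_eqI)
  show sg: "stab_vec I \<xi> g"
    unfolding stab_vec_def using g \<xi> rec_setD(1)[OF c] by simp
  fix u' w assume u': "stab_vec I \<xi> u'"
  define o' where "o' = odometer I \<xi>"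
  have o: "stab_vec I \<xi> o'" unfolding o'_def by (rule odometer_stab_vec[OF u'])
  have "g w \<le> o' w"
  proof (rule ccontr)
    assume "\<not> g w \<le> o' w"
    then have w: "o' w < g w" "w \<in> I" using g by (force, metis le0)
    \<comment> \<open>The firings prescribed by g that the odometer leaves out; the set where f is
      maximal will turn out to be forbidden.\<close>
    define f where "f w = int (g w) - int (o' w)" for w
    define m where "m = Max (f ` I)"
    have mle: "f y \<le> m" if "y \<in> I" for y unfolding m_def using that fin by simp
    have mpos: "m > 0" using mle[OF w(2)] w(1) unfolding f_def by simp
    define U where "U = {y\<in>I. f y = m}"
    have "m \<in> f ` I" unfolding m_def using w fin by (intro Max_in) auto
    then have "U \<noteq> {}" "U \<subseteq> I" unfolding U_def by auto
    then obtain x where x: "x \<in> U" "(\<Sum>u\<in>U. W x u) \<le> c x"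
      using rec_setD(3)[OF c] unfolding allowed_def by blast
    have xI: "x \<in> I" "f x = m" using x unfolding U_def by auto
    have "int (\<xi> x) + int (inflow I o' x) < int (dg x) * (int (o' x) + 1)"
      using o xI unfolding stab_vec_def by (metis of_nat_Suc of_nat_add of_nat_less_iff of_nat_mult add.commute)
    moreover have "int (\<xi> x) + int (inflow I g x) = int (c x) + int (dg x) * int (g x)"
      using \<xi>[OF xI(1)] by (metis of_nat_add of_nat_mult)
    ultimately have "int (c x) + int (dg x) * f x < int (dg x) + (int (inflow I g x) - int (inflow I o' x))"
      unfolding f_def by (simp add: algebra_simps)
    also have "int (inflow I g x) - int (inflow I o' x) = (\<Sum>y\<in>I. int (W x y) * f y)"
      unfolding inflow_def f_def by (simp add: sum_subtractf right_diff_distrib)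
    also have "\<dots> = (\<Sum>y\<in>U. int (W x y) * f y) + (\<Sum>y\<in>I-U. int (W x y) * f y)"
      using fin \<open>U \<subseteq> I\<close> by (metis (no_types, lifting) add.commute sum.subset_diff)
    also have "(\<Sum>y\<in>U. int (W x y) * f y) = int (\<Sum>u\<in>U. W x u) * m"
      unfolding of_nat_sum sum_distrib_right by (rule sum.cong) (auto simp: U_def)
    also have "(\<Sum>y\<in>I-U. int (W x y) * f y) \<le> (\<Sum>y\<in>I-U. int (W x y) * (m - 1))"
    proof (intro sum_mono mult_left_mono)
      fix y assume "y \<in> I - U"
      then show "f y \<le> m - 1" using mle[of y] unfolding U_def by fastforce
    qed simp
    also have "\<dots> = int (\<Sum>u\<in>I-U. W x u) * (m - 1)" by (simp add: sum_distrib_right)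
    finally have 1: "int (c x) + int (dg x) * m
        < int (dg x) + int (\<Sum>u\<in>U. W x u) * m + int (\<Sum>u\<in>I-U. W x u) * (m - 1)"
      using xI by simp
    \<comment> \<open>Off U at least one firing fewer is missing, and the weights inside I add up to
      at most dg x. The terms with m then cancel, and what remains is that c x is below the weight
      of U at x.\<close>
    have "(\<Sum>u\<in>I. W x u) = (\<Sum>u\<in>I-U. W x u) + (\<Sum>u\<in>U. W x u)"
      using fin \<open>U \<subseteq> I\<close> by (intro sum.subset_diff)
    then have "int (\<Sum>u\<in>I-U. W x u) \<le> int (dg x) - int (\<Sum>u\<in>U. W x u)"
      using sum_W_le[OF fin, of x] by linarith
    then have "int (\<Sum>u\<in>I-U. W x u) * (m - 1) \<le> (int (dg x) - int (\<Sum>u\<in>U. W x u)) * (m - 1)"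
      using mpos by (intro mult_right_mono) auto
    then have "int (c x) + int (dg x) * m < int (dg x) * m + int (\<Sum>u\<in>U. W x u)"
      using 1 by (simp add: algebra_simps)
    then show False using x(2) by linarith
  qed
  also have "o' w \<le> u' w" unfolding o'_def by (rule odometer_le[OF u'])
  finally show "g w \<le> u' w" .
qed

end

section \<open>Avalanches and least stabilizing vectors\<close>

text \<open>The edges at x are sorted by their other end. Loops form the class of x itself and count
  twice in \<open>chips\<close> as well as in \<open>vdegree\<close>.\<close>

lemma chips_wgraph:
  assumes wf: "wf_multigraph H" and lf: "locally_finite H"
  shows "wgraph (chips H) (vdegree H)"
proof
  show "chips H x y = chips H y x" for x y
    unfolding chips_def by (simp add: insert_commute)
  fix x
  define E where "E = {e \<in> edges H. x \<in> ends H e}"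
  define F where "F y = {e \<in> edges H. ends H e = {x, y}}" for y
  define Y where "Y = {y. F y \<noteq> {}}"
  have "x \<in> verts H" if "E \<noteq> {}" using that wf unfolding E_def wf_multigraph_def by blast
  then have finE: "finite E" using lf unfolding locally_finite_def E_def by (metis finite.emptyI)
  have fin_ends: "finite (ends H e)" if "e \<in> edges H" for e
    using wf that unfolding wf_multigraph_def by (metis card_eq_0_iff zero_neq_one zero_neq_numeral)
  have FE: "F y \<subseteq> E" for y unfolding F_def E_def by auto
  have E_eq: "E = (\<Union>y\<in>Y. F y)"
  proof
    show "E \<subseteq> (\<Union>y\<in>Y. F y)"
    proof
      fix e assume e: "e \<in> E"
      then have "card (ends H e) = 1 \<or> card (ends H e) = 2" "x \<in> ends H e"
        using wf unfolding E_def wf_multigraph_def by auto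
      then obtain y where "ends H e = {x, y}"
        by (force simp: card_1_singleton_iff card_2_iff doubleton_eq_iff insert_commute)
      then show "e \<in> (\<Union>y\<in>Y. F y)" using e unfolding Y_def F_def E_def by auto
    qed
  qed (use FE in auto)
  have finY: "finite Y"
  proof (rule finite_subset)
    show "Y \<subseteq> (\<Union>e\<in>E. ends H e)" unfolding Y_def F_def E_def by auto
    show "finite (\<Union>e\<in>E. ends H e)" using finE fin_ends unfolding E_def by auto
  qed
  have finF: "finite (F y)" for y using FE finE finite_subset by blast
  have chips: "chips H x y = card (F y) + (if y = x then card (F y) else 0)" for y
    unfolding chips_def F_def by simp
  have Y_eq: "{y. chips H x y \<noteq> 0} = Y"
    unfolding chips Y_def using finF by (auto simp: card_eq_0_iff)
  then show "finite {y. chips H x y \<noteq> 0}" using finY by simp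
  have "card E = (\<Sum>y\<in>Y. card (F y))"
    unfolding E_eq by (rule card_UN_disjoint) (use finY finF in \<open>auto simp: F_def doubleton_eq_iff\<close>)
  moreover have "card {e \<in> edges H. ends H e = {x}} = (\<Sum>y\<in>Y. if y = x then card (F y) else 0)"
  proof -
    have "card (F x) = (\<Sum>y\<in>Y. if y = x then card (F y) else 0)"
      using finY by (auto simp: sum.delta Y_def)
    then show ?thesis unfolding F_def by simp
  qed
  ultimately show "vdegree H x = (\<Sum>y | chips H x y \<noteq> 0. chips H x y)"
    unfolding vdegree_def Y_eq E_def[symmetric] by (simp add: chips sum.distrib)
qed

section \<open>Firing sequences on a finite graph with dissipative vertices\<close>

locale sandpile =
  fixes H :: "('v, 'e) multigraph" and P :: "'v set"
  assumes wf: "wf_multigraph H" and locally_finite: "locally_finite H"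
    and finite_verts: "finite (verts H)"

sublocale sandpile \<subseteq> wgraph "chips H" "vdegree H"
  by (rule chips_wgraph[OF wf locally_finite])

context sandpile
begin

abbreviation V0 :: "'v set" where "V0 \<equiv> verts H - P"

lemma finite_V0: "finite V0" using finite_verts by simp

lemma stable_configs_iff:
  "c \<in> stable_configs H P \<longleftrightarrow> (\<forall>w\<in>V0. c w < vdegree H w) \<and> (\<forall>w. w \<notin> V0 \<longrightarrow> c w = 0)"
  unfolding stable_configs_def by simp

lemma inflow_increment:
  assumes "w \<in> V0"
  shows "inflow V0 (u(w := Suc (u w))) y = inflow V0 u y + chips H y w"
proof -
  have "inflow V0 (u(w := Suc (u w))) y = (\<Sum>z\<in>V0. chips H y z * u z + (if z = w then chips H y z else 0))"
    unfolding inflow_def by (rule sum.cong) auto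
  also have "\<dots> = inflow V0 u y + chips H y w"
    unfolding inflow_def sum.distrib using assms finite_V0 by (simp add: sum.delta)
  finally show ?thesis .
qed

text \<open>The bridge between sequences and vectors: a legal firing of w takes one unit at w off
  the vector still to be performed. Legality matters because \<open>fire\<close> subtracts in the
  naturals.\<close>

lemma stab_vec_fire:
  assumes w: "w \<in> V0" and legal: "vdegree H w \<le> \<eta> w"
  shows "stab_vec V0 (fire H P w \<eta>) u \<longleftrightarrow> stab_vec V0 \<eta> (u(w := Suc (u w)))"
proof -
  have "fire H P w \<eta> y + inflow V0 u y < vdegree H y * Suc (u y) \<longleftrightarrow>
      \<eta> y + inflow V0 (u(w := Suc (u w))) y < vdegree H y * Suc ((u(w := Suc (u w))) y)"
    if y: "y \<in> V0" for y
    using y w legal unfolding inflow_increment[OF w] fire_def W_sym[of w y] by auto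
  moreover have "(\<forall>y. y \<notin> V0 \<longrightarrow> (u(w := Suc (u w))) y = 0) \<longleftrightarrow> (\<forall>y. y \<notin> V0 \<longrightarrow> u y = 0)"
    using w by auto
  ultimately show ?thesis unfolding stab_vec_def by (metis (no_types, lifting))
qed

text \<open>Least action principle: a vertex that can fire legally is positive in every stabilizing
  vector, and one unit is removed for the rest of the sequence.\<close>

lemma count_list_le_stab_vec:
  assumes "firing_sequence H P \<eta> ws \<eta>'" "stab_vec V0 \<eta> u"
  shows "count_list ws x \<le> u x"
  using assms
proof (induction \<eta> ws \<eta>' arbitrary: u rule: firing_sequence.induct)
  case (Cons w \<eta> ws \<eta>')
  define u' where "u' = u(w := u w - 1)"
  have "u w \<noteq> 0" using stab_vec_unfired[OF Cons.prems Cons.hyps(1)] Cons.hyps(2) by auto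
  then have u: "u = u'(w := Suc (u' w))" unfolding u'_def by auto
  have "stab_vec V0 (fire H P w \<eta>) u'"
    unfolding stab_vec_fire[of w \<eta>, OF Cons.hyps(1,2)] using Cons.prems by (subst (asm) u)
  from Cons.IH[OF this] show ?case by (subst u) auto
qed simp

lemma stab_vec_count_list:
  assumes "firing_sequence H P \<eta> ws \<eta>'" "\<eta>' \<in> stable_configs H P"
  shows "stab_vec V0 \<eta> (count_list ws)"
  using assms
proof (induction \<eta> ws \<eta>' rule: firing_sequence.induct)
  case (Nil \<eta>)
  then show ?case unfolding stab_vec_def stable_configs_iff by (simp add: inflow_def)
next
  case (Cons w \<eta> ws \<eta>')
  have "count_list (w # ws) = (count_list ws)(w := Suc (count_list ws w))" by (rule ext) simp
  then show ?case
    using stab_vec_fire[of w \<eta>, OF Cons.hyps(1,2)] Cons.IH[OF Cons.prems] by (simp only:)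
qed

text \<open>Conservation of chips. It recovers the final configuration from the firing counts, so
  that uniqueness of the counts gives uniqueness of the stabilization.\<close>

lemma firing_sequence_final:
  assumes "firing_sequence H P \<eta> ws \<eta>'" "w \<in> V0"
  shows "\<eta>' w + vdegree H w * count_list ws w = \<eta> w + inflow V0 (count_list ws) w"
  using assms
proof (induction \<eta> ws \<eta>' rule: firing_sequence.induct)
  case (Nil \<eta>)
  then show ?case by (simp add: inflow_def)
next
  case (Cons x \<eta> ws \<eta>')
  have "count_list (x # ws) = (count_list ws)(x := Suc (count_list ws x))" by (rule ext) simp
  then have "inflow V0 (count_list (x # ws)) w = inflow V0 (count_list ws) w + chips H w x"
    using inflow_increment[OF Cons.hyps(1)] by (simp only:)
  moreover have "count_list (x # ws) w = count_list ws w + (if w = x then 1 else 0)" by simp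
  moreover have "fire H P x \<eta> w = \<eta> w - (if w = x then vdegree H x else 0) + chips H w x"
    using Cons.prems W_sym[of x w] unfolding fire_def by auto
  ultimately show ?case
    using Cons.IH[OF Cons.prems] Cons.hyps(2) by (cases "w = x") (simp_all del: count_list.simps)
qed

text \<open>Any stabilizing vector is a budget: each legal firing lowers its total, so firing as
  long as possible ends in a stable configuration.\<close>

lemma firing_sequence_exists:
  assumes "stab_vec V0 \<eta> u" "\<And>w. w \<notin> V0 \<Longrightarrow> \<eta> w = 0"
  shows "\<exists>ws \<eta>'. firing_sequence H P \<eta> ws \<eta>' \<and> \<eta>' \<in> stable_configs H P"
  using assms
proof (induction "\<Sum>w\<in>V0. u w" arbitrary: \<eta> u rule: less_induct)
  case less
  show ?case
  proof (cases "\<eta> \<in> stable_configs H P")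
    case True
    then show ?thesis using firing_sequence.Nil by blast
  next
    case False
    then obtain w where w: "w \<in> V0" "vdegree H w \<le> \<eta> w"
      using less.prems(2) unfolding stable_configs_iff by force
    define u' where "u' = u(w := u w - 1)"
    have uw: "u w \<noteq> 0" using stab_vec_unfired[OF less.prems(1) w(1)] w(2) by auto
    then have u: "u = u'(w := Suc (u' w))" unfolding u'_def by auto
    have "stab_vec V0 (fire H P w \<eta>) u'"
      unfolding stab_vec_fire[of w \<eta>, OF w] using less.prems(1) by (subst (asm) u)
    moreover have "(\<Sum>w\<in>V0. u' w) < (\<Sum>w\<in>V0. u w)"
      using w(1) uw finite_V0 unfolding u'_def by (intro sum_strict_mono_ex1) auto
    moreover have "fire H P w \<eta> y = 0" if "y \<notin> V0" for y using that unfolding fire_def by auto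
    ultimately show ?thesis using less.hyps[of u'] firing_sequence.Cons[of w H P \<eta>, OF w] by blast
  qed
qed

lemma count_list_eq_odometer:
  assumes "firing_sequence H P \<eta> ws \<eta>'" "\<eta>' \<in> stable_configs H P"
  shows "count_list ws = odometer V0 \<eta>"
  by (rule odometer_eqI[symmetric, OF stab_vec_count_list[OF assms]])
    (rule count_list_le_stab_vec[OF assms(1)])

lemma avalanche_mass_eq:
  assumes "stab_vec V0 (add_chip c v) u" "\<And>w. w \<notin> V0 \<Longrightarrow> c w = 0" "v \<in> V0"
  shows "avalanche_mass H P c v = card {w. odometer V0 (add_chip c v) w \<noteq> 0}"
proof -
  have set: "set ws = {w. odometer V0 (add_chip c v) w \<noteq> 0}"
    if "firing_sequence H P (add_chip c v) ws \<eta>'" "\<eta>' \<in> stable_configs H P" for ws \<eta>'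
    unfolding count_list_eq_odometer[OF that, symmetric] by (auto simp: count_list_0_iff)
  have "\<And>w. w \<notin> V0 \<Longrightarrow> add_chip c v w = 0" using assms unfolding add_chip_def by auto
  from firing_sequence_exists[OF assms(1) this] obtain ws \<eta>' where
    ws: "firing_sequence H P (add_chip c v) ws \<eta>'" "\<eta>' \<in> stable_configs H P" by blast
  show ?thesis
    unfolding avalanche_mass_def
  proof (rule the_equality)
    show "\<exists>ws \<eta>'. firing_sequence H P (add_chip c v) ws \<eta>' \<and> \<eta>' \<in> stable_configs H P \<and>
        card {w. odometer V0 (add_chip c v) w \<noteq> 0} = card (set ws)"
      using ws set[OF ws] by (intro exI[of _ ws] exI[of _ \<eta>']) simp
  qed (use set in auto)
qed

lemma stable_final_unique:
  assumes "firing_sequence H P \<eta> ws \<eta>'" "\<eta>' \<in> stable_configs H P"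
    "firing_sequence H P \<eta> ws' \<eta>''" "\<eta>'' \<in> stable_configs H P"
  shows "\<eta>' = \<eta>''"
proof
  fix w
  show "\<eta>' w = \<eta>'' w"
  proof (cases "w \<in> V0")
    case True
    have "count_list ws = count_list ws'"
      using count_list_eq_odometer[OF assms(1,2)] count_list_eq_odometer[OF assms(3,4)] by simp
    then show ?thesis
      using firing_sequence_final[OF assms(1) True] firing_sequence_final[OF assms(3) True] by simp
  qed (use assms stable_configs_iff in auto)
qed

lemma stabilization_eqI:
  assumes "firing_sequence H P \<eta> ws \<eta>'" "\<eta>' \<in> stable_configs H P"
  shows "stabilization H P \<eta> = \<eta>'"
  unfolding stabilization_def by (rule the_equality) (use assms stable_final_unique in blast)+

lemma firing_sequence_add:
  assumes "firing_sequence H P \<eta> ws \<eta>'" "\<And>w. w \<notin> V0 \<Longrightarrow> b w = 0"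
  shows "firing_sequence H P (\<lambda>w. \<eta> w + b w) ws (\<lambda>w. \<eta>' w + b w)"
  using assms(1)
proof (induction \<eta> ws \<eta>' rule: firing_sequence.induct)
  case (Nil \<eta>)
  show ?case by (rule firing_sequence.Nil)
next
  case (Cons w \<eta> ws \<eta>')
  have "fire H P w (\<lambda>w. \<eta> w + b w) = (\<lambda>y. fire H P w \<eta> y + b y)"
    using Cons.hyps(1,2) assms(2) unfolding fire_def by fastforce
  then show ?case using Cons by (intro firing_sequence.Cons) auto
qed

lemma firing_sequence_append:
  assumes "firing_sequence H P \<eta> ws \<eta>'" "firing_sequence H P \<eta>' ws' \<eta>''"
  shows "firing_sequence H P \<eta> (ws @ ws') \<eta>''"
  using assms by (induction \<eta> ws \<eta>' rule: firing_sequence.induct) (auto intro: firing_sequence.Cons)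

text \<open>For U other than {x}, test U - {x} before the firing: its witness w gains exactly the
  chips along its edges to x, which pay for x joining the set. For U = {x} the chips returned by the
  loops at x suffice.\<close>

lemma allowed_fire:
  assumes c: "allowed V0 \<eta>" and x: "x \<in> V0" "vdegree H x \<le> \<eta> x"
  shows "allowed V0 (fire H P x \<eta>)"
  unfolding allowed_def
proof (intro allI impI)
  fix U assume U: "U \<subseteq> V0" "U \<noteq> {}"
  have finU: "finite U" using U finite_V0 finite_subset by blast
  have fire: "fire H P x \<eta> w = \<eta> w - (if w = x then vdegree H w else 0) + chips H x w"
    if "w \<in> U" for w
    using that U unfolding fire_def by auto
  show "\<exists>w\<in>U. (\<Sum>u\<in>U. chips H w u) \<le> fire H P x \<eta> w"
  proof (cases "U = {x}")
    case True
    then show ?thesis using fire[of x] by simp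
  next
    case False
    then obtain w where w: "w \<in> U - {x}" "(\<Sum>u\<in>U - {x}. chips H w u) \<le> \<eta> w"
      using c U unfolding allowed_def by (metis Diff_eq_empty_iff Diff_subset order.trans subset_singleton_iff)
    have "(\<Sum>u\<in>U. chips H w u) \<le> (\<Sum>u\<in>U - {x}. chips H w u) + chips H w x"
      using finU by (cases "x \<in> U") (simp_all add: sum.remove)
    then show ?thesis using w fire[of w] W_sym[of x w] by (intro bexI[of _ w]) auto
  qed
qed

lemma allowed_firing_sequence:
  assumes "firing_sequence H P \<eta> ws \<eta>'" "allowed V0 \<eta>"
  shows "allowed V0 \<eta>'"
  using assms by (induction \<eta> ws \<eta>' rule: firing_sequence.induct) (auto intro: allowed_fire)

lemma rec_set_eq: "rec_set V0 = {c \<in> stable_configs H P. allowed V0 c}"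
  unfolding rec_set_def stable_configs_def by auto

end

section \<open>Recurrent configurations\<close>

lemma weighted_average_eqD:
  fixes g :: "'s \<Rightarrow> real"
  assumes fin: "finite (set_pmf M)" and avg: "(\<Sum>z\<in>set_pmf M. g z * pmf M z) = m"
    and ge: "\<And>z. z \<in> set_pmf M \<Longrightarrow> g z \<ge> m" and z: "z \<in> set_pmf M"
  shows "g z = m"
proof -
  have "(\<Sum>z\<in>set_pmf M. pmf M z) = 1" using fin by (intro sum_pmf_eq_1) auto
  then have "(\<Sum>z\<in>set_pmf M. (g z - m) * pmf M z) = 0"
    using avg by (simp add: left_diff_distrib sum_subtractf sum_distrib_left[symmetric])
  then have "(g z - m) * pmf M z = 0"
    using sum_nonneg_eq_0_iff[of "set_pmf M" "\<lambda>z. (g z - m) * pmf M z"] fin ge z by simp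
  then show ?thesis using z by (simp add: set_pmf_iff)
qed

context
  fixes K :: "'s \<Rightarrow> 's pmf" and y :: 's
  assumes fin_K: "\<And>x. finite (set_pmf (K x))"
begin

lemma hit_within_Suc:
  "hit_within K y (Suc n) x =
     (\<Sum>z\<in>set_pmf (K x). (if z = y then 1 else hit_within K y n z) * pmf (K x) z)"
  unfolding hit_within.simps by (rule integral_measure_pmf_real) (use fin_K in auto)

lemma sum_pmf_K: "(\<Sum>z\<in>set_pmf (K x). pmf (K x) z) = 1"
  using fin_K by (intro sum_pmf_eq_1) auto

lemma hit_within_le_1: "hit_within K y n x \<le> 1"
proof (induction n arbitrary: x)
  case (Suc n)
  have "hit_within K y (Suc n) x \<le> (\<Sum>z\<in>set_pmf (K x). 1 * pmf (K x) z)"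
    unfolding hit_within_Suc using Suc by (intro sum_mono mult_right_mono) auto
  then show ?case using sum_pmf_K by simp
qed simp

lemma hit_within_nonneg: "0 \<le> hit_within K y n x"
proof (induction n arbitrary: x)
  case (Suc n)
  show ?case unfolding hit_within_Suc by (intro sum_nonneg mult_nonneg_nonneg) (use Suc in auto)
qed simp

lemma hit_within_mono: "hit_within K y n x \<le> hit_within K y (Suc n) x"
proof (induction n arbitrary: x)
  case 0
  show ?case using hit_within_nonneg[of "Suc 0" x] by simp
next
  case (Suc n)
  show ?case
    unfolding hit_within_Suc[of "Suc n" x] hit_within_Suc[of n x]
    by (intro sum_mono mult_right_mono) (use Suc in \<open>auto simp del: hit_within.simps\<close>)
qed

text \<open>Bounded monotone limits inherit the first-step equation. The state y is treated apart in
  it, because \<open>f y\<close> is the probability of returning to y.\<close>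

lemma hitting_probability:
  obtains f where "\<And>x. (\<lambda>n. hit_within K y n x) \<longlonglongrightarrow> f x" "\<And>x. f x \<le> 1"
    "\<And>x. (\<Sum>z\<in>set_pmf (K x). (if z = y then 1 else f z) * pmf (K x) z) = f x"
proof -
  have inc: "incseq (\<lambda>n. hit_within K y n x)" for x
    using hit_within_mono by (intro incseq_SucI)
  have "\<exists>l. (\<lambda>n. hit_within K y n x) \<longlonglongrightarrow> l \<and> l \<le> 1" for x
    using incseq_convergent[OF inc, of x 1] hit_within_le_1
    by (metis LIMSEQ_le_const2)
  then obtain f where f: "\<And>x. (\<lambda>n. hit_within K y n x) \<longlonglongrightarrow> f x" "\<And>x. f x \<le> 1" by metis
  have "(\<Sum>z\<in>set_pmf (K x). (if z = y then 1 else f z) * pmf (K x) z) = f x" for x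
  proof (rule LIMSEQ_unique)
    show "(\<lambda>n. hit_within K y (Suc n) x)
        \<longlonglongrightarrow> (\<Sum>z\<in>set_pmf (K x). (if z = y then 1 else f z) * pmf (K x) z)"
      unfolding hit_within_Suc by (intro tendsto_sum tendsto_mult tendsto_const) (use f in auto)
    show "(\<lambda>n. hit_within K y (Suc n) x) \<longlonglongrightarrow> f x" by (rule LIMSEQ_Suc[OF f(1)])
  qed
  with f show ?thesis using that by blast
qed

text \<open>Maximum principle: a minimum below 1 of the hitting probability would propagate to all
  successors, and none of them could be \<open>y\<close>.\<close>

lemma recurrent_stateI:
  assumes S: "finite S" "y \<in> S" and closed: "\<And>x. x \<in> S \<Longrightarrow> set_pmf (K x) \<subseteq> S"
    and reach: "\<And>x. x \<in> S \<Longrightarrow> (\<lambda>a b. b \<in> set_pmf (K a))\<^sup>*\<^sup>* x y"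
  shows "recurrent_state K y"
proof -
  obtain f where f: "\<And>x. (\<lambda>n. hit_within K y n x) \<longlonglongrightarrow> f x" "\<And>x. f x \<le> 1"
    "\<And>x. (\<Sum>z\<in>set_pmf (K x). (if z = y then 1 else f z) * pmf (K x) z) = f x"
    using hitting_probability by blast
  define m where "m = Min (f ` S)"
  have m: "m \<le> f x" if "x \<in> S" for x unfolding m_def using that S by simp
  have "m \<ge> 1"
  proof (rule ccontr)
    assume "\<not> m \<ge> 1"
    then have m1: "m < 1" by simp
    have step: "b \<in> S \<and> f b = m \<and> b \<noteq> y" if "a \<in> S" "f a = m" "b \<in> set_pmf (K a)" for a b
    proof -
      have "(if b = y then 1 else f b) = m"
        by (rule weighted_average_eqD[OF fin_K _ _ that(3)])
          (use f(3)[of a] that closed[of a] m m1 in \<open>auto simp: less_imp_le\<close>)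
      then show ?thesis using m1 closed[OF that(1)] that(3) by (auto split: if_splits)
    qed
    have "m \<in> f ` S" unfolding m_def using S by (intro Min_in) auto
    then obtain x where x: "x \<in> S" "f x = m" by auto
    obtain z where "z \<in> set_pmf (K x)" using set_pmf_not_empty by fast
    then have z: "z \<in> S \<and> f z = m \<and> z \<noteq> y" using step x by blast
    have "(\<lambda>a b. b \<in> set_pmf (K a))\<^sup>*\<^sup>* z y" using reach z by blast
    moreover have "w \<in> S \<and> f w = m \<and> w \<noteq> y" if "(\<lambda>a b. b \<in> set_pmf (K a))\<^sup>*\<^sup>* z w" for w
      using that
    proof (induction rule: rtranclp_induct)
      case (step a b)
      then show ?case using \<open>\<And>a b. a \<in> S \<Longrightarrow> f a = m \<Longrightarrow> b \<in> set_pmf (K a) \<Longrightarrow> b \<in> S \<and> f b = m \<and> b \<noteq> y\<close>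
        by blast
    qed (rule z)
    ultimately show False by blast
  qed
  then have "f y = 1" using m[OF S(2)] f(2)[of y] by linarith
  then show ?thesis unfolding recurrent_state_def using f(1)[of y] by simp
qed

text \<open>Maximum principle at the value 1: if \<open>f y = 1\<close>, this spreads to every state
  reachable from y, hence to x. But A is closed and misses y, so the hitting probability vanishes on
  A.\<close>

lemma not_recurrent_stateI:
  assumes "(\<lambda>a b. b \<in> set_pmf (K a))\<^sup>*\<^sup>* y x" "x \<in> A" "y \<notin> A"
    and closed: "\<And>x. x \<in> A \<Longrightarrow> set_pmf (K x) \<subseteq> A"
  shows "\<not> recurrent_state K y"
proof
  assume rec: "recurrent_state K y"
  obtain f where f: "\<And>x. (\<lambda>n. hit_within K y n x) \<longlonglongrightarrow> f x" "\<And>x. f x \<le> 1"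
    "\<And>x. (\<Sum>z\<in>set_pmf (K x). (if z = y then 1 else f z) * pmf (K x) z) = f x"
    using hitting_probability by blast
  have fy: "f y = 1" using rec f(1) LIMSEQ_unique unfolding recurrent_state_def by blast
  have "f x = 1"
    using assms(1)
  proof (induction rule: rtranclp_induct)
    case (step a b)
    \<comment> \<open>Negated, so that the maximum 1 becomes a minimum as in
      \<open>weighted_average_eqD\<close>.\<close>
    have "(\<Sum>z\<in>set_pmf (K a). (- (if z = y then 1 else f z)) * pmf (K a) z) = - 1"
      using f(3)[of a] step.IH by (simp add: sum_negf)
    then have "- (if b = y then 1 else f b) = - 1"
      by (rule weighted_average_eqD[OF fin_K _ _ step.hyps(2)]) (use f(2) in auto)
    then show ?case using fy by (auto split: if_splits)
  qed (rule fy)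
  moreover have "hit_within K y n z = 0" if "z \<in> A" for n z
    using that
  proof (induction n arbitrary: z)
    case (Suc n)
    have "(if w = y then 1 else hit_within K y n w) * pmf (K z) w = 0" if "w \<in> set_pmf (K z)" for w
      using that Suc closed[of z] assms(3) by auto
    then show ?case unfolding hit_within_Suc by (intro sum.neutral) auto
  qed simp
  then have "f x = 0" using f(1)[of x] assms(2) by (simp add: LIMSEQ_const_iff)
  ultimately show False by simp
qed

end

section \<open>The recurrent states of the sandpile chain\<close>

context sandpile
begin

lemma add_chip_zero: "\<lbrakk>\<And>w. w \<notin> V0 \<Longrightarrow> c w = 0; w \<in> V0; y \<notin> V0\<rbrakk> \<Longrightarrow> add_chip c w y = 0"
  unfolding add_chip_def by auto

lemma stabilization_spec:
  assumes "superharmonic V0 h" "\<And>w. w \<notin> V0 \<Longrightarrow> \<eta> w = 0"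
  obtains ws where "firing_sequence H P \<eta> ws (stabilization H P \<eta>)"
    "stabilization H P \<eta> \<in> stable_configs H P"
proof -
  obtain u where "stab_vec V0 \<eta> u" using stab_vec_exists[OF assms(1) finite_V0] by blast
  then obtain ws \<eta>' where "firing_sequence H P \<eta> ws \<eta>'" "\<eta>' \<in> stable_configs H P"
    using firing_sequence_exists assms(2) by metis
  then show ?thesis using stabilization_eqI that by metis
qed

text \<open>A transition of positive probability, for any law of the added chip with support
  \<open>V0\<close>.\<close>

definition chip_step :: "'v config \<Rightarrow> 'v config \<Rightarrow> bool" where
  "chip_step c c' \<longleftrightarrow> (\<exists>w\<in>V0. c' = stabilization H P (add_chip c w))"

text \<open>Abelian property: the chips of \<xi> exceeding c may be added one by one with
  stabilization in between, with the same result as stabilizing all of them at once.\<close>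

lemma chip_steps_to_stabilization:
  assumes h: "superharmonic V0 h" and c: "c \<in> stable_configs H P"
    and \<xi>: "\<And>w. c w \<le> \<xi> w" "\<And>w. w \<notin> V0 \<Longrightarrow> \<xi> w = 0"
  shows "chip_step\<^sup>*\<^sup>* c (stabilization H P \<xi>)"
  using c \<xi>
proof (induction "\<Sum>w\<in>V0. \<xi> w - c w" arbitrary: c \<xi> rule: less_induct)
  case less
  show ?case
  proof (cases "\<xi> = c")
    case True
    then show ?thesis
      using stabilization_eqI[OF firing_sequence.Nil, of \<xi>] less.prems(1) by simp
  next
    case False
    then obtain w where "\<xi> w \<noteq> c w" by auto
    then have w: "c w < \<xi> w" using less.prems(2)[of w] by simp
    then have wV: "w \<in> V0" using less.prems(3) by (metis not_less0)
    have zero: "\<And>y. y \<notin> V0 \<Longrightarrow> c y = 0" using less.prems(1) unfolding stable_configs_iff by blast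
    define c1 where "c1 = stabilization H P (add_chip c w)"
    have "add_chip c w y = 0" if "y \<notin> V0" for y using add_chip_zero zero wV that by blast
    from stabilization_spec[of h "add_chip c w", OF h this]
    obtain ws where ws: "firing_sequence H P (add_chip c w) ws c1" "c1 \<in> stable_configs H P"
      unfolding c1_def by blast
    \<comment> \<open>The stock of chips still to be added; it lies idle during the firings
      \<open>ws\<close>.\<close>
    define b where "b y = \<xi> y - add_chip c w y" for y
    have b0: "b y = 0" if "y \<notin> V0" for y unfolding b_def using less.prems(3) that by simp
    have "add_chip c w y \<le> \<xi> y" for y
      using less.prems(2)[of y] w unfolding add_chip_def by auto
    then have \<xi>: "\<xi> = (\<lambda>y. add_chip c w y + b y)" unfolding b_def by auto
    define \<xi>1 where "\<xi>1 = (\<lambda>y. c1 y + b y)"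
    have 1: "firing_sequence H P \<xi> ws \<xi>1"
      using firing_sequence_add[of "add_chip c w" ws c1 b, OF ws(1) b0] unfolding \<xi>1_def \<xi>[symmetric] by simp
    have zero1: "\<xi>1 y = 0" if "y \<notin> V0" for y
      using that ws(2) b0 unfolding \<xi>1_def stable_configs_iff by auto
    obtain ws' where ws': "firing_sequence H P \<xi>1 ws' (stabilization H P \<xi>1)"
      "stabilization H P \<xi>1 \<in> stable_configs H P"
      using stabilization_spec[of h \<xi>1, OF h zero1] by blast
    have eq: "stabilization H P \<xi> = stabilization H P \<xi>1"
      using stabilization_eqI[OF firing_sequence_append[OF 1 ws'(1)] ws'(2)] .
    have "(\<Sum>y\<in>V0. \<xi>1 y - c1 y) < (\<Sum>y\<in>V0. \<xi> y - c y)"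
      using w wV finite_V0
      by (intro sum_strict_mono_ex1) (auto simp: \<xi>1_def b_def add_chip_def intro!: bexI[of _ w])
    then have "chip_step\<^sup>*\<^sup>* c1 (stabilization H P \<xi>1)"
      using less.hyps ws(2) zero1 unfolding \<xi>1_def by simp
    moreover have "chip_step c c1" unfolding chip_step_def c1_def using wV by blast
    ultimately show ?thesis unfolding eq by simp
  qed
qed

lemma rec_set_chip_step:
  assumes "superharmonic V0 h" "c \<in> rec_set V0" "chip_step c c'"
  shows "c' \<in> rec_set V0"
proof -
  obtain w where w: "w \<in> V0" "c' = stabilization H P (add_chip c w)"
    using assms(3) unfolding chip_step_def by blast
  have "add_chip c w y = 0" if "y \<notin> V0" for y
    using add_chip_zero rec_setD(2)[OF assms(2)] w(1) that by blast
  from stabilization_spec[of h "add_chip c w", OF assms(1) this]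
  obtain ws where ws: "firing_sequence H P (add_chip c w) ws c'" "c' \<in> stable_configs H P"
    using w(2) by blast
  have "allowed V0 (add_chip c w)"
    using rec_setD(3)[OF assms(2)] unfolding allowed_def add_chip_def
    by (metis fun_upd_apply le_add1 order.trans)
  then show ?thesis using allowed_firing_sequence[OF ws(1)] ws(2) unfolding rec_set_eq by blast
qed

text \<open>Firing \<open>m * h\<close> in reverse from c raises each vertex by at least m, the sum
  of all degrees, so the result \<xi> dominates the stable c0. By
  \<open>odometer_reverse_firing\<close> the stabilization of \<xi> undoes exactly these firings and
  returns to c.\<close>

lemma chip_steps_to_rec_set:
  assumes h: "superharmonic V0 h" and c: "c \<in> rec_set V0" and c0: "c0 \<in> stable_configs H P"
  shows "chip_step\<^sup>*\<^sup>* c0 c"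
proof -
  define m where "m = (\<Sum>w\<in>V0. vdegree H w)"
  define g where "g w = (if w \<in> V0 then m * h w else 0)" for w
  define \<xi> where "\<xi> w = (if w \<in> V0 then c w + vdegree H w * g w - inflow V0 g w else 0)" for w
  have g: "inflow V0 g w + m \<le> vdegree H w * g w" if "w \<in> V0" for w
  proof -
    have "inflow V0 g w = inflow V0 (\<lambda>w. m * h w) w"
      unfolding inflow_def g_def by (rule sum.cong) auto
    then show ?thesis using superharmonic_scale[OF h that, of m] that unfolding g_def by simp
  qed
  have \<xi>: "\<xi> w + inflow V0 g w = c w + vdegree H w * g w" if "w \<in> V0" for w
    using g[OF that] that unfolding \<xi>_def by simp
  have "c0 w \<le> \<xi> w" for w
  proof (cases "w \<in> V0")
    case True
    have "c0 w < vdegree H w" using c0 True unfolding stable_configs_iff by blast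
    also have "\<dots> \<le> m" unfolding m_def using True finite_V0 by (intro member_le_sum) auto
    finally show ?thesis using \<xi>[OF True] g[OF True] by linarith
  qed (use c0 stable_configs_iff in auto)
  moreover have zero: "\<And>w. w \<notin> V0 \<Longrightarrow> \<xi> w = 0" unfolding \<xi>_def by auto
  ultimately have steps: "chip_step\<^sup>*\<^sup>* c0 (stabilization H P \<xi>)"
    using chip_steps_to_stabilization[OF h c0] by blast
  obtain ws where ws: "firing_sequence H P \<xi> ws (stabilization H P \<xi>)"
    "stabilization H P \<xi> \<in> stable_configs H P"
    using stabilization_spec[of h \<xi>, OF h zero] by blast
  have "g w = 0" if "w \<notin> V0" for w using that unfolding g_def by auto
  then have od: "count_list ws = g"
    using count_list_eq_odometer[OF ws] odometer_reverse_firing[of c V0 g \<xi>, OF c finite_V0 _ \<xi>]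
    by simp
  have "stabilization H P \<xi> = c"
  proof
    fix w
    show "stabilization H P \<xi> w = c w"
    proof (cases "w \<in> V0")
      case True
      then show ?thesis using firing_sequence_final[OF ws(1) True] \<xi>[OF True] unfolding od by simp
    next
      case False
      then show ?thesis using ws(2) rec_setD(2)[OF c] unfolding stable_configs_iff by auto
    qed
  qed
  then show ?thesis using steps by simp
qed

text \<open>The allowed stable configurations are closed under the chain, and each can be reached
  from every stable configuration. So they are recurrent, and any other configuration can be
  absorbed by them without return.\<close>

theorem recurrent_configs_eq:
  assumes h: "superharmonic V0 h" and ne: "V0 \<noteq> {}"
  shows "recurrent_configs H P = rec_set V0"
proof -
  have K: "b \<in> set_pmf (sandpile_chain H P q a) \<longleftrightarrow> chip_step a b" if "set_pmf q = V0" for q a b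
    using that unfolding sandpile_chain_def chip_step_def by auto
  have finK: "finite (set_pmf (sandpile_chain H P q a))" if "set_pmf q = V0" for q a
    using that finite_V0 unfolding sandpile_chain_def by simp
  have "recurrent_state (sandpile_chain H P q) c" if "c \<in> rec_set V0" "set_pmf q = V0" for c q
  proof (rule recurrent_stateI[where S = "rec_set V0"])
    show "finite (rec_set V0)" by (rule finite_rec_set[OF finite_V0])
    show "set_pmf (sandpile_chain H P q x) \<subseteq> rec_set V0" if "x \<in> rec_set V0" for x
      using rec_set_chip_step[OF h that] K[OF \<open>set_pmf q = V0\<close>] by blast
    show "(\<lambda>a b. b \<in> set_pmf (sandpile_chain H P q a))\<^sup>*\<^sup>* x c" if "x \<in> rec_set V0" for x
      using chip_steps_to_rec_set[OF h \<open>c \<in> rec_set V0\<close>, of x] that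
      unfolding K[OF \<open>set_pmf q = V0\<close>] rec_set_eq by auto
  qed (use that finK in auto)
  moreover have "c \<in> rec_set V0"
    if c: "c \<in> stable_configs H P"
      and rec: "\<And>q. set_pmf q = V0 \<Longrightarrow> recurrent_state (sandpile_chain H P q) c" for c
  proof (rule ccontr)
    assume nc: "c \<notin> rec_set V0"
    \<comment> \<open>One admissible law is enough to refute membership, since
      \<open>recurrent_configs\<close> asks for recurrence under all of them.\<close>
    let ?q = "pmf_of_set V0"
    have q: "set_pmf ?q = V0" using ne finite_V0 by (rule set_pmf_of_set)
    have "\<not> recurrent_state (sandpile_chain H P ?q) c"
    proof (rule not_recurrent_stateI[where A = "rec_set V0"])
      show "(\<lambda>a b. b \<in> set_pmf (sandpile_chain H P ?q a))\<^sup>*\<^sup>* c (\<lambda>w. if w \<in> V0 then vdegree H w - 1 else 0)"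
        using chip_steps_to_rec_set[OF h max_config_in_rec_set[OF h finite_V0] c] unfolding K[OF q] .
      show "set_pmf (sandpile_chain H P ?q x) \<subseteq> rec_set V0" if "x \<in> rec_set V0" for x
        using rec_set_chip_step[OF h that] K[OF q] by blast
    qed (use nc finK[OF q] max_config_in_rec_set[OF h finite_V0] in auto)
    then show False using rec[OF q] by blast
  qed
  ultimately show ?thesis unfolding recurrent_configs_def rec_set_eq by auto
qed

end

section \<open>Gluing at a single vertex\<close>

text \<open>Injections between any two fibres, in both directions, force equal cardinalities, so
  uniform counting on S becomes uniform counting on T. No bijection has to be exhibited.\<close>

lemma card_fibres:
  assumes fin: "finite S" "finite T" and f: "f ` S \<subseteq> T"
    and inj: "\<And>x y. x \<in> T \<Longrightarrow> y \<in> T \<Longrightarrow>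
      \<exists>\<phi>. inj_on \<phi> {s\<in>S. f s = x} \<and> \<phi> ` {s\<in>S. f s = x} \<subseteq> {s\<in>S. f s = y}"
  obtains g where "\<And>A. A \<subseteq> T \<Longrightarrow> card {s\<in>S. f s \<in> A} = g * card A"
proof -
  have le: "card {s\<in>S. f s = x} \<le> card {s\<in>S. f s = y}" if "x \<in> T" "y \<in> T" for x y
    using inj[OF that] fin(1) by (metis (no_types, lifting) card_inj_on_le finite_Collect_conjI finite_subset mem_Collect_eq subsetI)
  define g where "g = card {s\<in>S. f s = (SOME x. x \<in> T)}"
  have g: "card {s\<in>S. f s = x} = g" if "x \<in> T" for x
    unfolding g_def using le[OF that someI[of "\<lambda>x. x \<in> T", OF that]]
      le[OF someI[of "\<lambda>x. x \<in> T", OF that] that] by simp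
  have "card {s\<in>S. f s \<in> A} = g * card A" if A: "A \<subseteq> T" for A
  proof -
    have "{s\<in>S. f s \<in> A} = (\<Union>x\<in>A. {s\<in>S. f s = x})" by auto
    also have "card \<dots> = (\<Sum>x\<in>A. card {s\<in>S. f s = x})"
      using A fin finite_subset by (intro card_UN_disjoint) auto
    also have "\<dots> = (\<Sum>x\<in>A. g)" using g A by (intro sum.cong) auto
    finally show ?thesis by simp
  qed
  then show ?thesis using that by blast
qed

definition restr :: "'v set \<Rightarrow> 'v config \<Rightarrow> 'v config" where
  "restr I c = (\<lambda>w. if w \<in> I then c w else 0)"

context wgraph
begin

definition cut_off :: "'v set \<Rightarrow> 'v \<Rightarrow> bool" where
  "cut_off I p \<longleftrightarrow> finite I \<and> p \<notin> I \<and> (\<forall>w\<in>I. \<forall>u. u \<notin> I \<longrightarrow> u \<noteq> p \<longrightarrow> W w u = 0)"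

lemma cut_off_edge: "cut_off I p \<Longrightarrow> w \<in> I \<Longrightarrow> u \<notin> I \<Longrightarrow> u \<noteq> p \<Longrightarrow> W w u = 0"
  unfolding cut_off_def by blast

lemma cut_off_sum:
  assumes "cut_off I p" "w \<in> I" "insert p I \<subseteq> U" "finite U"
  shows "(\<Sum>u\<in>U. W w u) = dg w"
  using assms unfolding cut_off_def by (intro sum_W_eq) auto

lemma rec_set_restr:
  assumes "c \<in> rec_set J" "I \<subseteq> J"
  shows "restr I c \<in> rec_set I"
  using assms unfolding rec_set_def restr_def allowed_def
  by (auto simp: subset_iff)

text \<open>If a forbidden set U contains p, all of I may be added to it: the vertices of I then see
  their full degree, so the witness in the old configuration lies outside I, where nothing changed.
  If p is not in U, the part of U inside I is isolated from the rest of U and is judged by a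
  alone.\<close>

lemma rec_set_override:
  assumes cut: "cut_off I p" and J: "I \<subseteq> J" "finite J"
    and c: "c \<in> rec_set J" and a: "a \<in> rec_set I"
  shows "override_on c a I \<in> rec_set J"
proof -
  let ?c = "override_on c a I"
  have "\<exists>w\<in>U. (\<Sum>u\<in>U. W w u) \<le> ?c w" if U: "U \<subseteq> J" "U \<noteq> {}" for U
  proof (rule ccontr)
    assume "\<not> ?thesis"
    then have forb: "\<And>w. w \<in> U \<Longrightarrow> ?c w < (\<Sum>u\<in>U. W w u)" by (simp add: not_le)
    have finU: "finite U" using U J finite_subset by blast
    show False
    proof (cases "p \<in> U")
      case True
      have fin: "finite (U \<union> I)" using finU J finite_subset by blast
      have "U \<union> I \<subseteq> J" "U \<union> I \<noteq> {}" using U J by auto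
      then obtain w where w: "w \<in> U \<union> I" "(\<Sum>u\<in>U \<union> I. W w u) \<le> c w"
        using rec_setD(3)[OF c] unfolding allowed_def by blast
      show False
      proof (cases "w \<in> I")
        case wI: True
        then have "(\<Sum>u\<in>U \<union> I. W w u) = dg w" using True fin cut by (intro cut_off_sum) auto
        then show False using w rec_setD(1)[OF c, of w] wI J by auto
      next
        case False
        have "(\<Sum>u\<in>U. W w u) \<le> (\<Sum>u\<in>U \<union> I. W w u)" using fin by (intro sum_mono2) auto
        then show False using forb[of w] w False by auto
      qed
    next
      case False
      show False
      proof (cases "U \<inter> I = {}")
        case True
        then show False
          using rec_setD(3)[OF c] U forb unfolding allowed_def
          by (metis disjoint_iff not_le override_on_apply_notin)
      next
        case ne: False
        then obtain w where w: "w \<in> U \<inter> I" "(\<Sum>u\<in>U \<inter> I. W w u) \<le> a w"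
          using rec_setD(3)[OF a] unfolding allowed_def by (metis inf_le2)
        have "(\<Sum>u\<in>U. W w u) = (\<Sum>u\<in>U \<inter> I. W w u)"
        proof (intro sum.mono_neutral_right ballI)
          show "W w i = 0" if "i \<in> U - U \<inter> I" for i
            using cut_off_edge[OF cut, of w i] w False that by blast
        qed (use finU in auto)
        then show False using forb[of w] w by auto
      qed
    qed
  qed
  then show ?thesis
    using rec_setD(1,2)[OF c] rec_setD(1)[OF a] J(1) unfolding rec_set_def allowed_def
    by (simp add: override_on_def subset_iff)
qed

text \<open>Overwriting on I maps one fibre injectively into another; hence the restriction of a
  uniform recurrent configuration to I is again uniform.\<close>

lemma rec_set_restr_fibres:
  assumes cut: "cut_off I p" and J: "I \<subseteq> J" "finite J"
  obtains g where "\<And>A. A \<subseteq> rec_set I \<Longrightarrow> card {c\<in>rec_set J. restr I c \<in> A} = g * card A"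
proof (rule card_fibres)
  show "finite (rec_set J)" "finite (rec_set I)"
    using finite_rec_set J finite_subset by blast+
  show "restr I ` rec_set J \<subseteq> rec_set I" using rec_set_restr J by blast
  fix x y assume "x \<in> rec_set I" and y: "y \<in> rec_set I"
  let ?\<phi> = "\<lambda>c. override_on c y I"
  have "inj_on ?\<phi> {s \<in> rec_set J. restr I s = x}"
  proof (rule inj_onI, rule ext)
    fix c c' w assume c: "c \<in> {s \<in> rec_set J. restr I s = x}" "c' \<in> {s \<in> rec_set J. restr I s = x}"
      and eq: "?\<phi> c = ?\<phi> c'"
    then have "restr I c w = restr I c' w" "?\<phi> c w = ?\<phi> c' w" by simp_all
    then show "c w = c' w" unfolding restr_def override_on_def by (auto split: if_splits)
  qed
  moreover have "restr I (?\<phi> c) = y" for c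
    using rec_setD(2)[OF y] unfolding restr_def override_on_def by auto
  ultimately show "\<exists>\<phi>. inj_on \<phi> {s \<in> rec_set J. restr I s = x} \<and>
      \<phi> ` {s \<in> rec_set J. restr I s = x} \<subseteq> {s \<in> rec_set J. restr I s = y}"
    using rec_set_override[OF cut J _ y] by (intro exI[of _ ?\<phi>]) auto
qed (rule that)

lemma stab_vec_cong:
  assumes "\<And>w. w \<in> I \<Longrightarrow> c w = c' w"
  shows "stab_vec I c u \<longleftrightarrow> stab_vec I c' u"
  using assms unfolding stab_vec_def by simp

lemma odometer_cong:
  assumes "\<And>w. w \<in> I \<Longrightarrow> c w = c' w"
  shows "odometer I c = odometer I c'"
proof -
  have "stab_vec I c u = stab_vec I c' u" for u using stab_vec_cong assms by blast
  then show ?thesis unfolding odometer_def by simp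
qed

text \<open>Used for masses: an avalanche that fires p covers all of \<open>insert p I\<close>, so a
  smaller mass means that p stayed unfired.\<close>

lemma cut_vertex_fired:
  assumes cut: "cut_off I p" and J: "insert p I \<subseteq> J" "finite J"
    and c: "c \<in> rec_set J" and u: "stab_vec J (add_chip c v) u" and p: "u p \<noteq> 0"
    and y: "y \<in> insert p I"
  shows "u y \<noteq> 0"
proof (rule fired_spreads[OF rec_setD(3)[OF c] _ u J(2) J(1) _ p _ y])
  show "c w \<le> add_chip c v w" for w unfolding add_chip_def by auto
  show "z \<in> insert p I" if "w \<in> insert p I" "w \<noteq> p" "W w z \<noteq> 0" for w z
    using cut_off_edge[OF cut, of w z] that by blast
qed simp

text \<open>As long as p does not fire, nothing returns into I. The odometer of I, extended by 0,
  stabilizes J precisely when p can hold the chips arriving from I; the other vertices outside I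
  receive none.\<close>

lemma odometer_cut_off:
  assumes cut: "cut_off I p" and J: "insert p I \<subseteq> J" "finite J"
    and c: "c \<in> rec_set J" and v: "v \<in> I" and ex: "stab_vec J (add_chip c v) u0"
  defines "o1 \<equiv> odometer I (add_chip c v)" and "o2 \<equiv> odometer J (add_chip c v)"
  shows "c p + inflow I o1 p < dg p \<longleftrightarrow> o2 p = 0" and "o2 p = 0 \<Longrightarrow> o2 = o1"
proof -
  have IJ: "I \<subseteq> J" using J by blast
  have pI: "p \<notin> I" using cut unfolding cut_off_def by auto
  have o2: "stab_vec J (add_chip c v) o2" unfolding o2_def by (rule odometer_stab_vec[OF ex])
  have r: "stab_vec I (add_chip c v) (\<lambda>w. if w \<in> I then o2 w else 0)"
    by (rule stab_vec_restrict[OF o2 IJ J(2)]) simp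
  have o1: "stab_vec I (add_chip c v) o1" unfolding o1_def by (rule odometer_stab_vec[OF r])
  have le: "o1 w \<le> o2 w" for w
    using odometer_le[OF r, of w] unfolding o1_def by (auto split: if_splits)
  have infl: "inflow I o1 p \<le> inflow J o2 p"
    by (rule order.trans[OF inflow_mono[OF le] inflow_subset_le[OF J(2) IJ]])
  have p: "c p + inflow I o1 p < dg p" if "o2 p = 0"
  proof -
    have "p \<in> J" "p \<noteq> v" using J v pI by auto
    then show ?thesis
      using stab_vec_unfired[OF o2 _ that] infl unfolding add_chip_def by simp
  qed
  have "o2 = o1" if small: "c p + inflow I o1 p < dg p"
  proof
    have o10: "o1 w = 0" if "w \<notin> I" for w using o1 that unfolding stab_vec_def by blast
    have "stab_vec J (add_chip c v) o1"
      unfolding stab_vec_def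
    proof (intro conjI allI impI ballI)
      fix w assume "w \<in> J"
      have eq: "inflow J o1 w = inflow I o1 w" using J IJ o10 by (intro inflow_superset) auto
      show "add_chip c v w + inflow J o1 w < dg w * Suc (o1 w)"
      proof (cases "w \<in> I")
        case True
        then show ?thesis using o1 unfolding eq stab_vec_def by blast
      next
        case False
        then have 1: "add_chip c v w = c w" using v unfolding add_chip_def by auto
        show ?thesis
        proof (cases "w = p")
          case True
          then show ?thesis using small 1 eq o10[OF False] by simp
        next
          case wp: False
          have "inflow I o1 w = 0"
            unfolding inflow_def using cut False wp W_sym[of w]
            by (intro sum.neutral) (auto simp: cut_off_def)
          then show ?thesis using 1 eq rec_setD(1)[OF c \<open>w \<in> J\<close>] by simp
        qed
      qed
    qed (use o10 IJ in auto)
    then show "o2 w = o1 w" for w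
      using odometer_le[of J "add_chip c v" o1 w] le[of w] unfolding o2_def by simp
  qed
  moreover have "o1 p = 0" using o1 pI unfolding stab_vec_def by blast
  ultimately show "c p + inflow I o1 p < dg p \<longleftrightarrow> o2 p = 0" "o2 p = 0 \<Longrightarrow> o2 = o1"
    using p by auto
qed

end

section \<open>Cycles of the block-path\<close>

text \<open>The positions of the fired vertices on a cycle: a fired arc ends at an unfired vertex with a
  fired neighbour, which has to be deficient, and there is at most one deficient vertex.\<close>

lemma fired_interval:
  fixes T D :: "nat set"
  assumes T: "T \<subseteq> {1..<k}" "t \<in> T" and b: "t < b" "b < k" "b \<notin> T"
    and D: "\<And>a. a \<in> {1..<k} - T \<Longrightarrow> a - 1 \<in> T \<or> Suc a \<in> T \<Longrightarrow> a \<in> D"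
    and not_both: "\<And>a. a \<in> {1..<k} - T \<Longrightarrow> \<not> (a - 1 \<in> T \<and> Suc a \<in> T)"
    and unique: "\<And>a b. a \<in> D \<Longrightarrow> b \<in> D \<Longrightarrow> a = b"
  obtains j where "t < j" "j < k" "j \<in> D" "T = {1..<j}"
proof -
  \<comment> \<open>The first unfired position above t; its predecessor is fired, so it is
    deficient.\<close>
  define j where "j = (LEAST j. t < j \<and> j \<notin> T)"
  have j: "t < j" "j \<notin> T" unfolding j_def using LeastI[of "\<lambda>j. t < j \<and> j \<notin> T"] b by auto
  have jb: "j \<le> b" unfolding j_def using b by (intro Least_le) auto
  have below: "a \<in> T" if "t \<le> a" "a < j" for a
    using that not_less_Least[of a "\<lambda>j. t < j \<and> j \<notin> T"] T(2) unfolding j_def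
    by (cases "a = t") auto
  have t1: "t \<ge> 1" using T by auto
  have jk: "j \<in> {1..<k} - T" using j jb b by auto
  have "j - 1 \<in> T" using below[of "j - 1"] j(1) t1 by auto
  then have jD: "j \<in> D" using D jk by blast
  have "a \<in> T" if "1 \<le> a" "a < t" for a
  proof (rule ccontr)
    assume "a \<notin> T"
    \<comment> \<open>The last unfired position below t would have a fired successor and thus be a
      second deficient one.\<close>
    define a' where "a' = (GREATEST a. a < t \<and> a \<notin> T)"
    have bd: "\<forall>y. y < t \<and> y \<notin> T \<longrightarrow> y \<le> t" by auto
    have a': "a' < t" "a' \<notin> T"
      unfolding a'_def using GreatestI_nat[of "\<lambda>a. a < t \<and> a \<notin> T", OF _ bd[rule_format]] that \<open>a \<notin> T\<close>
      by auto
    have "a \<le> a'" unfolding a'_def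
      by (rule Greatest_le_nat[of "\<lambda>a. a < t \<and> a \<notin> T", OF _ bd[rule_format]]) (use that \<open>a \<notin> T\<close> in auto)
    have "Suc a' \<in> T"
    proof (rule ccontr)
      assume n: "Suc a' \<notin> T"
      then have "Suc a' \<noteq> t" using T(2) by auto
      then have "Suc a' < t \<and> Suc a' \<notin> T" using a' n by auto
      then have "Suc a' \<le> a'" unfolding a'_def
        by (rule Greatest_le_nat[of "\<lambda>a. a < t \<and> a \<notin> T", OF _ bd[rule_format]])
      then show False by simp
    qed
    moreover have "a' \<in> {1..<k} - T" using a' \<open>a \<le> a'\<close> that b by auto
    ultimately have "a' \<in> D" using D by blast
    then show False using unique[OF _ jD] a' j by auto
  qed
  \<comment> \<open>Past j, the first fired position would make its predecessor deficient. That
    predecessor would be j, now with two fired neighbours.\<close>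
  moreover have "a \<notin> T" if "j < a" for a
    using that
  proof (induction a rule: less_induct)
    case (less a)
    show ?case
    proof
      assume a: "a \<in> T"
      have a1: "a - 1 \<notin> T" using less.IH[of "a - 1"] less.prems j(2) by (cases "a - 1 = j") auto
      have S: "Suc (a - 1) = a" using less.prems by simp
      have mem: "a - 1 \<in> {1..<k} - T" using a a1 T less.prems j(1) t1 by auto
      then have "a - 1 \<in> D" using D[of "a - 1"] S a by simp
      then have "a - 1 = j" using unique jD by blast
      then show False using not_both[OF mem] S a \<open>j - 1 \<in> T\<close> by auto
    qed
  qed
  ultimately have "x \<in> T \<longleftrightarrow> x \<in> {1..<j}" for x
    using below[of x] j(2) T(1) by (cases x j rule: linorder_cases) (auto simp: not_less, force)
  then have "T = {1..<j}" by blast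
  then show ?thesis using that j jk jD by auto
qed

definition deficit :: "('v \<Rightarrow> nat) \<Rightarrow> 'v set \<Rightarrow> 'v config \<Rightarrow> 'v set" where
  "deficit dg V c = {x\<in>V. c x \<noteq> dg x - 1}"

text \<open>On the cycle vertices of a recurrent configuration only dg - 1 and dg - 2 occur
  (\<open>config_ring_vert\<close>), so the set s encodes the values there completely.\<close>

definition set_deficit :: "('v \<Rightarrow> nat) \<Rightarrow> 'v set \<Rightarrow> 'v set \<Rightarrow> 'v config \<Rightarrow> 'v config" where
  "set_deficit dg V s c = (\<lambda>x. if x \<in> V then (if x \<in> s then dg x - 2 else dg x - 1) else c x)"

text \<open>An avalanche entering at t fills the side of j on which t lies, up to the root at
  position 0 or k; whole branches fire with their cycle vertices.\<close>

definition arc :: "(nat \<Rightarrow> 'v set) \<Rightarrow> nat \<Rightarrow> nat \<Rightarrow> nat \<Rightarrow> 'v set" where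
  "arc B k t j = (\<Union>a\<in>(if t < j then {1..<j} else {j<..<k}). B a)"

context wgraph
begin

text \<open>A cycle \<open>X 0 = p, X 1, \<dots>, X k = p\<close> with branches \<open>B a\<close> hanging off the vertices \<open>X a\<close>,
  all inside a set \<open>I\<close> that is attached to the rest of the graph at \<open>p\<close> only.\<close>

definition ring :: "'v set \<Rightarrow> 'v \<Rightarrow> nat \<Rightarrow> (nat \<Rightarrow> 'v) \<Rightarrow> (nat \<Rightarrow> 'v set) \<Rightarrow> bool" where
  "ring I p k X B \<longleftrightarrow> 3 \<le> k \<and> cut_off I p \<and> X 0 = p \<and> X k = p \<and>
     (\<forall>a\<in>{1..<k}. X a \<in> B a \<and> B a \<subseteq> I \<and>
        (\<forall>b\<in>{1..<k}. a \<noteq> b \<longrightarrow> B a \<inter> B b = {}) \<and>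
        (\<forall>w\<in>B a - {X a}. \<forall>u. u \<notin> B a \<longrightarrow> W w u = 0) \<and>
        (\<forall>u. u \<notin> B a \<longrightarrow> W (X a) u = (if u = X (a - 1) \<or> u = X (Suc a) then 1 else 0)))"

text \<open>Reversing the orientation exchanges the two sides of the entry position, so later
  arguments treat only t < j.\<close>

lemma ring_reflect:
  assumes "ring I p k X B"
  shows "ring I p k (\<lambda>a. X (k - a)) (\<lambda>a. B (k - a))"
  unfolding ring_def
proof (intro conjI ballI)
  show "3 \<le> k" "cut_off I p" "X (k - 0) = p" "X (k - k) = p"
    using assms unfolding ring_def by auto
  fix a assume a: "a \<in> {1..<k}"
  then have ka: "k - a \<in> {1..<k}" and eq: "k - (a - 1) = Suc (k - a)" "k - Suc a = k - a - 1"
    by auto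
  note R = assms[unfolded ring_def, THEN conjunct2, THEN conjunct2, THEN conjunct2, THEN conjunct2,
      rule_format, OF ka]
  show "X (k - a) \<in> B (k - a)" "B (k - a) \<subseteq> I" using R by blast+
  show "a \<noteq> b \<longrightarrow> B (k - a) \<inter> B (k - b) = {}" if "b \<in> {1..<k}" for b
  proof
    assume "a \<noteq> b"
    then have "k - b \<in> {1..<k}" "k - a \<noteq> k - b" using a that by auto
    then show "B (k - a) \<inter> B (k - b) = {}" using R by blast
  qed
  show "\<forall>u. u \<notin> B (k - a) \<longrightarrow> W w u = 0" if "w \<in> B (k - a) - {X (k - a)}" for w
    using R that by blast
  show "\<forall>u. u \<notin> B (k - a) \<longrightarrow>
      W (X (k - a)) u = (if u = X (k - (a - 1)) \<or> u = X (k - Suc a) then 1 else 0)"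
    unfolding eq using R by (simp add: disj_commute)
qed

end

section \<open>The states of a single cycle\<close>

locale ring_graph = wgraph +
  fixes I p k X B
  assumes ring: "ring I p k X B"
begin

definition ring_verts where "ring_verts = X ` {1..<k}"

lemma
  shows k3: "3 \<le> k" and cut_off_I: "cut_off I p" and X0: "X 0 = p" and Xk: "X k = p"
    and p_notin: "p \<notin> I" and finite_I: "finite I"
  using ring unfolding ring_def cut_off_def by auto

lemma
  assumes "a \<in> {1..<k}"
  shows X_in_B: "X a \<in> B a" and B_subset: "B a \<subseteq> I" and X_in_I: "X a \<in> I"
    and B_disjoint: "b \<in> {1..<k} \<Longrightarrow> a \<noteq> b \<Longrightarrow> B a \<inter> B b = {}"
    and B_edge: "w \<in> B a \<Longrightarrow> w \<noteq> X a \<Longrightarrow> u \<notin> B a \<Longrightarrow> W w u = 0"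
    and X_edge: "u \<notin> B a \<Longrightarrow> W (X a) u = (if u = X (a - 1) \<or> u = X (Suc a) then 1 else 0)"
  using ring assms unfolding ring_def by (blast, blast, blast, blast, blast, blast)

lemma ring_verts_subset: "ring_verts \<subseteq> I"
  unfolding ring_verts_def using X_in_I by auto

lemma X_in_B_iff: "a \<in> {1..<k} \<Longrightarrow> b \<in> {1..<k} \<Longrightarrow> X b \<in> B a \<longleftrightarrow> a = b"
  using X_in_B B_disjoint by blast

lemma X_inj: "inj_on X {1..<k}"
  using X_in_B_iff X_in_B by (metis inj_onI)

text \<open>Here \<open>k3\<close> enters: on a cycle of length 2 the two neighbours of the vertex
  other than the root would coincide.\<close>

lemma X_pred_succ:
  assumes "a \<in> {1..<k}"
  shows "X (a - 1) \<notin> B a" "X (Suc a) \<notin> B a" "X (a - 1) \<noteq> X (Suc a)"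
proof -
  have pB: "p \<notin> B a" using B_subset[OF assms] p_notin by blast
  show 1: "X (a - 1) \<notin> B a"
  proof (cases "a = 1")
    case False
    then have "a - 1 \<in> {1..<k}" "a \<noteq> a - 1" using assms by auto
    then show ?thesis using X_in_B_iff[OF assms] by blast
  qed (use pB X0 in simp)
  show 2: "X (Suc a) \<notin> B a"
  proof (cases "Suc a = k")
    case False
    then have "Suc a \<in> {1..<k}" "a \<noteq> Suc a" using assms by auto
    then show ?thesis using X_in_B_iff[OF assms] by blast
  qed (use pB Xk in simp)
  show "X (a - 1) \<noteq> X (Suc a)"
  proof (cases "a = 1")
    case True
    then have "Suc a \<in> {1..<k}" using k3 by auto
    then show ?thesis using X_in_I[of "Suc a"] p_notin X0 True by auto
  next
    case False
    then have m: "a - 1 \<in> {1..<k}" using assms by auto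
    show ?thesis
    proof (cases "Suc a = k")
      case True
      then show ?thesis using X_in_I[OF m] p_notin Xk by metis
    next
      case False
      then have "Suc a \<in> {1..<k}" using assms by auto
      then show ?thesis using inj_onD[OF X_inj _ m] assms by fastforce
    qed
  qed
qed

lemma sum_W_branch:
  assumes a: "a \<in> {1..<k}" and w: "w \<in> B a" "w \<noteq> X a" and S: "B a \<subseteq> S" "finite S"
  shows "(\<Sum>u\<in>S. W w u) = dg w"
  using B_edge[OF a w] S by (intro sum_W_eq) auto

text \<open>Degree balance: when S contains the branch, only the two cycle edges can leave S, each
  costing one.\<close>

lemma sum_W_X:
  assumes a: "a \<in> {1..<k}" and S: "B a \<subseteq> S" "finite S"
  shows "(\<Sum>u\<in>S. W (X a) u) + of_bool (X (a - 1) \<notin> S) + of_bool (X (Suc a) \<notin> S) = dg (X a)"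
proof -
  let ?N = "{X (a - 1), X (Suc a)}"
  have "dg (X a) = (\<Sum>u\<in>S \<union> ?N. W (X a) u)"
  proof (intro sum_W_eq[symmetric])
    show "W (X a) u = 0" if "u \<notin> S \<union> ?N" for u
      using X_edge[OF a, of u] that S by auto
  qed (use S in auto)
  also have "\<dots> = (\<Sum>u\<in>S. W (X a) u) + (\<Sum>u\<in>?N - S. W (X a) u)"
  proof -
    have "S \<union> ?N = S \<union> (?N - S)" by blast
    then show ?thesis using S(2) by (simp only:) (rule sum.union_disjoint, auto)
  qed
  also have "(\<Sum>u\<in>?N - S. W (X a) u) = card (?N - S)"
  proof -
    have "W (X a) u = 1" if "u \<in> ?N - S" for u using X_edge[OF a, of u] that S(1) by auto
    then show ?thesis by simp
  qed
  also have "card (?N - S) = of_bool (X (a - 1) \<notin> S) + of_bool (X (Suc a) \<notin> S)"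
    using X_pred_succ(3)[OF a] by (auto simp: insert_Diff_if)
  finally show ?thesis by simp
qed

lemma dg_X_ge_2:
  assumes "a \<in> {1..<k}"
  shows "2 \<le> dg (X a)"
  using sum_W_X[OF assms order.refl] X_pred_succ[OF assms] B_subset[OF assms] finite_I finite_subset
  by fastforce

text \<open>A segment of whole branches is the test set. Off the cycle all edges of a branch vertex
  stay in the branch, and a stable vertex holds less than its degree, so only a cycle vertex can be
  the witness.\<close>

lemma segment_sum:
  assumes c: "c \<in> rec_set I" and ab: "1 \<le> a" "a \<le> b" "b < k"
  obtains i where "i \<in> {a..b}" "(\<Sum>u\<in>(\<Union>i\<in>{a..b}. B i). W (X i) u) \<le> c (X i)"
proof -
  define S where "S = (\<Union>i\<in>{a..b}. B i)"
  have i: "i \<in> {1..<k}" if "i \<in> {a..b}" for i using that ab by auto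
  have "S \<subseteq> I" unfolding S_def using B_subset i by blast
  then have finS: "finite S" using finite_I finite_subset by blast
  have "S \<noteq> {}" unfolding S_def using X_in_B[of a] ab by auto
  then obtain w where w: "w \<in> S" "(\<Sum>u\<in>S. W w u) \<le> c w"
    using rec_setD(3)[OF c] \<open>S \<subseteq> I\<close> unfolding allowed_def by blast
  then obtain j where j: "j \<in> {a..b}" "w \<in> B j" unfolding S_def by auto
  have "w = X j"
  proof (rule ccontr)
    assume "w \<noteq> X j"
    then have "(\<Sum>u\<in>S. W w u) = dg w"
      by (intro sum_W_branch[OF i[OF j(1)] j(2)]) (use j finS in \<open>auto simp: S_def\<close>)
    then show False using w rec_setD(1)[OF c, of w] \<open>S \<subseteq> I\<close> by auto
  qed
  then show ?thesis using that j w unfolding S_def by auto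
qed

lemma config_X_ge:
  assumes c: "c \<in> rec_set I" and a: "a \<in> {1..<k}"
  shows "dg (X a) \<le> c (X a) + 2"
proof -
  obtain i where "i \<in> {a..a}" "(\<Sum>u\<in>(\<Union>i\<in>{a..a}. B i). W (X i) u) \<le> c (X i)"
    using segment_sum[OF c, of a a] a by auto
  then have le: "(\<Sum>u\<in>B a. W (X a) u) \<le> c (X a)" by simp
  have "finite (B a)" using B_subset[OF a] finite_I finite_subset by blast
  then show ?thesis using sum_W_X[OF a order.refl] le X_pred_succ(1,2)[OF a] by simp
qed

text \<open>Between two deficient positions the segment would be forbidden: its end vertices lose
  one edge but hold at most dg - 2 chips, and the vertices between keep their full degree.\<close>

lemma deficit_unique:
  assumes c: "c \<in> rec_set I" and ab: "a \<in> {1..<k}" "b \<in> {1..<k}"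
    and def: "c (X a) \<noteq> dg (X a) - 1" "c (X b) \<noteq> dg (X b) - 1"
  shows "a = b"
proof -
  have False if ab: "a \<in> {1..<k}" "b \<in> {1..<k}" "a < b"
    and def: "c (X a) \<noteq> dg (X a) - 1" "c (X b) \<noteq> dg (X b) - 1" for a b
  proof -
    define S where "S = (\<Union>i\<in>{a..b}. B i)"
    obtain i where i: "i \<in> {a..b}" "(\<Sum>u\<in>S. W (X i) u) \<le> c (X i)"
      using segment_sum[OF c, of a b] ab unfolding S_def by auto
    have ik: "i \<in> {1..<k}" using i(1) ab by auto
    have finS: "finite S"
    proof (rule finite_subset[OF _ finite_I])
      show "S \<subseteq> I"
        unfolding S_def
      proof (rule UN_least)
        fix i assume "i \<in> {a..b}"
        then show "B i \<subseteq> I" using ab by (intro B_subset) auto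
      qed
    qed
    have eq: "(\<Sum>u\<in>S. W (X i) u) + of_bool (X (i - 1) \<notin> S) + of_bool (X (Suc i) \<notin> S) = dg (X i)"
      by (rule sum_W_X[OF ik _ finS]) (use i in \<open>auto simp: S_def\<close>)
    have lt: "c (X i) < dg (X i)" using rec_setD(1)[OF c X_in_I[OF ik]] .
    have pred: "X (i - 1) \<in> S" if "i \<noteq> a"
    proof -
      have "i - 1 \<in> {1..<k}" "i - 1 \<in> {a..b}" using that i(1) ab by auto
      then show ?thesis using X_in_B unfolding S_def by blast
    qed
    have succ: "X (Suc i) \<in> S" if "i \<noteq> b"
      using that i(1) ab X_in_B[of "Suc i"] unfolding S_def by (intro UN_I[of "Suc i"]) auto
    consider "i = a" | "i = b" | "i \<noteq> a" "i \<noteq> b" by blast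
    then show False
    proof cases
      case 1
      then have "X (Suc i) \<in> S" using succ ab by auto
      then show False using eq lt i(2) def(1) 1 by (auto simp: of_bool_def split: if_splits)
    next
      case 2
      then have "X (i - 1) \<in> S" using pred ab by auto
      then show False using eq lt i(2) def(2) 2 by (auto simp: of_bool_def split: if_splits)
    next
      case 3
      then show False using eq lt i(2) pred succ by auto
    qed
  qed
  from this[of a b] this[of b a] show ?thesis using assms by (cases a b rule: linorder_cases) auto
qed

lemma card_ring_verts: "card ring_verts = k - 1"
  unfolding ring_verts_def using card_image[OF X_inj] by simp

lemma deficit_subset: "deficit dg ring_verts c \<subseteq> ring_verts"
  unfolding deficit_def by auto

lemma card_deficit_le_1:
  assumes "c \<in> rec_set I"
  shows "card (deficit dg ring_verts c) \<le> 1"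
proof -
  have "x = y" if "x \<in> deficit dg ring_verts c" "y \<in> deficit dg ring_verts c" for x y
    using that deficit_unique[OF assms] unfolding deficit_def ring_verts_def by blast
  then show ?thesis by (metis card_le_Suc0_iff_eq One_nat_def card.infinite zero_le_one)
qed

definition deficit_states :: "'a set set" where
  "deficit_states = {s. s \<subseteq> ring_verts \<and> card s \<le> 1}"

lemma deficit_states_eq: "deficit_states = insert {} ((\<lambda>x. {x}) ` ring_verts)"
proof -
  have "finite ring_verts" using ring_verts_subset finite_I finite_subset by blast
  then have "s \<in> insert {} ((\<lambda>x. {x}) ` ring_verts)" if "s \<in> deficit_states" for s
    using that finite_subset[of s ring_verts] unfolding deficit_states_def
    by (auto simp: le_Suc_eq card_1_singleton_iff)
  then show ?thesis unfolding deficit_states_def by auto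
qed

lemma card_deficit_states: "card deficit_states = k"
proof -
  have "finite ring_verts" using ring_verts_subset finite_I finite_subset by blast
  moreover have "{} \<notin> (\<lambda>x. {x}) ` ring_verts" by auto
  ultimately have "card deficit_states = Suc (card ((\<lambda>x. {x}) ` ring_verts))"
    unfolding deficit_states_eq by simp
  also have "card ((\<lambda>x. {x}) ` ring_verts) = card ring_verts" by (rule card_image) simp
  finally show ?thesis using card_ring_verts k3 by simp
qed

lemma finite_deficit_states: "finite deficit_states"
  using card_deficit_states k3 by (intro card_ge_0_finite) simp

lemma deficit_in_states: "c \<in> rec_set I \<Longrightarrow> deficit dg ring_verts c \<in> deficit_states"
  unfolding deficit_states_def using deficit_subset card_deficit_le_1 by simp

text \<open>If \<open>U\<close> were forbidden after the change and met the cycle, then the first and the last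
  cycle vertex in \<open>U\<close> would both be the deficient one, which then has both cycle neighbours
  outside \<open>U\<close> and cannot be forbidden.\<close>

lemma set_deficit_in_rec_set:
  assumes c: "c \<in> rec_set I" and s: "s \<in> deficit_states"
  shows "set_deficit dg ring_verts s c \<in> rec_set I"
proof -
  let ?c = "set_deficit dg ring_verts s c"
  have "\<exists>w\<in>U. (\<Sum>u\<in>U. W w u) \<le> ?c w" if U: "U \<subseteq> I" "U \<noteq> {}" for U
  proof (cases "U \<inter> ring_verts = {}")
    case True
    then show ?thesis
      using rec_setD(3)[OF c] U unfolding allowed_def set_deficit_def by (metis disjoint_iff)
  next
    case False
    show ?thesis
    proof (rule ccontr)
      assume "\<not> ?thesis"
      then have forb: "\<And>w. w \<in> U \<Longrightarrow> ?c w < (\<Sum>u\<in>U. W w u)" by (simp add: not_le)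
      have finU: "finite U" using U finite_I finite_subset by blast
      define A where "A = {a\<in>{1..<k}. X a \<in> U}"
      have A: "finite A" "A \<noteq> {}" using False unfolding A_def ring_verts_def by auto
      have sum_le: "(\<Sum>u\<in>U. W (X a) u) + of_bool (X (a - 1) \<notin> U) + of_bool (X (Suc a) \<notin> U)
          \<le> dg (X a)" if a: "a \<in> {1..<k}" for a
      proof -
        let ?S = "U \<union> B a"
        have finS: "finite ?S" using finU B_subset[OF a] finite_I finite_subset by blast
        have "(\<Sum>u\<in>?S. W (X a) u) + of_bool (X (a - 1) \<notin> ?S) + of_bool (X (Suc a) \<notin> ?S) = dg (X a)"
          by (rule sum_W_X[OF a _ finS]) simp
        moreover have "(\<Sum>u\<in>U. W (X a) u) \<le> (\<Sum>u\<in>?S. W (X a) u)"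
          using finS by (intro sum_mono2) auto
        ultimately show ?thesis using X_pred_succ[OF a] by simp
      qed
      \<comment> \<open>A cycle vertex of U with a cycle neighbour outside U has at most dg - 1
        edges into U, so being forbidden makes it deficient; its other cycle neighbour then has to
        be in U.\<close>
      have key: "X a \<in> s" "X (a - 1) \<in> U \<or> X (Suc a) \<in> U"
        if a: "a \<in> A" and out: "X (a - 1) \<notin> U \<or> X (Suc a) \<notin> U" for a
      proof -
        have ak: "a \<in> {1..<k}" "X a \<in> U" using a unfolding A_def by auto
        have V: "X a \<in> ring_verts" using ak unfolding ring_verts_def by auto
        show "X a \<in> s"
          using sum_le[OF ak(1)] forb[OF ak(2)] out V dg_X_ge_2[OF ak(1)]
          unfolding set_deficit_def by (auto simp: of_bool_def split: if_splits)
        then show "X (a - 1) \<in> U \<or> X (Suc a) \<in> U"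
          using sum_le[OF ak(1)] forb[OF ak(2)] V dg_X_ge_2[OF ak(1)]
          unfolding set_deficit_def by (auto simp: of_bool_def split: if_splits)
      qed
      have mn: "Min A \<in> A" "Max A \<in> A" using A by auto
      have pU: "p \<notin> U" using p_notin U by blast
      have "X (Min A - 1) \<notin> U"
      proof (cases "Min A = 1")
        case False
        then have 1: "Min A - 1 \<in> {1..<k}" "Min A - 1 < Min A" using mn(1) unfolding A_def by auto
        then have "Min A - 1 \<notin> A" using A(1) by (meson Min_le leD)
        then show ?thesis using 1 unfolding A_def by blast
      qed (use pU X0 in simp)
      moreover have "X (Suc (Max A)) \<notin> U"
      proof (cases "Suc (Max A) = k")
        case False
        then have 1: "Suc (Max A) \<in> {1..<k}" using mn(2) unfolding A_def by auto
        have "Suc (Max A) \<notin> A" using A(1) by (meson Max_ge Suc_n_not_le_n)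
        then show ?thesis using 1 unfolding A_def by blast
      qed (use pU Xk in simp)
      ultimately have "X (Min A) \<in> s" "X (Max A) \<in> s" "X (Min A - 1) \<notin> U" "X (Suc (Max A)) \<notin> U"
        using key mn by blast+
      moreover have "X (Min A) = X (Max A)"
        using calculation(1,2) s unfolding deficit_states_eq by auto
      then have "Min A = Max A" using inj_onD[OF X_inj] mn unfolding A_def by blast
      ultimately show False using key(2)[OF mn(1)] by auto
    qed
  qed
  moreover have "?c w < dg w" if "w \<in> I" for w
  proof (cases "w \<in> ring_verts")
    case True
    then obtain a where "a \<in> {1..<k}" "w = X a" unfolding ring_verts_def by auto
    then have "2 \<le> dg w" using dg_X_ge_2 by simp
    then show ?thesis using True unfolding set_deficit_def by auto
  next
    case False
    then show ?thesis using rec_setD(1)[OF c that] unfolding set_deficit_def by simp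
  qed
  moreover have "?c w = 0" if "w \<notin> I" for w
    using rec_setD(2)[OF c that] that ring_verts_subset unfolding set_deficit_def by auto
  ultimately show ?thesis unfolding rec_set_def allowed_def by blast
qed

lemma config_ring_vert:
  assumes c: "c \<in> rec_set I" and x: "x \<in> ring_verts"
  shows "c x = (if x \<in> deficit dg ring_verts c then dg x - 2 else dg x - 1)"
proof -
  obtain a where a: "a \<in> {1..<k}" "x = X a" using x unfolding ring_verts_def by auto
  have "c x < dg x" "dg x \<le> c x + 2"
    using rec_setD(1)[OF c, of x] X_in_I[OF a(1)] config_X_ge[OF c a(1)] a(2) by auto
  then show ?thesis using x unfolding deficit_def by auto
qed

lemma deficit_set_deficit:
  assumes "s \<in> deficit_states"
  shows "deficit dg ring_verts (set_deficit dg ring_verts s c) = s"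
proof -
  have "2 \<le> dg x" if "x \<in> ring_verts" for x using that dg_X_ge_2 unfolding ring_verts_def by auto
  moreover have "s \<subseteq> ring_verts" using assms unfolding deficit_states_def by simp
  ultimately show ?thesis unfolding deficit_def set_deficit_def by (auto split: if_splits; fastforce)
qed

end

text \<open>The branch at position t is the previous piece I' together with its root q: the nesting
  along which avalanches are followed from one cycle to the next.\<close>

locale chain_ring = ring_graph +
  fixes I' q t
  assumes cut_off_I': "cut_off I' q" and t: "t \<in> {1..<k}" and Xt: "X t = q"
    and Bt: "B t = insert q I'"
begin

lemma I'_subset: "I' \<subseteq> I" and q_in_I: "q \<in> I" and q_notin: "q \<notin> I'" and finite_I': "finite I'"
  using B_subset[OF t] X_in_I[OF t] cut_off_I' Bt Xt unfolding cut_off_def by auto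

lemma ring_verts_I': "ring_verts \<inter> I' = {}"
proof -
  have "X a \<notin> I'" if a: "a \<in> {1..<k}" for a
    using X_in_B_iff[OF t a] Bt Xt q_notin by (cases "a = t") auto
  then show ?thesis unfolding ring_verts_def by blast
qed

text \<open>\<open>override_on\<close> prescribes the inner configuration and
  \<open>set_deficit\<close> the state of the cycle. Neither disturbs the other, because the cycle
  vertices lie outside I'; so the pair is uniform on the product, which is the independence used
  later.\<close>

lemma ring_fibres:
  obtains g :: nat where "\<And>A D. A \<subseteq> rec_set I' \<Longrightarrow> D \<subseteq> deficit_states \<Longrightarrow>
    card {c\<in>rec_set I. restr I' c \<in> A \<and> deficit dg ring_verts c \<in> D} = g * (card A * card D)"
proof -
  define f where "f c = (restr I' c, deficit dg ring_verts c)" for c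
  let ?T = "rec_set I' \<times> deficit_states"
  have fT: "f ` rec_set I \<subseteq> ?T"
    unfolding f_def using rec_set_restr[OF _ I'_subset] deficit_in_states by auto
  have inj: "\<exists>\<phi>. inj_on \<phi> {c\<in>rec_set I. f c = x} \<and>
      \<phi> ` {c\<in>rec_set I. f c = x} \<subseteq> {c\<in>rec_set I. f c = y}"
    if x: "x \<in> ?T" and y: "y \<in> ?T" for x y
  proof -
    obtain a s where as: "y = (a, s)" "a \<in> rec_set I'" "s \<in> deficit_states" using y by auto
    define \<phi> where "\<phi> c = set_deficit dg ring_verts s (override_on c a I')" for c
    have "inj_on \<phi> {c\<in>rec_set I. f c = x}"
    proof (rule inj_onI, rule ext)
      fix c c' w
      assume c: "c \<in> {c\<in>rec_set I. f c = x}" "c' \<in> {c\<in>rec_set I. f c = x}" and eq: "\<phi> c = \<phi> c'"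
      then have 1: "restr I' c = restr I' c'" "deficit dg ring_verts c = deficit dg ring_verts c'"
        "c \<in> rec_set I" "c' \<in> rec_set I"
        unfolding f_def by auto
      \<comment> \<open>On I' and on the cycle the value is determined by the fibre; everywhere else
        \<phi> leaves it unchanged.\<close>
      consider "w \<in> I'" | "w \<in> ring_verts" | "w \<notin> I'" "w \<notin> ring_verts" by blast
      then show "c w = c' w"
      proof cases
        case 1
        then show ?thesis using fun_cong[OF \<open>restr I' c = restr I' c'\<close>, of w] unfolding restr_def by simp
      next
        case 2
        then show ?thesis using config_ring_vert 1 by metis
      next
        case 3
        then show ?thesis
          using fun_cong[OF eq, of w] unfolding \<phi>_def set_deficit_def by simp
      qed
    qed
    moreover have "\<phi> c \<in> rec_set I \<and> f (\<phi> c) = y" if "c \<in> rec_set I" for c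
    proof -
      have "override_on c a I' \<in> rec_set I"
        by (rule rec_set_override[OF cut_off_I' I'_subset finite_I that as(2)])
      moreover have "restr I' (\<phi> c) = a"
        using ring_verts_I' rec_setD(2)[OF as(2)]
        unfolding \<phi>_def restr_def set_deficit_def override_on_def by (intro ext) auto
      ultimately show ?thesis
        using set_deficit_in_rec_set as deficit_set_deficit unfolding f_def \<phi>_def by auto
    qed
    ultimately show ?thesis by blast
  qed
  have "finite ?T" using finite_rec_set[OF finite_I'] finite_deficit_states by blast
  then obtain g where g: "\<And>A. A \<subseteq> ?T \<Longrightarrow> card {c\<in>rec_set I. f c \<in> A} = g * card A"
    using card_fibres[OF finite_rec_set[OF finite_I] _ fT inj] by blast
  show ?thesis
  proof (rule that[of g])
    fix A D assume AD: "A \<subseteq> rec_set I'" "D \<subseteq> deficit_states"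
    then have "card {c\<in>rec_set I. f c \<in> A \<times> D} = g * card (A \<times> D)" by (intro g) auto
    then show "card {c\<in>rec_set I. restr I' c \<in> A \<and> deficit dg ring_verts c \<in> D} = g * (card A * card D)"
      unfolding f_def by (simp add: card_cartesian_product)
  qed
qed

lemma ring_fibres_fraction:
  assumes A: "A \<subseteq> rec_set I'" and D: "D \<subseteq> deficit_states" and ne: "rec_set I \<noteq> {}"
  shows "card {c\<in>rec_set I. restr I' c \<in> A \<and> deficit dg ring_verts c \<in> D} / card (rec_set I)
       = (card A / card (rec_set I')) * (card D / k)"
proof -
  obtain g :: nat where g: "\<And>A D. A \<subseteq> rec_set I' \<Longrightarrow> D \<subseteq> deficit_states \<Longrightarrow>
    card {c\<in>rec_set I. restr I' c \<in> A \<and> deficit dg ring_verts c \<in> D} = g * (card A * card D)"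
    using ring_fibres by blast
  have "{c\<in>rec_set I. restr I' c \<in> rec_set I' \<and> deficit dg ring_verts c \<in> deficit_states} = rec_set I"
    using rec_set_restr[OF _ I'_subset] deficit_in_states by auto
  then have total: "card (rec_set I) = g * (card (rec_set I') * k)"
    using g[of "rec_set I'" deficit_states] card_deficit_states by simp
  have "card (rec_set I) \<noteq> 0" using ne finite_rec_set[OF finite_I] by simp
  then have "g \<noteq> 0" using total by auto
  then show ?thesis unfolding g[OF A D] total by simp
qed

end

section \<open>Avalanches crossing a cycle\<close>

text \<open>Stability at position a after the degree terms have cancelled: the chip arriving at t is
  paid for by the concave kink there, and the convex kink at the foot j of the slope is tolerated by
  the missing chip of the deficient vertex.\<close>

lemma trapezoid_concave:
  fixes a t j :: nat
  defines "\<tau> \<equiv> \<lambda>a. min (min a (j - a)) (min t (j - t))"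
  assumes "1 \<le> a" "1 \<le> t" "t < j"
  shows "\<tau> (a - 1) + \<tau> (Suc a) + (if a = t then 1 else 0) \<le> 2 * \<tau> a + (if a = j then 1 else 0)"
proof -
  have le: "\<tau> x \<le> x" "\<tau> x \<le> j - x" "\<tau> x \<le> t" "\<tau> x \<le> j - t" for x unfolding \<tau>_def by auto
  have d: "\<tau> a = a \<or> \<tau> a = j - a \<or> \<tau> a = t \<or> \<tau> a = j - t"
    unfolding \<tau>_def by (simp add: min_def)
  show ?thesis
  proof (cases "a < j")
    case True
    define da where "da = j - a"
    have "\<tau> (a - 1) + 1 \<le> a" "\<tau> (a - 1) \<le> da + 1" "\<tau> (Suc a) \<le> a + 1" "\<tau> (Suc a) + 1 \<le> da"
      using le(1,2)[of "a - 1"] le(1,2)[of "Suc a"] assms(2) True unfolding da_def by auto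
    note bounds = this le(3,4)[of "a - 1"] le(3,4)[of "Suc a"]
    have "\<tau> a = a \<or> \<tau> a = da \<or> (a \<noteq> t \<and> (\<tau> a = t \<or> \<tau> a = j - t))"
      using d unfolding da_def by auto
    moreover have "a = t \<Longrightarrow> \<tau> (a - 1) \<le> da" using bounds unfolding da_def by simp
    ultimately show ?thesis using bounds True by auto
  next
    case False
    then show ?thesis using le(2,4)[of "a - 1"] le(2)[of "Suc a"] assms(2-4) by (cases "a = j") auto
  qed
qed

context wgraph
begin

text \<open>The inflow counts the chips delivered to the root p while p itself is kept from
  firing.\<close>

definition good :: "'v \<Rightarrow> 'v set \<Rightarrow> 'v \<Rightarrow> 'v config set" where
  "good v I p = {c\<in>rec_set I. inflow I (odometer I (add_chip c v)) p = 1}"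

end

context chain_ring
begin

lemma W_p_X:
  assumes "a = 1 \<or> a = k - 1"
  shows "W p (X a) = 1"
proof -
  have ak: "a \<in> {1..<k}" using assms k3 by auto
  have "p = X (a - 1) \<or> p = X (Suc a)" using assms X0 Xk k3 by auto
  moreover have "p \<notin> B a" using B_subset[OF ak] p_notin by blast
  ultimately have "W (X a) p = 1" using X_edge[OF ak] by simp
  then show ?thesis using W_sym[of p "X a"] by simp
qed

lemma chain_ring_reflect: "chain_ring W dg I p k (\<lambda>a. X (k - a)) (\<lambda>a. B (k - a)) I' q (k - t)"
  by unfold_locales (use ring_reflect[OF ring] cut_off_I' t Xt Bt in auto)

lemma ring_verts_reflect: "ring_graph.ring_verts k (\<lambda>a. X (k - a)) = ring_verts"
proof -
  interpret r: chain_ring W dg I p k "\<lambda>a. X (k - a)" "\<lambda>a. B (k - a)" I' q "k - t"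
    by (rule chain_ring_reflect)
  have "(\<lambda>a. k - a) ` {1..<k} = {1..<k}"
  proof
    show "{1..<k} \<subseteq> (\<lambda>a. k - a) ` {1..<k}"
    proof
      fix a assume "a \<in> {1..<k}"
      then have "a = k - (k - a)" "k - a \<in> {1..<k}" by auto
      then show "a \<in> (\<lambda>a. k - a) ` {1..<k}" by blast
    qed
  qed auto
  then show ?thesis unfolding r.ring_verts_def ring_verts_def by (metis image_image)
qed

lemma arc_reflect:
  assumes "j \<in> {1..<k}" "j \<noteq> t"
  shows "arc (\<lambda>a. B (k - a)) k (k - t) (k - j) = arc B k t j"
proof -
  have img: "(\<lambda>a. k - a) ` {1..<k - j} = {j<..<k}" "(\<lambda>a. k - a) ` {k - j<..<k} = {1..<j}"
  proof -
    show "(\<lambda>a. k - a) ` {1..<k - j} = {j<..<k}"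
    proof
      show "{j<..<k} \<subseteq> (\<lambda>a. k - a) ` {1..<k - j}"
      proof
        fix a assume "a \<in> {j<..<k}"
        then have "a = k - (k - a)" "k - a \<in> {1..<k - j}" by auto
        then show "a \<in> (\<lambda>a. k - a) ` {1..<k - j}" by blast
      qed
    qed auto
    show "(\<lambda>a. k - a) ` {k - j<..<k} = {1..<j}"
    proof
      show "{1..<j} \<subseteq> (\<lambda>a. k - a) ` {k - j<..<k}"
      proof
        fix a assume "a \<in> {1..<j}"
        then have "a = k - (k - a)" "k - a \<in> {k - j<..<k}" using assms by auto
        then show "a \<in> (\<lambda>a. k - a) ` {k - j<..<k}" by blast
      qed
    qed (use assms in auto)
  qed
  have "k - t < k - j \<longleftrightarrow> \<not> t < j" using assms t by auto
  moreover have "(\<Union>a\<in>S. B (k - a)) = (\<Union>a\<in>(\<lambda>a. k - a) ` S. B a)" for S :: "nat set" by auto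
  ultimately show ?thesis unfolding arc_def by (cases "t < j") (simp_all only: img if_True if_False simp_thms)
qed

section \<open>The fired set on a cycle\<close>

context
  fixes v c
  assumes v: "v \<in> I'" and c: "c \<in> rec_set I"
begin

abbreviation "od \<equiv> odometer I (add_chip c v)"

abbreviation "fired \<equiv> {w. od w \<noteq> 0}"

text \<open>A fired cycle vertex fires its whole branch by \<open>fired_spreads\<close>, and a
  branch is entered only through its cycle vertex, hence \<open>odometer_support\<close>. An unfired
  cycle vertex next to a fired one receives a chip, so it cannot hold dg - 1; two fired neighbours
  are excluded, as it holds at least dg - 2.\<close>

lemma fired_positions:
  assumes ex: "stab_vec I (add_chip c v) u0" and q: "od q \<noteq> 0" and out: "inflow I od p \<le> 1"
  obtains T where "T \<subseteq> {1..<k}" "t \<in> T" "T \<noteq> {1..<k}" "fired = (\<Union>a\<in>T. B a)"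
    "\<And>a. a \<in> {1..<k} \<Longrightarrow> od (X a) \<noteq> 0 \<longleftrightarrow> a \<in> T"
    "\<And>a. a \<in> {1..<k} - T \<Longrightarrow> a - 1 \<in> T \<or> Suc a \<in> T \<Longrightarrow> X a \<in> deficit dg ring_verts c"
    "\<And>a. a \<in> {1..<k} - T \<Longrightarrow> \<not> (a - 1 \<in> T \<and> Suc a \<in> T)"
proof -
  have o: "stab_vec I (add_chip c v) od" by (rule odometer_stab_vec[OF ex])
  define T where "T = {a\<in>{1..<k}. od (X a) \<noteq> 0}"
  have Tk: "T \<subseteq> {1..<k}" unfolding T_def by auto
  have tT: "t \<in> T" using t q Xt unfolding T_def by auto
  let ?Z = "\<Union>a\<in>T. B a"
  have ZI: "?Z \<subseteq> I" using B_subset Tk by blast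
  have vZ: "v \<in> ?Z" using v Bt tT by auto
  have sub: "od y \<noteq> 0" if y: "y \<in> ?Z" for y
  proof -
    obtain a where a: "a \<in> T" "y \<in> B a" using y by auto
    then have ak: "a \<in> {1..<k}" "od (X a) \<noteq> 0" unfolding T_def by auto
    show ?thesis
    proof (rule fired_spreads[OF rec_setD(3)[OF c] _ o finite_I B_subset[OF ak(1)] X_in_B[OF ak(1)] ak(2) _ a(2)])
      show "c w \<le> add_chip c v w" for w unfolding add_chip_def by auto
      show "z \<in> B a" if "w \<in> B a" "w \<noteq> X a" "W w z \<noteq> 0" for w z
        by (rule ccontr) (use B_edge[of a w z] ak(1) that in simp)
    qed
  qed
  have sup: "od y = 0" if "y \<notin> ?Z" for y
  proof (rule odometer_support[OF ex finite_I ZI _ _ that])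
    show "add_chip c v w < dg w" if "w \<in> I - ?Z" for w
      using that vZ rec_setD(1)[OF c, of w] unfolding add_chip_def by auto
    fix w z assume wz: "w \<in> ?Z" "z \<in> I - ?Z" "W w z \<noteq> 0"
    then obtain a where a: "a \<in> T" "w \<in> B a" by auto
    then have ak: "a \<in> {1..<k}" unfolding T_def by auto
    have zB: "z \<notin> B a" using wz a by auto
    then have w: "w = X a" using B_edge[of a w z] ak a(2) wz(3) by (metis)
    then have "z = X (a - 1) \<or> z = X (Suc a)" using X_edge[OF ak zB] wz(3) by (auto split: if_splits)
    then obtain b where b: "z = X b" "b = a - 1 \<or> b = Suc a" by auto
    have "b \<noteq> 0" "b \<noteq> k" using b(1) wz(2) p_notin X0 Xk by (metis DiffD1)+
    then have "b \<in> {1..<k}" using b(2) ak by auto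
    moreover have "b \<notin> T" using wz(2) X_in_B[OF \<open>b \<in> {1..<k}\<close>] b(1) by blast
    ultimately show "od z = 0" using b(1) unfolding T_def by auto
  qed
  have fired: "fired = ?Z"
  proof (intro set_eqI iffI)
    fix y assume y: "y \<in> fired"
    show "y \<in> ?Z"
    proof (rule ccontr)
      assume "y \<notin> ?Z"
      from sup[OF this] y show False by simp
    qed
  next
    fix y assume "y \<in> ?Z"
    from sub[OF this] show "y \<in> fired" by simp
  qed
  have T_iff: "od (X a) \<noteq> 0 \<longleftrightarrow> a \<in> T" if "a \<in> {1..<k}" for a using that unfolding T_def by simp
  have unfired: "(\<Sum>y\<in>Y. W (X a) y) + c (X a) < dg (X a)"
    if a: "a \<in> {1..<k} - T" and Y: "Y \<subseteq> I" "\<And>y. y \<in> Y \<Longrightarrow> od y \<noteq> 0" for a Y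
  proof -
    have "od (X a) = 0" using T_iff[of a] a by simp
    then have "add_chip c v (X a) + inflow I od (X a) < dg (X a)"
      using stab_vec_unfired[OF o X_in_I[of a]] a by simp
    moreover have "(\<Sum>y\<in>Y. W (X a) y) \<le> inflow I od (X a)"
      using sum_W_le_inflow[OF finite_I Y] .
    moreover have "c (X a) \<le> add_chip c v (X a)" unfolding add_chip_def by auto
    ultimately show ?thesis by linarith
  qed
  have nb: "b \<in> {1..<k} \<and> X b \<in> I \<and> od (X b) \<noteq> 0" if "b \<in> T" for b
    using that Tk T_iff[of b] X_in_I[of b] by (meson subsetD)
  have def: "X a \<in> deficit dg ring_verts c" if a: "a \<in> {1..<k} - T" and n: "a - 1 \<in> T \<or> Suc a \<in> T" for a
  proof -
    obtain b where b: "b \<in> T" "b = a - 1 \<or> b = Suc a" using n by auto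
    have "W (X a) (X b) = 1" using X_edge[of a "X b"] X_pred_succ[of a] a b(2) by auto
    then have "1 + c (X a) < dg (X a)" using unfired[OF a, of "{X b}"] nb[OF b(1)] by auto
    then show ?thesis using a unfolding deficit_def ring_verts_def by auto
  qed
  have nboth: "\<not> (a - 1 \<in> T \<and> Suc a \<in> T)" if a: "a \<in> {1..<k} - T" for a
  proof
    assume n: "a - 1 \<in> T \<and> Suc a \<in> T"
    have ak: "a \<in> {1..<k}" using a by blast
    have "W (X a) (X (a - 1)) = 1" "W (X a) (X (Suc a)) = 1"
      using X_edge[OF ak] X_pred_succ[OF ak] by auto
    then have "2 + c (X a) < dg (X a)"
      using unfired[OF a, of "{X (a - 1), X (Suc a)}"] nb n X_pred_succ(3)[OF ak] by auto
    then show False using config_X_ge[OF c ak] by linarith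
  qed
  \<comment> \<open>If all positions fired, the two end positions, distinct by \<open>k3\<close>,
    would both send a chip to p.\<close>
  have "T \<noteq> {1..<k}"
  proof
    assume "T = {1..<k}"
    then have m: "1 \<in> T" "k - 1 \<in> T" using k3 by auto
    have "W p (X 1) = 1" "W p (X (k - 1)) = 1" using W_p_X by blast+
    moreover have "X 1 \<noteq> X (k - 1)" using inj_onD[OF X_inj, of 1 "k - 1"] m Tk k3 by auto
    moreover have "(\<Sum>y\<in>{X 1, X (k - 1)}. W p y) \<le> inflow I od p"
      by (rule sum_W_le_inflow[OF finite_I]) (use nb m in auto)
    ultimately show False using out by simp
  qed
  then show ?thesis by (rule that[OF Tk tT _ fired T_iff def nboth])
qed

lemma outflow_ge_1:
  assumes "a = 1 \<or> a = k - 1" "od (X a) \<noteq> 0"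
  shows "1 \<le> inflow I od p"
proof -
  have ak: "a \<in> {1..<k}" using assms(1) k3 by auto
  have "W p (X a) \<le> inflow I od p" 
    by (rule W_le_inflow[of I "X a" od p, OF finite_I X_in_I[OF ak] assms(2)])
  then show ?thesis using W_p_X[OF assms(1)] by simp
qed

text \<open>\<open>fired_interval\<close> gives an arc that begins at position 1. As this position
  fires, the root receives a chip, which turns the bound on the outflow into an equality.\<close>

lemma fired_arc_right:
  assumes ex: "stab_vec I (add_chip c v) u0" and q: "od q \<noteq> 0" and out: "inflow I od p \<le> 1"
    and b: "t < b" "b < k" "od (X b) = 0"
  shows "\<exists>j\<in>{1..<k}. j \<noteq> t \<and> deficit dg ring_verts c = {X j} \<and> fired = arc B k t j \<and>
    inflow I od p = 1"
proof -
  obtain T where T: "T \<subseteq> {1..<k}" "t \<in> T" "T \<noteq> {1..<k}" "fired = (\<Union>a\<in>T. B a)"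
    "\<And>a. a \<in> {1..<k} \<Longrightarrow> od (X a) \<noteq> 0 \<longleftrightarrow> a \<in> T"
    "\<And>a. a \<in> {1..<k} - T \<Longrightarrow> a - 1 \<in> T \<or> Suc a \<in> T \<Longrightarrow> X a \<in> deficit dg ring_verts c"
    "\<And>a. a \<in> {1..<k} - T \<Longrightarrow> \<not> (a - 1 \<in> T \<and> Suc a \<in> T)"
    using fired_positions[OF ex q out] by blast
  define D where "D = {a\<in>{1..<k}. X a \<in> deficit dg ring_verts c}"
  have uniq: "a = b" if "a \<in> D" "b \<in> D" for a b
    using that deficit_unique[OF c] unfolding D_def deficit_def by blast
  have "b \<notin> T" using T(5)[of b] b by auto
  then obtain j where j: "t < j" "j < k" "j \<in> D" "T = {1..<j}"
    using fired_interval[of T k t b D] T(1,2) b T(6,7) uniq unfolding D_def by blast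
  have "deficit dg ring_verts c \<subseteq> {X j}"
    using uniq[OF _ j(3)] deficit_subset[of c] unfolding D_def ring_verts_def by blast
  then have "deficit dg ring_verts c = {X j}" using j(3) unfolding D_def by blast
  moreover have "1 \<in> T" using j t by auto
  then have "inflow I od p = 1" using outflow_ge_1[of 1] T(5)[of 1] k3 out by auto
  ultimately show ?thesis using j T(4) t unfolding arc_def by (intro bexI[of _ j]) auto
qed

end

text \<open>Not all positions are fired; if an unfired one lies before t, the reflected cycle is
  used.\<close>

lemma fired_arc:
  assumes v: "v \<in> I'" and c: "c \<in> rec_set I" and ex: "stab_vec I (add_chip c v) u0"
    and q: "odometer I (add_chip c v) q \<noteq> 0" and out: "inflow I (odometer I (add_chip c v)) p \<le> 1"
  obtains j where "j \<in> {1..<k}" "j \<noteq> t" "deficit dg ring_verts c = {X j}"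
    "{w. odometer I (add_chip c v) w \<noteq> 0} = arc B k t j"
    "inflow I (odometer I (add_chip c v)) p = 1"
proof -
  let ?o = "odometer I (add_chip c v)"
  obtain T where T: "T \<subseteq> {1..<k}" "t \<in> T" "T \<noteq> {1..<k}"
    "\<And>a. a \<in> {1..<k} \<Longrightarrow> ?o (X a) \<noteq> 0 \<longleftrightarrow> a \<in> T"
    using fired_positions[OF v c ex q out] by metis
  then obtain b where b: "b \<in> {1..<k}" "b \<noteq> t" "?o (X b) = 0" by blast
  show ?thesis
  proof (cases "t < b")
    case True
    then show ?thesis
      using fired_arc_right[OF v c ex q out True _ b(3)] b(1) that by (metis atLeastLessThan_iff)
  next
    case False
    interpret r: chain_ring W dg I p k "\<lambda>a. X (k - a)" "\<lambda>a. B (k - a)" I' q "k - t"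
      by (rule chain_ring_reflect)
    have "k - t < k - b" "k - b < k" "?o (X (k - (k - b))) = 0" using False b t by auto
    from r.fired_arc_right[OF v c ex q out this]
    obtain j where j: "j \<in> {1..<k}" "j \<noteq> k - t" "deficit dg ring_verts c = {X (k - j)}"
      "{w. ?o w \<noteq> 0} = arc (\<lambda>a. B (k - a)) k (k - t) j" "inflow I ?o p = 1"
      unfolding ring_verts_reflect by auto
    have 1: "k - j \<in> {1..<k}" "k - j \<noteq> t" "k - (k - j) = j" using j(1,2) t by auto
    have "arc (\<lambda>a. B (k - a)) k (k - t) (k - (k - j)) = arc B k t (k - j)"
      by (rule arc_reflect[OF 1(1,2)])
    then have arc: "{w. ?o w \<noteq> 0} = arc B k t (k - j)" by (simp only: 1(3) j(4))
    show ?thesis by (rule that[of "k - j", OF 1(1) 1(2) j(3) arc j(5)])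
  qed
qed

text \<open>The trapezoid \<open>min (min a (j - a)) (min t (j - t))\<close> (truncated subtraction makes it vanish
  beyond \<open>j\<close>) counts the firings on the cycle when the deficient vertex sits at position \<open>j > t\<close>
  and one chip arrives at position \<open>t\<close>.\<close>

lemma outflow_le_1_right:
  assumes v: "v \<in> I'" and c: "c \<in> rec_set I"
    and good: "restr I' c \<in> good v I' q" and j: "t < j" "j < k" "deficit dg ring_verts c = {X j}"
    and ex': "stab_vec I' (add_chip c v) u'"
  shows "\<exists>u. stab_vec I (add_chip c v) u \<and> inflow I u p \<le> 1"
proof -
  define o' where "o' = odometer I' (add_chip c v)"
  have o': "stab_vec I' (add_chip c v) o'" unfolding o'_def by (rule odometer_stab_vec[OF ex'])
  have o'0: "o' w = 0" if "w \<notin> I'" for w using o' that unfolding stab_vec_def by blast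
  have "odometer I' (add_chip (restr I' c) v) = o'"
    unfolding o'_def by (rule odometer_cong) (auto simp: add_chip_def restr_def v)
  then have out': "inflow I' o' q = 1" using good unfolding good_def by simp
  define \<tau> where "\<tau> a = min (min a (j - a)) (min t (j - t))" for a
  \<comment> \<open>Extends \<tau> constantly over each branch; the branches are disjoint, so at
    most one summand is nonzero.\<close>
  define \<theta> where "\<theta> w = (\<Sum>a\<in>{1..<k}. if w \<in> B a then \<tau> a else 0)" for w
  have \<theta>B: "\<theta> w = \<tau> a" if "a \<in> {1..<k}" "w \<in> B a" for a w
  proof -
    have "\<theta> w = (\<Sum>b\<in>{1..<k}. if b = a then \<tau> a else 0)"
      unfolding \<theta>_def using that B_disjoint by (intro sum.cong) auto
    then show ?thesis using that by simp
  qed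
  have \<theta>0: "\<theta> w = 0" if "\<And>a. a \<in> {1..<k} \<Longrightarrow> w \<notin> B a" for w
    unfolding \<theta>_def using that by (intro sum.neutral) auto
  have \<theta>p: "\<theta> p = 0" using \<theta>0 B_subset p_notin by blast
  have \<theta>X: "\<theta> (X a) = \<tau> a" if ak: "a \<le> k" for a
  proof -
    consider "a = 0" | "a = k" | "a \<in> {1..<k}" using ak by fastforce
    then show ?thesis
    proof cases
      case 2
      then show ?thesis using \<theta>p Xk j unfolding \<tau>_def by simp
    qed (use \<theta>p X0 \<theta>B X_in_B in \<open>auto simp: \<tau>_def\<close>)
  qed
  define u where "u w = o' w + \<theta> w" for w
  have infl: "inflow I u w = inflow I' o' w + inflow I \<theta> w" for w
  proof -
    have "inflow I u w = inflow I o' w + inflow I \<theta> w"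
      unfolding inflow_def u_def by (simp add: distrib_left sum.distrib)
    then show ?thesis using inflow_superset[OF finite_I I'_subset, of w o'] o'0 by simp
  qed
  have o'_infl0: "inflow I' o' w = 0" if "w \<notin> insert q I'" for w
    unfolding inflow_def using that cut_off_edge[OF cut_off_I', of _ w] W_sym[of w]
    by (intro sum.neutral) auto
  \<comment> \<open>Away from the cycle vertex \<theta> is constant along all edges of the branch,
    so its contribution is balanced exactly by the degree.\<close>
  have \<theta>_in: "inflow I \<theta> w = \<tau> a * dg w" if a: "a \<in> {1..<k}" and w: "w \<in> B a" "w \<noteq> X a" for a w
  proof -
    have "inflow I \<theta> w = (\<Sum>y\<in>I. W w y * \<tau> a)"
      unfolding inflow_def
    proof (rule sum.cong)
      fix y assume "y \<in> I"
      show "W w y * \<theta> y = W w y * \<tau> a" using B_edge[OF a w, of y] \<theta>B[OF a, of y] by (cases "y \<in> B a") auto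
    qed simp
    also have "\<dots> = dg w * \<tau> a"
      using sum_W_branch[OF a w B_subset[OF a] finite_I] by (simp add: sum_distrib_right[symmetric])
    finally show ?thesis by simp
  qed
  \<comment> \<open>The Laplacian of \<theta> at a cycle vertex, with \<open>2 * \<tau> a\<close> on
    the left to stay within the naturals.\<close>
  have \<theta>_X: "inflow I \<theta> (X a) + 2 * \<tau> a = dg (X a) * \<tau> a + \<tau> (a - 1) + \<tau> (Suc a)"
    if a: "a \<in> {1..<k}" for a
  proof -
    let ?J = "insert p I" let ?N = "{X (a - 1), X (Suc a)}"
    have BJ: "B a \<subseteq> ?J" using B_subset[OF a] by blast
    have finB: "finite (B a)" using B_subset[OF a] finite_I finite_subset by blast
    have XI: "X b \<in> ?J" if "b \<le> k" for b
      using that X_in_I[of b] X0 Xk by (cases "b = 0"; cases "b = k") auto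
    have N: "?N \<subseteq> ?J - B a" using XI[of "a - 1"] XI[of "Suc a"] a X_pred_succ(1,2)[OF a] by auto
    have W1: "W (X a) y = 1" if "y \<in> ?N" for y using X_edge[OF a, of y] that X_pred_succ[OF a] by auto
    have "inflow I \<theta> (X a) = inflow ?J \<theta> (X a)"
      using \<theta>p finite_I by (intro inflow_superset[symmetric]) auto
    also have "\<dots> = (\<Sum>y\<in>?J - B a. W (X a) y * \<theta> y) + (\<Sum>y\<in>B a. W (X a) y * \<theta> y)"
      unfolding inflow_def using BJ finite_I by (intro sum.subset_diff) auto
    also have "(\<Sum>y\<in>?J - B a. W (X a) y * \<theta> y) = (\<Sum>y\<in>?N. W (X a) y * \<theta> y)"
      using N finite_I X_edge[OF a] by (intro sum.mono_neutral_right) auto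
    also have "\<dots> = \<theta> (X (a - 1)) + \<theta> (X (Suc a))" using W1 X_pred_succ(3)[OF a] by simp
    also have "\<dots> = \<tau> (a - 1) + \<tau> (Suc a)" using \<theta>X[of "a - 1"] \<theta>X[of "Suc a"] a by auto
    also have "(\<Sum>y\<in>B a. W (X a) y * \<theta> y) = (\<Sum>y\<in>B a. W (X a) y) * \<tau> a"
      unfolding sum_distrib_right using \<theta>B[OF a] by (intro sum.cong) auto
    finally have eq: "inflow I \<theta> (X a) = \<tau> (a - 1) + \<tau> (Suc a) + (\<Sum>y\<in>B a. W (X a) y) * \<tau> a" .
    have "dg (X a) = (\<Sum>y\<in>B a. W (X a) y) + 2"
      using sum_W_X[OF a order.refl finB] X_pred_succ[OF a] by simp
    then show ?thesis unfolding eq by (simp add: algebra_simps)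
  qed
  have \<theta>_out: "inflow I \<theta> w = 0" if w: "\<And>a. a \<in> {1..<k} \<Longrightarrow> w \<notin> B a" "w \<noteq> p" for w
    unfolding inflow_def
  proof (intro sum.neutral ballI)
    fix y assume "y \<in> I"
    show "W w y * \<theta> y = 0"
    proof (cases "\<exists>a\<in>{1..<k}. y \<in> B a")
      case True
      then obtain a where a: "a \<in> {1..<k}" "y \<in> B a" by blast
      have nX: "w \<noteq> X b" if "b \<le> k" for b
      proof (cases "b \<in> {1..<k}")
        case True
        then show ?thesis using X_in_B w(1) by blast
      next
        case False
        then have "b = 0 \<or> b = k" using that by auto
        then show ?thesis using X0 Xk w(2) by auto
      qed
      have "a - 1 \<le> k" "Suc a \<le> k" using a(1) by auto
      then have "w \<noteq> X (a - 1)" "w \<noteq> X (Suc a)" using nX by blast+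
      then have "W y w = 0" using B_edge[OF a _ w(1)[OF a(1)]] X_edge[OF a(1) w(1)[OF a(1)]]
        by (cases "y = X a") auto
      then show ?thesis using W_sym[of w y] by simp
    next
      case False
      then show ?thesis using \<theta>0[of y] by auto
    qed
  qed
  have cX: "c (X a) + (if a = j then 2 else 1) \<le> dg (X a)" if a: "a \<in> {1..<k}" for a
  proof -
    have "X a \<in> ring_verts" using a unfolding ring_verts_def by blast
    moreover have "X a = X j \<longleftrightarrow> a = j" using inj_onD[OF X_inj] a j t by auto
    ultimately show ?thesis using config_ring_vert[OF c] j(3) dg_X_ge_2[OF a] by auto
  qed
  have "add_chip c v w + inflow I u w < dg w * Suc (u w)" if wI: "w \<in> I" for w
  proof (cases "\<exists>a\<in>{1..<k}. w \<in> B a")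
    case False
    then have nB: "\<And>a. a \<in> {1..<k} \<Longrightarrow> w \<notin> B a" by blast
    have "w \<notin> insert q I'" using nB[OF t] Bt by blast
    moreover have "w \<noteq> p" using wI p_notin by blast
    ultimately have "inflow I u w = 0" unfolding infl using \<theta>_out nB o'_infl0 by simp
    then show ?thesis using rec_setD(1)[OF c wI] v \<open>w \<notin> insert q I'\<close> unfolding add_chip_def by auto
  next
    case True
    then obtain a where a: "a \<in> {1..<k}" "w \<in> B a" by blast
    have uw: "u w = o' w + \<tau> a" unfolding u_def using \<theta>B[OF a] by simp
    show ?thesis
    proof (cases "w = X a")
      case False
      have "add_chip c v w + inflow I' o' w < dg w * Suc (o' w)"
      proof (cases "a = t")
        case True
        then have "w \<in> I'" using a(2) False Bt Xt by auto
        then show ?thesis using o' unfolding stab_vec_def by blast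
      next
        case at: False
        then have "w \<notin> insert q I'" using B_disjoint[OF a(1) t] a(2) Bt by auto
        then show ?thesis
          using rec_setD(1)[OF c wI] v o'_infl0 unfolding add_chip_def by (cases "w = v") auto
      qed
      then show ?thesis unfolding infl uw \<theta>_in[OF a False] by (simp add: algebra_simps)
    next
      case True
      have wI': "w \<notin> I'" using ring_verts_I' a(1) True unfolding ring_verts_def by blast
      have 1: "add_chip c v w = c w" using v wI' unfolding add_chip_def by auto
      have 2: "inflow I' o' w = (if a = t then 1 else 0)"
      proof (cases "a = t")
        case True
        then show ?thesis using out' \<open>w = X a\<close> Xt by simp
      next
        case False
        then have "w \<noteq> q" using True Xt inj_onD[OF X_inj _ a(1) t] by auto
        then show ?thesis using o'_infl0[of w] wI' False by simp
      qed
      have "\<tau> (a - 1) + \<tau> (Suc a) + (if a = t then 1 else 0) \<le> 2 * \<tau> a + (if a = j then 1 else 0)"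
        unfolding \<tau>_def using a(1) j(1) t by (intro trapezoid_concave) auto
      moreover have "inflow I u w + 2 * \<tau> a = (if a = t then 1 else 0) + dg w * \<tau> a + \<tau> (a - 1) + \<tau> (Suc a)"
        unfolding infl 2 using \<theta>_X[OF a(1)] True by simp
      moreover have "c w + (if a = j then 2 else 1) \<le> dg w" using cX[OF a(1)] True by simp
      ultimately have "c w + inflow I u w < dg w + dg w * \<tau> a" using j(1) by (auto split: if_splits)
      then show ?thesis unfolding 1 uw using o'0[OF wI'] by simp
    qed
  qed
  moreover have "u w = 0" if "w \<notin> I" for w
    using that o'0 I'_subset \<theta>0[of w] B_subset unfolding u_def by blast
  ultimately have "stab_vec I (add_chip c v) u" unfolding stab_vec_def by blast
  moreover have "inflow I u p \<le> 1"
  proof -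
    have "p \<notin> insert q I'" using I'_subset q_in_I p_notin by auto
    then have "inflow I' o' p = 0" by (rule o'_infl0)
    \<comment> \<open>Only the first position feeds p: the last one, k - 1, is at or beyond j and
      has \<tau> = 0.\<close>
    moreover have "inflow I \<theta> p = (\<Sum>y\<in>{X 1}. W p y * \<theta> y)"
      unfolding inflow_def
    proof (rule sum.mono_neutral_right)
      show "{X 1} \<subseteq> I" using X_in_I[of 1] k3 by auto
      show "\<forall>y\<in>I - {X 1}. W p y * \<theta> y = 0"
      proof
        fix y assume y: "y \<in> I - {X 1}"
        show "W p y * \<theta> y = 0"
        proof (cases "\<exists>a\<in>{1..<k}. y \<in> B a")
          case True
          then obtain a where a: "a \<in> {1..<k}" "y \<in> B a" by blast
          have pB: "p \<notin> B a" using B_subset[OF a(1)] p_notin by blast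
          show ?thesis
          proof (cases "W p y = 0")
            case False
            then have Wy: "W y p \<noteq> 0" using W_sym[of p y] by simp
            then have ya: "y = X a" using B_edge[of a y p] a pB by metis
            then have "p = X (a - 1) \<or> p = X (Suc a)"
              using Wy X_edge[OF a(1) pB] by (auto split: if_splits)
            moreover have "p \<noteq> X b" if "b \<in> {1..<k}" for b using X_in_I[OF that] p_notin by blast
            ultimately have "a - 1 \<notin> {1..<k} \<or> Suc a \<notin> {1..<k}" by blast
            moreover have "a \<noteq> 1" using ya y by auto
            ultimately have "a = k - 1" using a(1) by auto
            then have "\<tau> a = 0" using j unfolding \<tau>_def by simp
            then show ?thesis using \<theta>B[OF a] by simp
          qed simp
        next
          case False
          then show ?thesis using \<theta>0[of y] by auto
        qed
      qed
    qed (use finite_I in auto)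
    moreover have "W p (X 1) \<le> 1" using W_p_X by (metis order.refl)
    moreover have "\<theta> (X 1) \<le> 1" using \<theta>X[of 1] k3 unfolding \<tau>_def by (simp add: min_le_iff_disj)
    ultimately show ?thesis unfolding infl using mult_le_mono[of "W p (X 1)" 1 "\<theta> (X 1)" 1] by simp
  qed
  ultimately show ?thesis by blast
qed

lemma outflow_le_1:
  assumes v: "v \<in> I'" and c: "c \<in> rec_set I" and good: "restr I' c \<in> good v I' q"
    and j: "j \<in> {1..<k}" "j \<noteq> t" "deficit dg ring_verts c = {X j}"
    and ex': "stab_vec I' (add_chip c v) u'"
  shows "\<exists>u. stab_vec I (add_chip c v) u \<and> inflow I u p \<le> 1"
proof (cases "t < j")
  case True
  then show ?thesis using outflow_le_1_right[OF v c good True _ j(3) ex'] j(1) by auto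
next
  case False
  interpret r: chain_ring W dg I p k "\<lambda>a. X (k - a)" "\<lambda>a. B (k - a)" I' q "k - t"
    by (rule chain_ring_reflect)
  have "k - t < k - j" "k - j < k" "deficit dg (r.ring_verts) c = {X (k - (k - j))}"
    using False j t unfolding ring_verts_reflect by auto
  then show ?thesis using r.outflow_le_1_right[OF v c good _ _ _ ex'] by blast
qed

text \<open>The chip arriving at q topples it because q is not the deficient vertex, and the
  explicit vector of \<open>outflow_le_1\<close> bounds the outflow by one; \<open>fired_arc\<close>
  then determines the rest.\<close>

lemma good_step:
  assumes v: "v \<in> I'" and c: "c \<in> rec_set I" and good: "restr I' c \<in> good v I' q"
    and j: "j \<in> {1..<k}" "j \<noteq> t" "deficit dg ring_verts c = {X j}"
    and ex: "stab_vec I (add_chip c v) u0"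
  shows "c \<in> good v I p" and "{w. odometer I (add_chip c v) w \<noteq> 0} = arc B k t j"
proof -
  let ?o = "odometer I (add_chip c v)"
  have ex': "stab_vec I' (add_chip c v) (\<lambda>w. if w \<in> I' then ?o w else 0)"
    by (rule stab_vec_restrict[OF odometer_stab_vec[OF ex] I'_subset finite_I]) simp
  obtain u where u: "stab_vec I (add_chip c v) u" "inflow I u p \<le> 1"
    using outflow_le_1[OF v c good j ex'] by blast
  have out: "inflow I ?o p \<le> 1"
    by (rule order.trans[OF inflow_mono[OF odometer_le[OF u(1)]] u(2)])
  have "?o q \<noteq> 0"
  proof
    assume q0: "?o q = 0"
    have "odometer I' (add_chip (restr I' c) v) = odometer I' (add_chip c v)"
      by (rule odometer_cong) (auto simp: add_chip_def restr_def v)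
    then have "1 = inflow I' (odometer I' (add_chip c v)) q" using good unfolding good_def by simp
    also have "\<dots> \<le> inflow I' (\<lambda>w. if w \<in> I' then ?o w else 0) q"
      by (rule inflow_mono[OF odometer_le[OF ex']])
    also have "\<dots> = inflow I' ?o q" unfolding inflow_def by (rule sum.cong) auto
    also have "\<dots> \<le> inflow I ?o q" by (rule inflow_subset_le[OF finite_I I'_subset])
    finally have 1: "1 \<le> inflow I ?o q" .
    have "X j \<noteq> q" using inj_onD[OF X_inj _ j(1) t] Xt j(2) by auto
    then have "q \<notin> deficit dg ring_verts c" using j(3) by auto
    moreover have "q \<in> ring_verts" using Xt t unfolding ring_verts_def by auto
    ultimately have "c q = dg q - 1" unfolding deficit_def by auto
    moreover have "add_chip c v q + inflow I ?o q < dg q"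
      by (rule stab_vec_unfired[OF odometer_stab_vec[OF ex] q_in_I q0])
    moreover have "add_chip c v q = c q" using v q_notin unfolding add_chip_def by auto
    ultimately show False using 1 by linarith
  qed
  from fired_arc[OF v c ex this out]
  obtain j' where j': "j' \<in> {1..<k}" "j' \<noteq> t" "deficit dg ring_verts c = {X j'}"
    "{w. ?o w \<noteq> 0} = arc B k t j'" "inflow I ?o p = 1" .
  have "j = j'" using inj_onD[OF X_inj _ j(1) j'(1)] j(3) j'(3) by auto
  then show "{w. ?o w \<noteq> 0} = arc B k t j" using j'(4) by simp
  show "c \<in> good v I p" unfolding good_def using c j'(5) by simp
qed

lemma finite_arc:
  assumes "j \<in> {1..<k}"
  shows "finite (arc B k t j)"
proof (rule finite_subset[OF _ finite_I])
  have "a \<in> {1..<k}" if "a \<in> (if t < j then {1..<j} else {j<..<k})" for a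
    using assms that by (auto split: if_splits)
  then show "arc B k t j \<subseteq> I" unfolding arc_def using B_subset by blast
qed

text \<open>On either side of t the arcs grow strictly with the distance of j from t, so each side
  contributes at most one position. This is the origin of the constant 2 in the upper bound.\<close>

lemma card_arc_positions:
  "card {j\<in>{1..<k}. j \<noteq> t \<and> card (arc B k t j) = M} \<le> 2"
proof -
  let ?R = "{j\<in>{1..<k}. t < j \<and> card (arc B k t j) = M}"
  let ?L = "{j\<in>{1..<k}. j < t \<and> card (arc B k t j) = M}"
  have mono: "card (arc B k t i) < card (arc B k t j)"
    if ij: "i \<in> {1..<k}" "j \<in> {1..<k}" "t < i \<and> i < j \<or> j < i \<and> i < t" for i j
  proof (rule psubset_card_mono[OF finite_arc[OF ij(2)]])
    have "X i \<in> arc B k t j" "X i \<notin> arc B k t i"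
      using ij X_in_B[OF ij(1)] X_in_B_iff[OF _ ij(1)] unfolding arc_def
      by (auto split: if_splits)
    moreover have "arc B k t i \<subseteq> arc B k t j"
      unfolding arc_def using ij by (intro UN_mono) (auto split: if_splits)
    ultimately show "arc B k t i \<subset> arc B k t j" by blast
  qed
  have "i = j" if "i \<in> ?R" "j \<in> ?R" for i j
    using mono[of i j] mono[of j i] that by (cases i j rule: linorder_cases) auto
  moreover have "i = j" if "i \<in> ?L" "j \<in> ?L" for i j
    using mono[of i j] mono[of j i] that by (cases i j rule: linorder_cases) auto
  moreover have fin: "finite ?R" "finite ?L" by auto
  ultimately have "card ?R \<le> Suc 0" "card ?L \<le> Suc 0" by (meson card_le_Suc0_iff_eq)+
  moreover have "{j\<in>{1..<k}. j \<noteq> t \<and> card (arc B k t j) = M} \<subseteq> ?R \<union> ?L" by auto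
  then have "card {j\<in>{1..<k}. j \<noteq> t \<and> card (arc B k t j) = M} \<le> card ?R + card ?L"
    using fin by (meson card_mono card_Un_le finite_UnI order.trans)
  ultimately show ?thesis by linarith
qed

end

section \<open>Avalanche probabilities along the chain of cycles\<close>

context wgraph
begin

text \<open>The avalanches of mass \<open>M\<close> that do not fire \<open>p\<close>; the state of \<open>p\<close> is part of the
  configuration on the larger set \<open>I'\<close>.\<close>

definition stopped :: "'v \<Rightarrow> 'v set \<Rightarrow> 'v \<Rightarrow> 'v set \<Rightarrow> nat \<Rightarrow> 'v config set" where
  "stopped v I p I' M = {c\<in>rec_set I'.
     c p + inflow I (odometer I (add_chip c v)) p < dg p \<and>
     card {w. odometer I (add_chip c v) w \<noteq> 0} = M}"

lemma stopped_subset: "stopped v I p I' M \<subseteq> rec_set I'"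
  unfolding stopped_def by auto

text \<open>Such a small mass leaves p unfired, so the avalanche is that of I and the event is read
  off from the restriction to I', which is uniform. The right-hand side does not involve J: this
  makes the avalanche probabilities eventually constant.\<close>

lemma mass_fraction:
  assumes cut: "cut_off I p" and cut': "cut_off I' p'" and sub: "insert p I \<subseteq> I'" "I' \<subseteq> J"
    and fin: "finite J" and v: "v \<in> I" and h: "superharmonic J h" and M: "M < card (insert p I)"
  shows "card {c\<in>rec_set J. card {w. odometer J (add_chip c v) w \<noteq> 0} = M} / card (rec_set J)
    = card (stopped v I p I' M) / card (rec_set I')"
proof -
  have pJ: "insert p I \<subseteq> J" using sub by blast
  have eq: "card {w. odometer J (add_chip c v) w \<noteq> 0} = M \<longleftrightarrow> restr I' c \<in> stopped v I p I' M"
    if c: "c \<in> rec_set J" for c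
  proof -
    obtain u where u: "stab_vec J (add_chip c v) u" using stab_vec_exists[OF h fin] .
    have o: "stab_vec J (add_chip c v) (odometer J (add_chip c v))" by (rule odometer_stab_vec[OF u])
    have finF: "finite {w. odometer J (add_chip c v) w \<noteq> 0}"
      by (rule finite_subset[OF _ fin]) (use o in \<open>auto simp: stab_vec_def\<close>)
    have p0: "odometer J (add_chip c v) p = 0" if "card {w. odometer J (add_chip c v) w \<noteq> 0} = M"
    proof (rule ccontr)
      assume "odometer J (add_chip c v) p \<noteq> 0"
      then have "insert p I \<subseteq> {w. odometer J (add_chip c v) w \<noteq> 0}"
        using cut_vertex_fired[OF cut pJ fin c o] by blast
      then have "card (insert p I) \<le> card {w. odometer J (add_chip c v) w \<noteq> 0}"
        by (rule card_mono[OF finF])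
      then show False using that M by simp
    qed
    have r: "odometer I (add_chip (restr I' c) v) = odometer I (add_chip c v)"
      by (rule odometer_cong) (use sub in \<open>auto simp: add_chip_def restr_def\<close>)
    have rp: "restr I' c p = c p" using sub unfolding restr_def by auto
    note oc = odometer_cut_off[OF cut pJ fin c v u]
    have "restr I' c \<in> stopped v I p I' M \<longleftrightarrow>
        c p + inflow I (odometer I (add_chip c v)) p < dg p \<and> card {w. odometer I (add_chip c v) w \<noteq> 0} = M"
      unfolding stopped_def using rec_set_restr[OF c sub(2)] by (simp add: r rp)
    also have "\<dots> \<longleftrightarrow> odometer J (add_chip c v) p = 0 \<and> card {w. odometer J (add_chip c v) w \<noteq> 0} = M"
      using oc by auto
    finally show ?thesis using p0 by blast
  qed
  obtain g where g: "\<And>A. A \<subseteq> rec_set I' \<Longrightarrow> card {c\<in>rec_set J. restr I' c \<in> A} = g * card A"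
    using rec_set_restr_fibres[OF cut' sub(2) fin] by blast
  have "{c\<in>rec_set J. restr I' c \<in> rec_set I'} = rec_set J" using rec_set_restr[OF _ sub(2)] by blast
  then have total: "card (rec_set J) = g * card (rec_set I')" using g[of "rec_set I'"] by simp
  have "rec_set J \<noteq> {}" using max_config_in_rec_set[OF h fin] by blast
  then have "g \<noteq> 0" using total finite_rec_set[OF fin] by auto
  moreover have "{c\<in>rec_set J. card {w. odometer J (add_chip c v) w \<noteq> 0} = M}
      = {c\<in>rec_set J. restr I' c \<in> stopped v I p I' M}" using eq by blast
  ultimately show ?thesis using g[OF stopped_subset] total by simp
qed

end

text \<open>Only the rows of W at vertices of I' enter; this transfers the event between a finite
  \<open>H n\<close> and the infinite graph.\<close>

lemma stopped_cong:
  assumes G: "wgraph W dg" and G': "wgraph W' dg'"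
    and eq: "\<And>w. w \<in> I' \<Longrightarrow> W w = W' w \<and> dg w = dg' w" and sub: "insert p I \<subseteq> I'"
  shows "wgraph.rec_set W dg I' = wgraph.rec_set W' dg' I'"
    and "wgraph.stopped W dg v I p I' M = wgraph.stopped W' dg' v I p I' M"
proof -
  have allowed: "wgraph.allowed W I' c = wgraph.allowed W' I' c" for c
  proof -
    have "(\<exists>w\<in>U. (\<Sum>u\<in>U. W w u) \<le> c w) \<longleftrightarrow> (\<exists>w\<in>U. (\<Sum>u\<in>U. W' w u) \<le> c w)" if "U \<subseteq> I'" for U
      using eq that by (intro bex_cong) auto
    then show ?thesis unfolding wgraph.allowed_def[OF G] wgraph.allowed_def[OF G'] by blast
  qed
  show R: "wgraph.rec_set W dg I' = wgraph.rec_set W' dg' I'"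
    unfolding wgraph.rec_set_def[OF G] wgraph.rec_set_def[OF G'] allowed using eq by auto
  have infl: "wgraph.inflow W I u w = wgraph.inflow W' I u w" if "w \<in> I'" for u w
    unfolding wgraph.inflow_def[OF G] wgraph.inflow_def[OF G'] using eq[OF that] by simp
  have "wgraph.stab_vec W dg I c u = wgraph.stab_vec W' dg' I c u" for c u
    unfolding wgraph.stab_vec_def[OF G] wgraph.stab_vec_def[OF G'] using infl eq sub
    by (metis insert_subset subsetD)
  then have od: "wgraph.odometer W dg I c = wgraph.odometer W' dg' I c" for c
    unfolding wgraph.odometer_def[OF G] wgraph.odometer_def[OF G'] by simp
  have "p \<in> I'" using sub by blast
  then show "wgraph.stopped W dg v I p I' M = wgraph.stopped W' dg' v I p I' M"
    unfolding wgraph.stopped_def[OF G] wgraph.stopped_def[OF G'] R od infl[OF \<open>p \<in> I'\<close>]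
    using eq by simp
qed

text \<open>Beyond J0 every block is a cycle of length at least 3; of the earlier pieces only the
  nesting and their dissipativity are known.\<close>

locale ring_chain = wgraph +
  fixes v :: 'a and p :: "nat \<Rightarrow> 'a" and I :: "nat \<Rightarrow> 'a set" and J0 :: nat
    and k :: "nat \<Rightarrow> nat" and X :: "nat \<Rightarrow> nat \<Rightarrow> 'a" and B :: "nat \<Rightarrow> nat \<Rightarrow> 'a set"
    and t :: "nat \<Rightarrow> nat"
  assumes J0: "1 \<le> J0"
    and cut_off_I: "1 \<le> i \<Longrightarrow> cut_off (I i) (p i)"
    and v_in_I: "1 \<le> i \<Longrightarrow> v \<in> I i"
    and I_step: "1 \<le> i \<Longrightarrow> insert (p i) (I i) \<subseteq> I (Suc i)"
    and rings: "J0 < i \<Longrightarrow> chain_ring W dg (I i) (p i) (k i) (X i) (B i) (I (i - 1)) (p (i - 1)) (t i)"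
    and superharmonic_I: "1 \<le> i \<Longrightarrow> \<exists>h. superharmonic (I i) h"
begin

lemma finite_I: "1 \<le> i \<Longrightarrow> finite (I i)"
  using cut_off_I unfolding cut_off_def by blast

lemma stab_vec_I: "1 \<le> i \<Longrightarrow> \<exists>u. stab_vec (I i) c u"
  using superharmonic_I stab_vec_exists[OF _ finite_I] by metis

lemma rec_set_I_nonempty: "1 \<le> i \<Longrightarrow> rec_set (I i) \<noteq> {}"
  using superharmonic_I max_config_in_rec_set[OF _ finite_I] by blast

lemma card_rec_set_I_pos: "1 \<le> i \<Longrightarrow> 0 < card (rec_set (I i))"
  using rec_set_I_nonempty finite_rec_set[OF finite_I] by (simp add: card_gt_0_iff)

definition frac :: "nat \<Rightarrow> 'a config set \<Rightarrow> real" where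
  "frac i A = card A / card (rec_set (I i))"

abbreviation "defic i \<equiv> deficit dg (ring_graph.ring_verts (k i) (X i))"

abbreviation "states i \<equiv> ring_graph.deficit_states (k i) (X i)"

lemma ring_graph_i: "J0 < i \<Longrightarrow> ring_graph W dg (I i) (p i) (k i) (X i) (B i)"
  by (rule chain_ring.axioms(1)[OF rings])

lemma frac_ring:
  assumes i: "J0 < i" and A: "A \<subseteq> rec_set (I (i - 1))" and D: "D \<subseteq> states i"
  shows "frac i {c\<in>rec_set (I i). restr (I (i - 1)) c \<in> A \<and> defic i c \<in> D}
    = frac (i - 1) A * (card D / k i)"
proof -
  interpret chain_ring W dg "I i" "p i" "k i" "X i" "B i" "I (i - 1)" "p (i - 1)" "t i"
    by (rule rings[OF i])
  show ?thesis
    unfolding frac_def using ring_fibres_fraction[OF A D rec_set_I_nonempty] i J0 by simp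
qed

lemma frac_mono:
  assumes "1 \<le> i" "A \<subseteq> A'" "A' \<subseteq> rec_set (I i)"
  shows "frac i A \<le> frac i A'"
  unfolding frac_def using assms finite_subset[OF assms(3) finite_rec_set[OF finite_I]]
  by (intro divide_right_mono) (auto intro: card_mono)

lemma frac_nonneg: "0 \<le> frac i A"
  unfolding frac_def by simp

lemma frac_rec_set: "1 \<le> i \<Longrightarrow> frac i (rec_set (I i)) = 1"
  unfolding frac_def using card_rec_set_I_pos by simp

lemma odometer_restr:
  "1 \<le> i \<Longrightarrow> odometer (I i) (add_chip (restr (I i) c) v) = odometer (I i) (add_chip c v)"
  by (rule odometer_cong) (auto simp: add_chip_def restr_def v_in_I)

abbreviation "stop i M \<equiv> stopped v (I i) (p i) (I (Suc i)) M"

text \<open>The mass is too large for the piece i - 1, so p (i - 1) fires. The vertex p i stays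
  unfired although it holds at least dg - 2 chips, so at most one chip reaches it.
  \<open>fired_arc\<close> then gives exactly one, and p i must hold exactly dg - 2.\<close>

lemma stopD:
  assumes i: "J0 < i" and M: "card (insert (p (i - 1)) (I (i - 1))) \<le> M" and c: "c \<in> stop i M"
  shows "restr (I i) c \<in> good v (I i) (p i)" and "defic (Suc i) c = {p i}"
    and "\<exists>j\<in>{1..<k i}. j \<noteq> t i \<and> defic i (restr (I i) c) = {X i j} \<and> card (arc (B i) (k i) (t i) j) = M"
proof -
  interpret r: chain_ring W dg "I i" "p i" "k i" "X i" "B i" "I (i - 1)" "p (i - 1)" "t i"
    by (rule rings[OF i])
  interpret s: chain_ring W dg "I (Suc i)" "p (Suc i)" "k (Suc i)" "X (Suc i)" "B (Suc i)" "I i" "p i" "t (Suc i)"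
    using rings[of "Suc i"] i by simp
  have i1: "1 \<le> i" "1 \<le> i - 1" using i J0 by auto
  define c' where "c' = restr (I i) c"
  define o' where "o' = odometer (I i) (add_chip c' v)"
  have o_eq: "odometer (I i) (add_chip c v) = o'"
    unfolding o'_def c'_def by (rule odometer_restr[OF i1(1), symmetric])
  have cR: "c \<in> rec_set (I (Suc i))" and small: "c (p i) + inflow (I i) o' (p i) < dg (p i)"
    and mass: "card {w. o' w \<noteq> 0} = M"
    using c unfolding stopped_def mem_Collect_eq o_eq by auto
  have c'R: "c' \<in> rec_set (I i)" unfolding c'_def using rec_set_restr[OF cR] I_step[OF i1(1)] by auto
  obtain u0 where ex: "stab_vec (I i) (add_chip c' v) u0" using stab_vec_I[OF i1(1)] by blast
  have pI: "insert (p (i - 1)) (I (i - 1)) \<subseteq> I i" using I_step[OF i1(2)] i1 by simp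
  have fired: "o' (p (i - 1)) \<noteq> 0"
  proof
    assume "o' (p (i - 1)) = 0"
    then have o'_eq: "o' = odometer (I (i - 1)) (add_chip c' v)"
      unfolding o'_def
      by (rule odometer_cut_off(2)[OF r.cut_off_I' pI r.finite_I c'R v_in_I[OF i1(2)] ex])
    obtain u1 where "stab_vec (I (i - 1)) (add_chip c' v) u1" using stab_vec_I[OF i1(2)] by blast
    then have "stab_vec (I (i - 1)) (add_chip c' v) o'" unfolding o'_eq by (rule odometer_stab_vec)
    then have "{w. o' w \<noteq> 0} \<subseteq> I (i - 1)" unfolding stab_vec_def by auto
    then have "M \<le> card (I (i - 1))" using mass card_mono[OF r.finite_I'] by blast
    then show False using M r.finite_I' r.q_notin by simp
  qed
  have pX: "p i \<in> s.ring_verts"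
    using s.Xt imageI[OF s.t, of "X (Suc i)"] unfolding s.ring_verts_def by simp
  have cp: "dg (p i) \<le> c (p i) + 2" using s.config_X_ge[OF cR s.t] unfolding s.Xt .
  have out: "inflow (I i) o' (p i) \<le> 1" using cp small by linarith
  obtain j where j: "j \<in> {1..<k i}" "j \<noteq> t i" "defic i c' = {X i j}"
    "{w. o' w \<noteq> 0} = arc (B i) (k i) (t i) j" "inflow (I i) o' (p i) = 1"
    using r.fired_arc[OF v_in_I[OF i1(2)] c'R ex fired[unfolded o'_def] out[unfolded o'_def]]
    unfolding o'_def by metis
  show "restr (I i) c \<in> good v (I i) (p i)"
    unfolding good_def using c'R j(5) unfolding c'_def[symmetric] o'_def by simp
  show "\<exists>j\<in>{1..<k i}. j \<noteq> t i \<and> defic i (restr (I i) c) = {X i j} \<and> card (arc (B i) (k i) (t i) j) = M"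
    using j mass unfolding c'_def[symmetric] by (intro bexI[of _ j]) auto
  have "p i \<in> defic (Suc i) c" using pX small j(5) unfolding deficit_def by auto
  then show "defic (Suc i) c = {p i}"
    using s.card_deficit_le_1[OF cR] s.deficit_subset finite_subset[OF s.deficit_subset]
    by (metis One_nat_def card_le_Suc0_iff_eq finite_subset is_singletonI' is_singleton_the_elem
        s.finite_I s.ring_verts_subset empty_iff singletonD)
qed

text \<open>At most two states of cycle i have the right arc mass, and a single state of the next
  cycle is possible; independence multiplies the proportions.\<close>

lemma stop_frac_le:
  assumes i: "J0 < i" and M: "card (insert (p (i - 1)) (I (i - 1))) \<le> M"
  shows "frac (Suc i) (stop i M) \<le> 2 / (real (k i) * real (k (Suc i)))"
proof -
  interpret r: chain_ring W dg "I i" "p i" "k i" "X i" "B i" "I (i - 1)" "p (i - 1)" "t i"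
    by (rule rings[OF i])
  interpret s: chain_ring W dg "I (Suc i)" "p (Suc i)" "k (Suc i)" "X (Suc i)" "B (Suc i)" "I i" "p i" "t (Suc i)"
    using rings[of "Suc i"] i by simp
  have i1: "1 \<le> i" "1 \<le> i - 1" using i J0 by auto
  define S where "S = {j\<in>{1..<k i}. j \<noteq> t i \<and> card (arc (B i) (k i) (t i) j) = M}"
  define D where "D = (\<lambda>j. {X i j}) ` S"
  have "card D \<le> card S" unfolding D_def S_def by (intro card_image_le) simp
  also have "\<dots> \<le> 2" unfolding S_def by (rule r.card_arc_positions)
  finally have D2: "card D \<le> 2" .
  have D: "D \<subseteq> states i" unfolding D_def S_def r.deficit_states_eq r.ring_verts_def by auto
  define A where "A = {a\<in>rec_set (I i). restr (I (i - 1)) a \<in> rec_set (I (i - 1)) \<and> defic i a \<in> D}"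
  have "frac i A = card D / k i"
    unfolding A_def using frac_ring[OF i order.refl D] frac_rec_set[OF i1(2)] by simp
  also have "\<dots> \<le> 2 / k i" using D2 by (intro divide_right_mono) auto
  finally have A2: "frac i A \<le> 2 / k i" .
  have pD: "{{p i}} \<subseteq> states (Suc i)"
    using s.Xt imageI[OF s.t, of "X (Suc i)"] unfolding s.deficit_states_eq s.ring_verts_def by auto
  have "stop i M \<subseteq> {c\<in>rec_set (I (Suc i)). restr (I (Suc i - 1)) c \<in> A \<and> defic (Suc i) c \<in> {{p i}}}"
  proof
    fix c assume c: "c \<in> stop i M"
    have cR: "c \<in> rec_set (I (Suc i))" using c stopped_subset by blast
    have c'R: "restr (I i) c \<in> rec_set (I i)" using rec_set_restr[OF cR] I_step[OF i1(1)] by auto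
    have "restr (I (i - 1)) (restr (I i) c) \<in> rec_set (I (i - 1))"
      by (rule rec_set_restr[OF c'R r.I'_subset])
    then have "restr (I i) c \<in> A"
      using stopD(3)[OF i M c] c'R unfolding A_def D_def S_def by auto
    then show "c \<in> {c\<in>rec_set (I (Suc i)). restr (I (Suc i - 1)) c \<in> A \<and> defic (Suc i) c \<in> {{p i}}}"
      using cR stopD(2)[OF i M c] by simp
  qed
  then have "frac (Suc i) (stop i M)
      \<le> frac (Suc i) {c\<in>rec_set (I (Suc i)). restr (I (Suc i - 1)) c \<in> A \<and> defic (Suc i) c \<in> {{p i}}}"
    by (intro frac_mono) auto
  also have "\<dots> = frac i A * (1 / k (Suc i))"
    using frac_ring[of "Suc i" A "{{p i}}"] i pD unfolding A_def by simp
  also have "\<dots> \<le> (2 / k i) * (1 / k (Suc i))" using A2 by (intro mult_right_mono) auto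
  finally show ?thesis by simp
qed

abbreviation "good_frac i \<equiv> frac i (good v (I i) (p i))"

lemma good_subset: "good v (I i) (p i) \<subseteq> rec_set (I i)"
  unfolding good_def by auto

text \<open>Given a single chip at p (i - 1), the states \<open>{X i j}\<close> and
  \<open>{p i}\<close> force the avalanche to stop with mass M. A suitable j will come from the
  realizability of M through \<open>stopD\<close>.\<close>

lemma stop_frac_ge:
  assumes i: "J0 < i" and j: "j \<in> {1..<k i}" "j \<noteq> t i" "card (arc (B i) (k i) (t i) j) = M"
  shows "good_frac (i - 1) / (real (k i) * real (k (Suc i))) \<le> frac (Suc i) (stop i M)"
proof -
  interpret r: chain_ring W dg "I i" "p i" "k i" "X i" "B i" "I (i - 1)" "p (i - 1)" "t i"
    by (rule rings[OF i])
  interpret s: chain_ring W dg "I (Suc i)" "p (Suc i)" "k (Suc i)" "X (Suc i)" "B (Suc i)" "I i" "p i" "t (Suc i)"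
    using rings[of "Suc i"] i by simp
  have i1: "1 \<le> i" "1 \<le> i - 1" using i J0 by auto
  define A where "A = {a\<in>rec_set (I i). restr (I (i - 1)) a \<in> good v (I (i - 1)) (p (i - 1))
    \<and> defic i a \<in> {{X i j}}}"
  have D: "{{X i j}} \<subseteq> states i" using j(1) unfolding r.deficit_states_eq r.ring_verts_def by auto
  have A: "frac i A = good_frac (i - 1) * (1 / k i)"
    unfolding A_def using frac_ring[OF i good_subset D] by simp
  have pD: "{{p i}} \<subseteq> states (Suc i)"
    using s.Xt imageI[OF s.t, of "X (Suc i)"] unfolding s.deficit_states_eq s.ring_verts_def by auto
  have "{c\<in>rec_set (I (Suc i)). restr (I (Suc i - 1)) c \<in> A \<and> defic (Suc i) c \<in> {{p i}}} \<subseteq> stop i M"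
  proof
    fix c assume "c \<in> {c\<in>rec_set (I (Suc i)). restr (I (Suc i - 1)) c \<in> A \<and> defic (Suc i) c \<in> {{p i}}}"
    then have c: "c \<in> rec_set (I (Suc i))" "restr (I i) c \<in> A" "defic (Suc i) c = {p i}" by auto
    define c' where "c' = restr (I i) c"
    have c': "c' \<in> rec_set (I i)" "restr (I (i - 1)) c' \<in> good v (I (i - 1)) (p (i - 1))"
      "defic i c' = {X i j}"
      using c(2) unfolding A_def c'_def[symmetric] by auto
    obtain u0 where ex: "stab_vec (I i) (add_chip c' v) u0" using stab_vec_I[OF i1(1)] by blast
    note g = r.good_step[OF v_in_I[OF i1(2)] c'(1,2) j(1,2) c'(3) ex]
    have eq: "odometer (I i) (add_chip c v) = odometer (I i) (add_chip c' v)"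
      unfolding c'_def by (rule odometer_restr[OF i1(1), symmetric])
    have "inflow (I i) (odometer (I i) (add_chip c v)) (p i) = 1"
      using g(1) unfolding good_def eq by simp
    moreover have "p i \<in> s.ring_verts"
      using s.Xt imageI[OF s.t, of "X (Suc i)"] unfolding s.ring_verts_def by simp
    then have "c (p i) = dg (p i) - 2" using s.config_ring_vert[OF c(1)] c(3) by simp
    moreover have "2 \<le> dg (p i)" using s.dg_X_ge_2[OF s.t] unfolding s.Xt .
    ultimately show "c \<in> stop i M"
      unfolding stopped_def using c(1) g(2) j(3) eq by simp
  qed
  then have "frac (Suc i) {c\<in>rec_set (I (Suc i)). restr (I (Suc i - 1)) c \<in> A \<and> defic (Suc i) c \<in> {{p i}}}
      \<le> frac (Suc i) (stop i M)"
    by (intro frac_mono stopped_subset) auto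
  moreover have "frac (Suc i) {c\<in>rec_set (I (Suc i)). restr (I (Suc i - 1)) c \<in> A \<and> defic (Suc i) c \<in> {{p i}}}
      = frac i A * (1 / k (Suc i))"
    using frac_ring[of "Suc i" A "{{p i}}"] i pD unfolding A_def by simp
  ultimately show ?thesis using A by simp
qed

text \<open>Two of the states are given up: no deficient vertex on the cycle, and deficiency of the
  entry vertex p (i - 1). To all others \<open>good_step\<close> applies.\<close>

lemma good_frac_step:
  assumes i: "J0 < i"
  shows "good_frac (i - 1) * (1 - 2 / real (k i)) \<le> good_frac i"
proof -
  interpret r: chain_ring W dg "I i" "p i" "k i" "X i" "B i" "I (i - 1)" "p (i - 1)" "t i"
    by (rule rings[OF i])
  have i1: "1 \<le> i" "1 \<le> i - 1" using i J0 by auto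
  define D where "D = states i - {{}, {p (i - 1)}}"
  have pD: "{{}, {p (i - 1)}} \<subseteq> states i"
    using r.Xt imageI[OF r.t, of "X i"] unfolding r.deficit_states_eq r.ring_verts_def by auto
  have "card D = k i - 2"
    unfolding D_def using card_Diff_subset[OF _ pD] r.card_deficit_states by simp
  then have D: "card D / real (k i) = 1 - 2 / real (k i)"
    using r.k3 by (simp add: of_nat_diff diff_divide_distrib)
  have Dsub: "D \<subseteq> states i" unfolding D_def by blast
  have "{a\<in>rec_set (I i). restr (I (i - 1)) a \<in> good v (I (i - 1)) (p (i - 1)) \<and> defic i a \<in> D}
      \<subseteq> good v (I i) (p i)"
  proof
    fix a assume "a \<in> {a\<in>rec_set (I i). restr (I (i - 1)) a \<in> good v (I (i - 1)) (p (i - 1)) \<and> defic i a \<in> D}"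
    then have a: "a \<in> rec_set (I i)" "restr (I (i - 1)) a \<in> good v (I (i - 1)) (p (i - 1))" "defic i a \<in> D"
      by auto
    then obtain x where x: "x \<in> r.ring_verts" "defic i a = {x}"
      unfolding D_def r.deficit_states_eq by auto
    then obtain j where j: "j \<in> {1..<k i}" "x = X i j" unfolding r.ring_verts_def by auto
    have "j \<noteq> t i" using a(3) x(2) j(2) r.Xt unfolding D_def by auto
    obtain u0 where ex: "stab_vec (I i) (add_chip a v) u0" using stab_vec_I[OF i1(1)] by blast
    show "a \<in> good v (I i) (p i)"
      using r.good_step(1)[OF v_in_I[OF i1(2)] a(1,2) j(1) \<open>j \<noteq> t i\<close> _ ex] x(2) j(2) by simp
  qed
  then have "frac i {a\<in>rec_set (I i). restr (I (i - 1)) a \<in> good v (I (i - 1)) (p (i - 1)) \<and> defic i a \<in> D}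
      \<le> good_frac i"
    by (rule frac_mono[OF i1(1) _ good_subset])
  then show ?thesis
    unfolding frac_ring[OF i good_subset Dsub] D .
qed

text \<open>A product of factors 1 - x is at least 1 minus the sum of the x. The start J is left
  free, because positivity at J becomes available only later.\<close>

lemma good_frac_ge:
  assumes "J0 \<le> J"
  shows "good_frac J * (1 - (\<Sum>l\<in>{J<..J + n}. 2 / real (k l))) \<le> good_frac (J + n)"
proof (induction n)
  case (Suc n)
  let ?S = "\<Sum>l\<in>{J<..J + n}. 2 / real (k l)" and ?x = "2 / real (k (Suc (J + n)))"
  have ring: "3 \<le> k (Suc (J + n))" using ring_graph.k3[OF ring_graph_i] assms by simp
  have x: "0 \<le> ?x" "?x \<le> 1" using ring by auto
  have S: "0 \<le> ?S" by (intro sum_nonneg) auto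
  have ins: "{J<..J + Suc n} = insert (Suc (J + n)) {J<..J + n}" by auto
  have "(\<Sum>l\<in>{J<..J + Suc n}. 2 / real (k l)) = ?S + ?x" unfolding ins by simp
  then have "good_frac J * (1 - (\<Sum>l\<in>{J<..J + Suc n}. 2 / real (k l)))
      \<le> good_frac J * ((1 - ?S) * (1 - ?x))"
    using S x frac_nonneg[of J] by (intro mult_left_mono) (auto simp: algebra_simps)
  also have "\<dots> \<le> good_frac (J + n) * (1 - ?x)"
    using Suc x by (simp add: mult_right_mono mult.assoc[symmetric] del: of_nat_Suc)
  also have "\<dots> \<le> good_frac (Suc (J + n))" using good_frac_step[of "Suc (J + n)"] assms by simp
  finally show ?case by simp
qed simp

end

section \<open>Connectivity after deleting vertices\<close>

lemma adjacent_sym: "adjacent G x y \<Longrightarrow> adjacent G y x"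
  unfolding adjacent_def by (simp add: insert_commute)

lemma adjacent_verts: "wf_multigraph G \<Longrightarrow> adjacent G x y \<Longrightarrow> x \<in> verts G \<and> y \<in> verts G"
  unfolding adjacent_def wf_multigraph_def by fastforce

lemma adjacent_delete_verts:
  assumes "wf_multigraph G"
  shows "adjacent (delete_verts G F) x y \<longleftrightarrow> adjacent G x y \<and> x \<notin> F \<and> y \<notin> F"
proof
  assume "adjacent (delete_verts G F) x y"
  then show "adjacent G x y \<and> x \<notin> F \<and> y \<notin> F"
    unfolding adjacent_def delete_verts_def induced_def by auto
next
  assume r: "adjacent G x y \<and> x \<notin> F \<and> y \<notin> F"
  then obtain e where e: "e \<in> edges G" "ends G e = {x, y}" unfolding adjacent_def by blast
  have "ends G e \<subseteq> verts G - F" using adjacent_verts[OF assms, of x y] r e(2) by auto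
  then show "adjacent (delete_verts G F) x y"
    using e unfolding adjacent_def delete_verts_def induced_def by auto
qed

lemma adjacent_subgraph: "subgraph H G \<Longrightarrow> adjacent H x y \<Longrightarrow> adjacent G x y"
  unfolding adjacent_def subgraph_def by auto

lemma verts_delete_verts: "verts (delete_verts G F) = verts G - F"
  unfolding delete_verts_def induced_def by auto

lemma rtranclp_adjacent_sym: "(adjacent G)\<^sup>*\<^sup>* x y \<Longrightarrow> (adjacent G)\<^sup>*\<^sup>* y x"
  by (metis adjacent_sym symp_def sympD symp_rtranclp)

lemma rtranclp_delete_subgraph:
  assumes "subgraph H G" "wf_multigraph G"
    and "(adjacent (delete_verts H F))\<^sup>*\<^sup>* x y"
  shows "(adjacent (delete_verts G F))\<^sup>*\<^sup>* x y"
proof -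
  have "wf_multigraph H" using assms(1) unfolding subgraph_def by blast
  then show ?thesis
    using assms(3) adjacent_subgraph[OF assms(1)]
    by (elim rtranclp_mono[THEN predicate2D, rotated])
      (auto simp: adjacent_delete_verts assms(2))
qed

text \<open>Allowing F to be empty treats connectedness and the absence of cut vertices at
  once.\<close>

lemma two_connected_delete:
  assumes B: "two_connected B" and F: "F = {} \<or> F = {z}"
    and ab: "a \<in> verts B - F" "b \<in> verts B - F"
  shows "(adjacent (delete_verts B F))\<^sup>*\<^sup>* a b"
proof -
  have wf: "wf_multigraph B" and conn: "graph_connected B" and nc: "\<not> cut_vertex B x" for x
    using B unfolding two_connected_def by auto
  show ?thesis
  proof (cases "F \<inter> verts B = {}")
    case True
    have "adjacent (delete_verts B F) x y \<longleftrightarrow> adjacent B x y" for x y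
      using adjacent_delete_verts[OF wf, of F x y] adjacent_verts[OF wf, of x y] True by auto
    then have "adjacent (delete_verts B F) = adjacent B" by (intro ext) simp
    then show ?thesis using conn ab unfolding graph_connected_def by auto
  next
    case False
    then have "F = {z}" "z \<in> verts B" using F by auto
    then have "graph_connected (delete_verts B F)" using nc[of z] unfolding cut_vertex_def by simp
    then show ?thesis using ab unfolding graph_connected_def verts_delete_verts by blast
  qed
qed

lemma is_blockD:
  assumes "is_block G B"
  shows "subgraph B G" "two_connected B" "wf_multigraph B" "ends B = ends G"
  using assms unfolding is_block_def subgraph_def by auto

lemma block_connected_delete:
  assumes G: "wf_multigraph G" and B: "is_block G B" and ab: "a \<in> verts B" "b \<in> verts B" "a \<noteq> z" "b \<noteq> z"
  shows "(adjacent (delete_verts G {z}))\<^sup>*\<^sup>* a b"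
  using rtranclp_delete_subgraph[OF is_blockD(1)[OF B] G]
    two_connected_delete[OF is_blockD(2)[OF B], of "{z}" z a b] ab by auto

text \<open>A walk of minimal length to S neither repeats a vertex nor meets S early, so it can
  serve as an ear.\<close>

lemma shortest_path:
  assumes "R\<^sup>*\<^sup>* y z" "z \<in> S"
  obtains f m where "f 0 = y" "f m \<in> S" "\<And>i. i < m \<Longrightarrow> R (f i) (f (Suc i))"
    "inj_on f {..m}" "\<And>i. i < m \<Longrightarrow> f i \<notin> S"
proof -
  obtain n where n: "(R ^^ n) y z" using assms(1) by (meson rtranclp_imp_relpowp)
  define m where "m = (LEAST m. \<exists>z\<in>S. (R ^^ m) y z)"
  have "\<exists>z\<in>S. (R ^^ m) y z"
    unfolding m_def by (rule LeastI[of _ n]) (use n assms(2) in blast)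
  then obtain z' where z': "z' \<in> S" "(R ^^ m) y z'" by blast
  have least: "m \<le> l" if "(R ^^ l) y w" "w \<in> S" for l w
    unfolding m_def by (rule Least_le) (use that in blast)
  obtain f where f: "f 0 = y" "f m = z'" "\<And>i. i < m \<Longrightarrow> R (f i) (f (Suc i))"
    using z'(2) unfolding relpowp_fun_conv by blast
  have path: "(R ^^ (j - i)) (f i) (f j)" if "i \<le> j" "j \<le> m" for i j
    unfolding relpowp_fun_conv using that f(3)
    by (intro exI[of _ "\<lambda>l. f (i + l)"]) auto
  have "i = j" if ij: "i < j" "j \<le> m" "f i = f j" for i j
  proof -
    have "(R ^^ i) y (f j)" using path[of 0 i] f(1) ij by simp
    moreover have "(R ^^ (m - j)) (f j) z'" using path[of j m] f(2) ij by simp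
    ultimately have "(R ^^ (i + (m - j))) y z'" unfolding relpowp_add by blast
    then show ?thesis using least[OF _ z'(1)] ij by force
  qed
  then have "inj_on f {..m}" by (metis atMost_iff inj_onI linorder_neqE_nat)
  moreover have "f i \<notin> S" if "i < m" for i
    using least[of i "f i"] path[of 0 i] f(1) that by auto
  ultimately show ?thesis using that f z'(1) by blast
qed

text \<open>Maximality of a block: adding to it an ear, that is a further edge at \<open>x\<close> followed by a path
  back to the block avoiding \<open>x\<close>, would keep it 2-connected.\<close>

lemma block_no_ear:
  assumes G: "wf_multigraph G" and B: "is_block G B" and x: "x \<in> verts B"
    and e: "e \<in> edges G" "ends G e = {x, y}" "y \<noteq> x" "e \<notin> edges B"
    and z: "z \<in> verts B"
  shows "\<not> (adjacent (delete_verts G {x}))\<^sup>*\<^sup>* y z"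
proof
  assume "(adjacent (delete_verts G {x}))\<^sup>*\<^sup>* y z"
  then obtain f m where f: "f 0 = y" "f m \<in> verts B"
    "\<And>i. i < m \<Longrightarrow> adjacent (delete_verts G {x}) (f i) (f (Suc i))"
    "inj_on f {..m}" "\<And>i. i < m \<Longrightarrow> f i \<notin> verts B"
    using shortest_path[OF _ z] by blast
  have adj: "adjacent G (f i) (f (Suc i))" "f i \<noteq> x" "f (Suc i) \<noteq> x" if "i < m" for i
    using f(3)[OF that] unfolding adjacent_delete_verts[OF G] by auto
  have fx: "f i \<noteq> x" if "i \<le> m" for i
    using adj(3)[of "i - 1"] that f(1) e(3) by (cases i) auto
  obtain g where g: "\<And>i. i < m \<Longrightarrow> g i \<in> edges G \<and> ends G (g i) = {f i, f (Suc i)}"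
    using adj(1) unfolding adjacent_def by metis
  note wfB = is_blockD(3)[OF B] and endsB = is_blockD(4)[OF B] and subB = is_blockD(1)[OF B]
  have two: "two_connected B" by (rule is_blockD(2)[OF B])
  define B' where "B' = \<lparr>verts = verts B \<union> f ` {..m}, edges = insert e (edges B \<union> g ` {..<m}), ends = ends G\<rparr>"
  have B'_sel: "verts B' = verts B \<union> f ` {..m}" "edges B' = insert e (edges B \<union> g ` {..<m})" "ends B' = ends G"
    unfolding B'_def by auto
  have Bwf: "ends G d \<subseteq> verts B \<and> card (ends G d) = 2" if "d \<in> edges B" for d
    using wfB two that endsB unfolding wf_multigraph_def two_connected_def by auto
  have fne: "f i \<noteq> f (Suc i)" if "i < m" for i
    using inj_onD[OF f(4), of i "Suc i"] that by auto
  have edge': "ends G d \<subseteq> verts B' \<and> card (ends G d) = 2" if d: "d \<in> edges B'" for d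
  proof -
    consider "d = e" | "d \<in> edges B" | i where "i < m" "d = g i" using d unfolding B'_sel by auto
    then show ?thesis
    proof cases
      case 1
      have "y \<in> f ` {..m}" using f(1) by auto
      then show ?thesis using 1 e x unfolding B'_sel by auto
    next
      case 2
      then show ?thesis using Bwf unfolding B'_sel by blast
    next
      case 3
      then show ?thesis using g fne unfolding B'_sel by auto
    qed
  qed
  have wf': "wf_multigraph B'" using edge' unfolding wf_multigraph_def B'_sel(3) by auto
  have vertsG: "verts B' \<subseteq> verts G"
  proof -
    have "f i \<in> verts G" if "i \<le> m" for i
    proof (cases "i = m")
      case True
      then show ?thesis using f(2) subB unfolding subgraph_def by blast
    next
      case False
      then show ?thesis using adj(1)[of i] adjacent_verts[OF G] that by simp
    qed
    then show ?thesis using subB unfolding B'_sel subgraph_def by auto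
  qed
  have sub': "subgraph B' G"
    using wf' vertsG subB e(1) g unfolding subgraph_def B'_sel by auto
  have subBB': "subgraph B B'"
    using wfB endsB unfolding subgraph_def B'_sel by auto
  have adjB': "adjacent B' a b" if "d \<in> edges B'" "ends G d = {a, b}" for d a b
    using that unfolding adjacent_def B'_sel(3) by blast
  have conn: "(adjacent (delete_verts B' F))\<^sup>*\<^sup>* a b"
    if F: "F = {} \<or> F = {u}" and ab: "a \<in> verts B' - F" "b \<in> verts B' - F" for F u a b
  proof -
    let ?R = "adjacent (delete_verts B' F)"
    have step: "?R (f i) (f (Suc i))" if "i < m" "f i \<notin> F" "f (Suc i) \<notin> F" for i
      using that g[of i] adjB'[of "g i"] unfolding adjacent_delete_verts[OF wf'] B'_sel by auto
    have path: "?R\<^sup>*\<^sup>* (f i) (f j)" if "i \<le> j" "j \<le> m" "\<And>l. i \<le> l \<Longrightarrow> l \<le> j \<Longrightarrow> f l \<notin> F" for i j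
      using that
    proof (induction j)
      case (Suc j)
      show ?case
      proof (cases "i = Suc j")
        case False
        then have "?R\<^sup>*\<^sup>* (f i) (f j)" using Suc by auto
        moreover have "?R (f j) (f (Suc j))" using Suc.prems False by (intro step) auto
        ultimately show ?thesis by simp
      qed simp
    qed simp
    have xy: "?R (f 0) x" if "x \<notin> F" "f 0 \<notin> F"
      using that e f(1) adjB'[of e] unfolding adjacent_delete_verts[OF wf'] B'_sel
      by (auto simp: insert_commute)
    have toB: "\<exists>w\<in>verts B - F. ?R\<^sup>*\<^sup>* a w" if a: "a \<in> verts B' - F" for a
    proof (cases "a \<in> verts B")
      case True
      then show ?thesis using a by blast
    next
      case False
      then obtain i where i: "i \<le> m" "a = f i" using a unfolding B'_sel by auto
      show ?thesis
      proof (cases "\<exists>l. i \<le> l \<and> l \<le> m \<and> f l \<in> F")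
        case False
        then have "?R\<^sup>*\<^sup>* a (f m)" "f m \<notin> F" using path[of i m] i by auto
        then show ?thesis using f(2) by blast
      next
        \<comment> \<open>The deleted vertex lies on the path between a and its far end; then a is
          joined backwards along the path and through e to x.\<close>
        case True
        then obtain l where l: "i \<le> l" "l \<le> m" "f l \<in> F" by blast
        then have Fl: "F = {f l}" using F by auto
        have il: "i \<noteq> l" using a i(2) l(3) by auto
        have "f j \<notin> F" if "j \<le> i" for j
          using inj_onD[OF f(4), of j l] that l il Fl by auto
        then have "?R\<^sup>*\<^sup>* (f 0) a" "f 0 \<notin> F" using path[of 0 i] i by auto
        moreover have "x \<notin> F" using Fl fx[OF l(2)] by auto
        ultimately have "?R\<^sup>*\<^sup>* a x"
          using xy rtranclp_adjacent_sym by (metis rtranclp.rtrancl_into_rtrancl)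
        then show ?thesis using \<open>x \<notin> F\<close> x by blast
      qed
    qed
    obtain a' where a': "a' \<in> verts B - F" "?R\<^sup>*\<^sup>* a a'" using toB[OF ab(1)] by blast
    obtain b' where b': "b' \<in> verts B - F" "?R\<^sup>*\<^sup>* b b'" using toB[OF ab(2)] by blast
    have "?R\<^sup>*\<^sup>* a' b'"
      by (rule rtranclp_delete_subgraph[OF subBB' wf' two_connected_delete[OF two F a'(1) b'(1)]])
    then show ?thesis using a'(2) rtranclp_adjacent_sym[OF b'(2)] by (meson rtranclp_trans)
  qed
  have "graph_connected B'"
  proof -
    have "adjacent (delete_verts B' {}) = adjacent B'"
      by (intro ext) (simp add: adjacent_delete_verts[OF wf'])
    then show ?thesis using conn[of "{}"] unfolding graph_connected_def by simp
  qed
  moreover have "\<not> cut_vertex B' u" for u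
    using conn[of "{u}" u] unfolding cut_vertex_def graph_connected_def verts_delete_verts by blast
  ultimately have "two_connected B'"
    using wf' edge' unfolding two_connected_def B'_sel by auto
  then have "B' = B" using B sub' subBB' unfolding is_block_def by blast
  then show False using e(4) B'_sel(2) by auto
qed

text \<open>The vertex list is rotated to start at p; indices are taken modulo the length, so the
  closing value at k is p again.\<close>

lemma cycle_parametrization:
  assumes "is_cycle B" "p \<in> verts B"
  obtains X E where "X 0 = p" "X (card (verts B)) = p" "inj_on X {..<card (verts B)}"
    "verts B = X ` {..<card (verts B)}" "inj_on E {..<card (verts B)}" "edges B = E ` {..<card (verts B)}"
    "\<And>b. b < card (verts B) \<Longrightarrow> ends B (E b) = {X b, X (Suc b)}"
proof -
  obtain vs es where vs: "vs \<noteq> []" "length es = length vs" "distinct vs" "distinct es"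
    "verts B = set vs" "edges B = set es"
    "\<forall>i<length vs. ends B (es ! i) = {vs ! i, vs ! (Suc i mod length vs)}"
    using assms(1) unfolding is_cycle_def by blast
  define k where "k = length vs"
  have card: "card (verts B) = k" unfolding k_def vs(5) by (rule distinct_card[OF vs(3)])
  have k0: "k > 0" using vs(1) unfolding k_def by simp
  obtain r where r: "r < k" "vs ! r = p" using assms(2) unfolding vs(5) k_def by (meson in_set_conv_nth)
  define X where "X a = vs ! ((r + a) mod k)" for a
  define E where "E a = es ! ((r + a) mod k)" for a
  have inj: "inj_on (\<lambda>a. (r + a) mod k) {..<k}"
  proof (rule linorder_inj_onI)
    fix a b assume ab: "a < b" "a \<in> {..<k}" "b \<in> {..<k}"
    show "(r + a) mod k \<noteq> (r + b) mod k"
    proof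
      assume "(r + a) mod k = (r + b) mod k"
      then have "k dvd (r + b) - (r + a)" using ab mod_eq_dvd_iff_nat[of "r + a" "r + b" k] by simp
      then show False using ab dvd_imp_le[of k "b - a"] by auto
    qed
  qed auto
  have img: "(\<lambda>a. (r + a) mod k) ` {..<k} = {..<k}"
    by (rule endo_inj_surj[OF _ _ inj]) (use k0 in auto)
  have nth: "inj_on (\<lambda>i. vs ! i) {..<k}" "inj_on (\<lambda>i. es ! i) {..<k}"
    unfolding k_def using vs(2,3,4) by (auto simp: inj_on_def nth_eq_iff_index_eq)
  have set: "set vs = (\<lambda>i. vs ! i) ` {..<k}" "set es = (\<lambda>i. es ! i) ` {..<k}"
    unfolding k_def using vs(2) by (auto simp: in_set_conv_nth image_iff)
  show ?thesis
  proof (rule that[of X E])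
    show "X 0 = p" unfolding X_def using r by simp
    show "X (card (verts B)) = p" unfolding X_def card using r by simp
    show "inj_on X {..<card (verts B)}" "inj_on E {..<card (verts B)}"
      unfolding X_def E_def card using comp_inj_on[OF inj, of "\<lambda>i. vs ! i"] comp_inj_on[OF inj, of "\<lambda>i. es ! i"]
        nth img by (simp_all add: comp_def)
    have "X ` {..<k} = (\<lambda>i. vs ! i) ` (\<lambda>a. (r + a) mod k) ` {..<k}"
      "E ` {..<k} = (\<lambda>i. es ! i) ` (\<lambda>a. (r + a) mod k) ` {..<k}"
      unfolding X_def E_def image_image by simp_all
    then have "verts B = X ` {..<k}" "edges B = E ` {..<k}" unfolding vs(5,6) set img by simp_all
    then show "verts B = X ` {..<card (verts B)}" "edges B = E ` {..<card (verts B)}"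
      unfolding card by simp_all
    fix b
    have "Suc ((r + b) mod k) mod k = (r + Suc b) mod k" by (simp add: mod_Suc_eq)
    moreover have "(r + b) mod k < length vs" using k0 unfolding k_def by simp
    ultimately show "ends B (E b) = {X b, X (Suc b)}"
      using vs(7) unfolding X_def E_def k_def[symmetric] by simp
  qed
qed

section \<open>Decorations along the block-path\<close>

locale cactus_path =
  fixes G :: "('v, 'e) multigraph" and v :: 'v and C :: "nat \<Rightarrow> ('v, 'e) multigraph" and p :: "nat \<Rightarrow> 'v"
  assumes cactus: "cactus G" and one_ended: "one_ended G" and path: "infinite_block_path G v C p"
begin

lemma
  shows wf: "wf_multigraph G" and lf: "locally_finite G" and conn: "graph_connected G"
  using cactus unfolding cactus_def by auto

abbreviation reach :: "'v \<Rightarrow> 'v \<Rightarrow> 'v \<Rightarrow> bool" where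
  "reach x \<equiv> (adjacent (delete_verts G {x}))\<^sup>*\<^sup>*"

abbreviation D :: "'v \<Rightarrow> 'v set" where "D x \<equiv> verts (decoration G x)"

lemma adj_del: "adjacent (delete_verts G {x}) a b \<longleftrightarrow> adjacent G a b \<and> a \<noteq> x \<and> b \<noteq> x"
  using adjacent_delete_verts[OF wf] by auto

lemma reach_verts: "reach x a b \<Longrightarrow> a \<in> verts G - {x} \<Longrightarrow> b \<in> verts G - {x}"
  by (induction rule: rtranclp_induct) (use adj_del adjacent_verts[OF wf] in auto)

lemma reach_comp: "reach x a b \<Longrightarrow> {y. reach x a y} = {y. reach x b y}"
  using rtranclp_adjacent_sym by (metis (no_types, lifting) rtranclp_trans)

lemma comp_iff:
  "S \<in> graph_components (delete_verts G {x}) \<longleftrightarrow> (\<exists>a\<in>verts G - {x}. S = {y. reach x a y})"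
  unfolding graph_components_def verts_delete_verts by auto

lemma D_iff:
  assumes "x \<in> verts G"
  shows "w \<in> D x \<longleftrightarrow> w = x \<or> (w \<in> verts G - {x} \<and> finite {y. reach x w y})"
proof -
  have "D x = verts G \<inter> insert x (\<Union>{S \<in> graph_components (delete_verts G {x}). finite S})"
    unfolding decoration_def induced_def by simp
  moreover have "w \<in> \<Union>{S \<in> graph_components (delete_verts G {x}). finite S} \<longleftrightarrow>
      w \<in> verts G - {x} \<and> finite {y. reach x w y}"
  proof
    assume "w \<in> \<Union>{S \<in> graph_components (delete_verts G {x}). finite S}"
    then obtain a where a: "a \<in> verts G - {x}" "reach x a w" "finite {y. reach x a y}"
      unfolding comp_iff by auto
    then show "w \<in> verts G - {x} \<and> finite {y. reach x w y}"
      using reach_verts[OF a(2,1)] reach_comp[OF a(2)] by simp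
  next
    assume "w \<in> verts G - {x} \<and> finite {y. reach x w y}"
    then show "w \<in> \<Union>{S \<in> graph_components (delete_verts G {x}). finite S}"
      by (intro UnionI[of "{y. reach x w y}"]) (auto simp: comp_iff)
  qed
  ultimately show ?thesis using assms by blast
qed

lemma D_self: "x \<in> verts G \<Longrightarrow> x \<in> D x" using D_iff by blast

lemma D_verts: "x \<in> verts G \<Longrightarrow> D x \<subseteq> verts G" by (auto simp: D_iff)

lemma D_reach:
  assumes "x \<in> verts G" "reach x a b" "a \<in> verts G" "a \<noteq> x"
  shows "a \<in> D x \<longleftrightarrow> b \<in> D x"
  using assms reach_verts[OF assms(2)] reach_comp[OF assms(2)] unfolding D_iff[OF assms(1)] by auto

lemma D_closed:
  assumes x: "x \<in> verts G" and w: "w \<in> D x" "w \<noteq> x" "adjacent G w u"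
  shows "u \<in> D x"
proof (cases "u = x")
  case False
  then have "reach x w u" using w adj_del by blast
  then show ?thesis using D_reach[OF x _ _ w(2)] w D_verts[OF x] by blast
qed (use D_self[OF x] in simp)

text \<open>One-endedness: both vertices lie in the unique infinite component left after deleting
  x.\<close>

lemma outside_D_reach:
  assumes x: "x \<in> verts G" and ab: "a \<in> verts G - D x" "b \<in> verts G - D x"
  shows "reach x a b"
proof -
  have ne: "a \<noteq> x" "b \<noteq> x" using ab D_self[OF x] by auto
  have inf: "infinite {y. reach x a y}" "infinite {y. reach x b y}"
    using ab ne D_iff[OF x, of a] D_iff[OF x, of b] by auto
  have "{y. reach x a y} \<in> graph_components (delete_verts G {x})"
    "{y. reach x b y} \<in> graph_components (delete_verts G {x})"
    using ab ne unfolding comp_iff by auto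
  moreover have "\<exists>!S. S \<in> graph_components (delete_verts G {x}) \<and> infinite S"
    using one_ended x unfolding one_ended_def by (metis empty_subsetI finite.emptyI finite_insert insert_subset)
  ultimately have "{y. reach x a y} = {y. reach x b y}" using inf by blast
  then show ?thesis by blast
qed

text \<open>A walk from w to x can leave \<open>D x\<close> only through x, so it stays inside until
  x is reached.\<close>

lemma D_connected:
  assumes x: "x \<in> verts G" and w: "w \<in> D x"
  shows "(\<lambda>a b. adjacent G a b \<and> a \<in> D x \<and> b \<in> D x)\<^sup>*\<^sup>* w x"
proof -
  have "(adjacent G)\<^sup>*\<^sup>* w x"
    using conn x w D_verts[OF x] unfolding graph_connected_def by blast
  then show ?thesis using w
  proof (induction rule: converse_rtranclp_induct)
    case (step a b)
    show ?case
    proof (cases "a = x")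
      case False
      then have "b \<in> D x" using D_closed[OF x step.prems _ step.hyps(1)] by blast
      then show ?thesis
        using step converse_rtranclp_into_rtranclp[of "\<lambda>a b. adjacent G a b \<and> a \<in> D x \<and> b \<in> D x" a b] by blast
    qed simp
  qed simp
qed

lemma finite_incident: "finite {e \<in> edges G. x \<in> ends G e}"
proof (cases "x \<in> verts G")
  case True
  then show ?thesis using lf unfolding locally_finite_def by blast
next
  case False
  then have "{e \<in> edges G. x \<in> ends G e} = {}" using wf unfolding wf_multigraph_def by auto
  then show ?thesis by (simp only: finite.emptyI)
qed

lemma finite_neighbours: "finite {y. adjacent G x y}"
proof (rule finite_subset)
  show "{y. adjacent G x y} \<subseteq> (\<Union>e\<in>{e \<in> edges G. x \<in> ends G e}. ends G e)"
    unfolding adjacent_def by auto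
  have "finite (ends G e)" if "e \<in> edges G" for e
    using wf that unfolding wf_multigraph_def by (metis card_eq_0_iff zero_neq_one zero_neq_numeral)
  then show "finite (\<Union>e\<in>{e \<in> edges G. x \<in> ends G e}. ends G e)" using finite_incident by auto
qed

text \<open>Every component left after deleting x contains a neighbour of x by connectedness, and
  local finiteness leaves only finitely many of them.\<close>

lemma finite_D:
  assumes x: "x \<in> verts G"
  shows "finite (D x)"
proof (rule finite_subset)
  let ?N = "{y \<in> {y. adjacent G x y}. finite {z. reach x y z}}"
  show "D x \<subseteq> insert x (\<Union>y\<in>?N. {z. reach x y z})"
  proof
    fix w assume w: "w \<in> D x"
    have "(adjacent G)\<^sup>*\<^sup>* w x"
      using conn x w D_verts[OF x] unfolding graph_connected_def by blast
    then have "w = x \<or> (\<exists>y. adjacent G y x \<and> reach x w y)"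
    proof (induction rule: converse_rtranclp_induct)
      case (step a b)
      show ?case
      proof (cases "a = x \<or> b = x")
        case True
        then show ?thesis using step.hyps(1) by blast
      next
        case False
        then have "reach x a b" using step.hyps(1) adj_del by blast
        then show ?thesis using step.IH False by (meson rtranclp_trans)
      qed
    qed simp
    then consider "w = x" | y where "w \<noteq> x" "adjacent G y x" "reach x w y" by blast
    then show "w \<in> insert x (\<Union>y\<in>?N. {z. reach x y z})"
    proof cases
      case 2
      have "finite {z. reach x w z}" using w 2(1) unfolding D_iff[OF x] by blast
      then have "y \<in> ?N" using reach_comp[OF 2(3)] adjacent_sym[OF 2(2)] by auto
      then show ?thesis using rtranclp_adjacent_sym[OF 2(3)] by blast
    qed simp
  qed
  show "finite (insert x (\<Union>y\<in>?N. {z. reach x y z}))" using finite_neighbours[of x] by auto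
qed

lemma not_in_D_infinite:
  assumes x: "x \<in> verts G" and Z: "infinite Z" "\<And>z. z \<in> Z \<Longrightarrow> reach x a z" and a: "a \<noteq> x"
  shows "a \<notin> D x"
proof
  assume "a \<in> D x"
  then have "finite {y. reach x a y}" using a unfolding D_iff[OF x] by blast
  moreover have "Z \<subseteq> {y. reach x a y}" using Z(2) by blast
  ultimately show False using Z(1) finite_subset by blast
qed

section \<open>The blocks of the path relative to the decorations\<close>

lemma
  shows block: "1 \<le> i \<Longrightarrow> is_block G (C i)"
    and C_inter: "1 \<le> i \<Longrightarrow> verts (C i) \<inter> verts (C (Suc i)) = {p i}"
    and joining: "1 \<le> i \<Longrightarrow> joining_block_path G v (p i) (map C [1..<i + 1])"
    and C_inj: "inj_on C {1..}" and v_C1: "v \<in> verts (C 1)" "v \<notin> verts (C 2)"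
  using path unfolding infinite_block_path_def by auto

lemma p_in_C: "1 \<le> i \<Longrightarrow> p i \<in> verts (C i)" "1 \<le> i \<Longrightarrow> p i \<in> verts (C (Suc i))"
  using C_inter by blast+

lemma C_verts: "1 \<le> i \<Longrightarrow> verts (C i) \<subseteq> verts G"
  using is_blockD(1)[OF block] unfolding subgraph_def by blast

lemma p_verts: "1 \<le> i \<Longrightarrow> p i \<in> verts G"
  using p_in_C C_verts by blast

lemma minimal:
  assumes "1 \<le> i" "block_path_between G v (p i) Bs"
  shows "i \<le> length Bs"
proof -
  have "length (map C [1..<i + 1]) \<le> length Bs"
    using joining[OF assms(1)] assms(2) unfolding joining_block_path_def by blast
  then show ?thesis by (simp del: upt_Suc)
qed

lemma hd_last_C:
  assumes "1 \<le> l"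
  shows "hd (map C [1..<l + 1]) = C 1" "last (map C [1..<l + 1]) = C l"
  using assms by (simp_all add: hd_map last_map del: upt_Suc)

lemma initial_block_path: "1 \<le> l \<Longrightarrow> block_path G (map C [1..<l + 1])"
  using joining unfolding joining_block_path_def block_path_between_def by blast

text \<open>The first l blocks would already join v to p i, against minimality.\<close>

lemma p_notin_C:
  assumes "1 \<le> l" "l < i"
  shows "p i \<notin> verts (C l)"
proof
  assume "p i \<in> verts (C l)"
  then have "block_path_between G v (p i) (map C [1..<l + 1])"
    using initial_block_path[OF assms(1)] v_C1(1) hd_last_C[OF assms(1)]
    unfolding block_path_between_def by simp
  then have "i \<le> length (map C [1..<l + 1])" using assms by (intro minimal) auto
  then show False using assms by (simp del: upt_Suc)
qed

text \<open>Jumping from C l directly to C m would shorten the path to p m: l + 1 blocks instead of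
  m.\<close>

lemma C_disjoint:
  assumes "1 \<le> l" "l + 2 \<le> m"
  shows "verts (C l) \<inter> verts (C m) = {}"
proof (rule ccontr)
  assume ne: "verts (C l) \<inter> verts (C m) \<noteq> {}"
  let ?Bs = "map C [1..<l + 1] @ [C m]"
  have "C m \<noteq> C i" if "1 \<le> i" "i \<le> l" for i using inj_onD[OF C_inj, of m i] that assms by auto
  then have "C m \<notin> set (map C [1..<l + 1])" by (auto simp: image_iff) force
  moreover have "map C [1..<l + 1] \<noteq> []" using assms by simp
  ultimately have "block_path G ?Bs"
    using initial_block_path[OF assms(1)] ne block[of m] assms hd_last_C(2)[OF assms(1)]
    unfolding block_path_def successively_append_iff by (simp del: upt_Suc)
  moreover have "hd ?Bs = C 1"
    using hd_last_C(1)[OF assms(1)] assms by (simp add: hd_append del: upt_Suc)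
  ultimately have "block_path_between G v (p m) ?Bs"
    using v_C1(1) p_in_C(1)[of m] assms unfolding block_path_between_def by simp
  then have "m \<le> length ?Bs" using assms by (intro minimal) auto
  then show False using assms by (simp del: upt_Suc)
qed

lemma p_neq: "1 \<le> i \<Longrightarrow> i < j \<Longrightarrow> p i \<noteq> p j"
  using p_notin_C p_in_C(1) by metis

lemma tail_reach:
  assumes i: "1 \<le> i" and x: "\<And>l. i \<le> l \<Longrightarrow> x \<notin> verts (C l)"
    and y: "i \<le> l" "y \<in> verts (C l)"
  shows "reach x (p i) y"
  using y
proof (induction l arbitrary: y rule: dec_induct)
  case base
  show ?case
    by (rule block_connected_delete[OF wf block[OF i]]) (use p_in_C[OF i] base x[of i] in auto)
next
  case (step l)
  have l1: "1 \<le> l" using step.hyps i by linarith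
  have "reach x (p i) (p l)" by (rule step.IH[OF p_in_C(1)[OF l1]])
  moreover have "reach x (p l) y"
    by (rule block_connected_delete[OF wf block[of "Suc l"]])
      (use p_in_C(2)[OF l1] step x[of "Suc l"] in auto)
  ultimately show ?case by (meson rtranclp_trans)
qed

text \<open>The component of p i contains all later p l, which are infinitely many.\<close>

lemma p_notin_D:
  assumes i: "1 \<le> i" and x: "x \<in> verts G" "\<And>l. i \<le> l \<Longrightarrow> x \<notin> verts (C l)"
  shows "p i \<notin> D x"
proof (rule not_in_D_infinite[OF x(1), of "p ` {i..}"])
  have "inj_on p {i..}" by (rule linorder_inj_onI) (use p_neq i in auto)
  then show "infinite (p ` {i..})" using finite_image_iff infinite_Ici by blast
  show "reach x (p i) z" if z: "z \<in> p ` {i..}" for z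
  proof -
    obtain l where "z = p l" "i \<le> l" using z by auto
    then show ?thesis using tail_reach[OF i x(2), of l z] p_in_C(1)[of l] i by auto
  qed
  show "p i \<noteq> x" using x(2)[OF order.refl] p_in_C(1)[OF i] by blast
qed

lemma not_in_later:
  assumes i: "1 \<le> i" and x: "x \<in> verts (C i)" "x \<noteq> p i" and l: "i < l"
  shows "x \<notin> verts (C l)"
proof (cases "l = Suc i")
  case True
  then show ?thesis using C_inter[OF i] x by blast
next
  case False
  then show ?thesis using C_disjoint[OF i, of l] x l by auto
qed

lemma p_notin_D_cycle:
  assumes i: "1 \<le> i" and x: "x \<in> verts (C i)" "x \<noteq> p i"
  shows "p i \<notin> D x"
proof -
  have xG: "x \<in> verts G" using C_verts[OF i] x by blast
  \<comment> \<open>Applied one block further on: x lies in C i, but in no later block.\<close>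
  have "p (Suc i) \<notin> D x"
    by (rule p_notin_D[OF _ xG]) (use not_in_later[OF i x] in auto)
  moreover have "reach x (p i) (p (Suc i))"
    by (rule block_connected_delete[OF wf block[of "Suc i"]])
      (use i p_in_C[OF i] p_in_C(1)[of "Suc i"] not_in_later[OF i x, of "Suc i"] in auto)
  ultimately show ?thesis using D_reach[OF xG _ p_verts[OF i]] x(2) by blast
qed

lemma C_notin_D:
  assumes i: "1 \<le> i" and x: "x \<in> verts (C i)" "x \<noteq> p i" and y: "y \<in> verts (C i)" "y \<noteq> x"
  shows "y \<notin> D x"
proof -
  have xG: "x \<in> verts G" using C_verts[OF i] x by blast
  have "reach x y (p i)"
    by (rule block_connected_delete[OF wf block[OF i] y(1) p_in_C(1)[OF i] y(2)]) (use x(2) in simp)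
  then show ?thesis using D_reach[OF xG] C_verts[OF i] y p_notin_D_cycle[OF i x] by blast
qed

lemma block_edge_out:
  assumes B: "is_block G B" and x: "x \<in> verts B" and z: "z \<in> verts B" "z \<noteq> x"
  obtains e y where "e \<in> edges B" "ends G e = {x, y}" "y \<noteq> x" "y \<in> verts B"
proof -
  note two = is_blockD(2)[OF B]
  have "(adjacent B)\<^sup>*\<^sup>* x z" using two x z unfolding two_connected_def graph_connected_def by blast
  then obtain y where y: "adjacent B x y" using z(2) by (metis converse_rtranclpE)
  then obtain e where e: "e \<in> edges B" "ends B e = {x, y}" unfolding adjacent_def by blast
  have "card (ends B e) = 2" using two e unfolding two_connected_def by blast
  then have "y \<noteq> x" using e by auto
  moreover have "y \<in> verts B" using adjacent_verts[OF is_blockD(3)[OF B] y] by blast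
  ultimately show ?thesis using that e is_blockD(4)[OF B] by auto
qed

lemma p_Suc_notin_D:
  assumes i: "1 \<le> i"
  shows "p (Suc i) \<notin> D (p i)"
proof -
  have out: "p i \<notin> verts (C l)" if "Suc (Suc i) \<le> l" for l
    using C_disjoint[OF i, of l] p_in_C(1)[OF i] that by auto
  have "p (Suc (Suc i)) \<notin> D (p i)" by (rule p_notin_D[OF _ p_verts[OF i] out]) auto
  moreover have "reach (p i) (p (Suc i)) (p (Suc (Suc i)))"
    by (rule block_connected_delete[OF wf block[of "Suc (Suc i)"]])
      (use p_in_C(2)[of "Suc i"] p_in_C(1)[of "Suc (Suc i)"] out[of "Suc (Suc i)"] in auto)
  ultimately show ?thesis
    using D_reach[OF p_verts[OF i], of "p (Suc i)" "p (Suc (Suc i))"] p_verts[of "Suc i"]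
      p_neq[OF i, of "Suc i"] by auto
qed

text \<open>Otherwise some edge of C i at p i leads into the infinite component, which also contains
  p (i + 1). That would be an ear of the block C (i + 1) starting at p i, excluded by
  maximality.\<close>

lemma C_subset_D:
  assumes i: "1 \<le> i"
  shows "verts (C i) \<subseteq> D (p i)"
proof
  fix y assume y: "y \<in> verts (C i)"
  show "y \<in> D (p i)"
  proof (rule ccontr)
    assume nD: "y \<notin> D (p i)"
    then have yp: "y \<noteq> p i" using D_self[OF p_verts[OF i]] by auto
    obtain e z where e: "e \<in> edges (C i)" "ends G e = {p i, z}" "z \<noteq> p i" "z \<in> verts (C i)"
      using block_edge_out[OF block[OF i] p_in_C(1)[OF i] y yp] .
    have "reach (p i) z y" by (rule block_connected_delete[OF wf block[OF i] e(4) y e(3) yp])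
    then have "z \<notin> D (p i)" using D_reach[OF p_verts[OF i]] nD e C_verts[OF i] by blast
    then have "reach (p i) z (p (Suc i))"
      using outside_D_reach[OF p_verts[OF i]] e(4) C_verts[OF i] p_Suc_notin_D[OF i] p_verts[of "Suc i"]
      by auto
    moreover have "e \<notin> edges (C (Suc i))"
    proof
      assume "e \<in> edges (C (Suc i))"
      then have "z \<in> verts (C (Suc i))"
        using is_blockD(3,4)[OF block[of "Suc i"]] e(2) unfolding wf_multigraph_def by auto
      then show False using C_inter[OF i] e(3,4) by blast
    qed
    moreover have "e \<in> edges G" using e(1) is_blockD(1)[OF block[OF i]] unfolding subgraph_def by blast
    ultimately show False
      using block_no_ear[OF wf block[of "Suc i"] p_in_C(2)[OF i] _ e(2,3) _ p_in_C(1)[of "Suc i"]] by auto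
  qed
qed

text \<open>\<open>D x\<close> is connected and misses p i, so it stays on the side of x, and x
  belongs to C i, which lies on the finite side of p i.\<close>

lemma D_subset_D:
  assumes i: "1 \<le> i" and x: "x \<in> verts (C i)" "x \<noteq> p i"
  shows "D x \<subseteq> D (p i)"
proof
  fix w assume w: "w \<in> D x"
  have xG: "x \<in> verts G" using C_verts[OF i] x by blast
  have np: "p i \<notin> D x" by (rule p_notin_D_cycle[OF i x])
  have "reach (p i) w x"
    using D_connected[OF xG w]
  proof (elim rtranclp_mono[THEN predicate2D, rotated], intro le_funI le_boolI)
    fix a b assume "adjacent G a b \<and> a \<in> D x \<and> b \<in> D x"
    then show "adjacent (delete_verts G {p i}) a b" using np unfolding adj_del by metis
  qed
  moreover have "w \<noteq> p i" "w \<in> verts G" using np w D_verts[OF xG] by auto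
  ultimately show "w \<in> D (p i)" using D_reach[OF p_verts[OF i]] C_subset_D[OF i] x(1) by blast
qed

lemma p_D_step:
  assumes i: "1 \<le> i"
  shows "D (p i) \<subseteq> D (p (Suc i))" "p (Suc i) \<notin> D (p i)"
  using D_subset_D[of "Suc i" "p i"] p_in_C(2)[OF i] p_neq[OF i, of "Suc i"] p_Suc_notin_D[OF i] by auto

lemma p_D_mono:
  assumes "1 \<le> i" "i \<le> j"
  shows "D (p i) \<subseteq> D (p j)"
  using assms(2)
proof (induction j rule: dec_induct)
  case (step j)
  then show ?case using p_D_step(1)[of j] assms(1) by auto
qed simp

lemma p_notin_earlier_D: "1 \<le> i \<Longrightarrow> i < j \<Longrightarrow> p j \<notin> D (p i)"
  using p_D_step(2)[of "j - 1"] p_D_mono[of i "j - 1"] by (cases j) auto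

lemma v_in_D:
  assumes i: "1 \<le> i"
  shows "v \<in> D (p i)" "v \<noteq> p i"
proof -
  have 1: "v \<in> D (p 1)" using C_subset_D[of 1] v_C1 by auto
  then show "v \<in> D (p i)" using p_D_mono[OF _ i] by auto
  show "v \<noteq> p i"
  proof (cases "i = 1")
    case True
    then show ?thesis using p_in_C(2)[of 1] v_C1(2) by (auto simp: numeral_2_eq_2)
  next
    case False
    then show ?thesis using p_notin_earlier_D[of 1 i] 1 i by auto
  qed
qed

text \<open>A walk inside \<open>D y\<close> from a common vertex to y never meets x, so it cannot
  leave \<open>D x\<close>; but y is not in \<open>D x\<close>.\<close>

lemma D_disjoint:
  assumes i: "1 \<le> i" and x: "x \<in> verts (C i)" "x \<noteq> p i" and y: "y \<in> verts (C i)" "y \<noteq> p i"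
    and xy: "x \<noteq> y"
  shows "D x \<inter> D y = {}"
proof (rule ccontr)
  assume "D x \<inter> D y \<noteq> {}"
  then obtain w where w: "w \<in> D x" "w \<in> D y" by blast
  have xG: "x \<in> verts G" "y \<in> verts G" using C_verts[OF i] x y by auto
  have nx: "x \<notin> D y" by (rule C_notin_D[OF i y x(1) xy])
  have ny: "y \<notin> D x" by (rule C_notin_D[OF i x y(1) xy[symmetric]])
  have "y \<in> D x"
    using D_connected[OF xG(2) w(2)] w(1)
  proof (induction rule: rtranclp_induct)
    case (step a b)
    then show ?case using D_closed[OF xG(1), of a b] nx by blast
  qed
  then show False using ny by simp
qed

text \<open>Outside C i such an edge would continue through the infinite component back to p i,
  which makes it an ear of C i.\<close>

lemma edge_leaving_D:
  assumes i: "1 \<le> i" and x: "x \<in> verts (C i)" "x \<noteq> p i"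
    and e: "e \<in> edges G" "ends G e = {x, y}" "y \<notin> D x"
  shows "e \<in> edges (C i)"
proof (rule ccontr)
  assume ne: "e \<notin> edges (C i)"
  have xG: "x \<in> verts G" using C_verts[OF i] x by blast
  have yx: "y \<noteq> x" using e(3) D_self[OF xG] by auto
  have "y \<in> verts G" using wf e unfolding wf_multigraph_def by auto
  then have "reach x y (p i)"
    using outside_D_reach[OF xG] e(3) p_verts[OF i] p_notin_D_cycle[OF i x] by blast
  then show False using block_no_ear[OF wf block[OF i] x(1) e(1,2) yx ne p_in_C(1)[OF i]] by blast
qed

text \<open>Supplies the edge condition of \<open>ring\<close>: by \<open>edge_leaving_D\<close> all
  edges from X a out of its branch are cycle edges, and with more than two vertices these lead to
  two different neighbours.\<close>

lemma cycle_branches: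
  assumes i: "1 \<le> i" and k: "2 < card (verts (C i))"
  obtains X where "X 0 = p i" "X (card (verts (C i))) = p i" "inj_on X {..<card (verts (C i))}"
    "verts (C i) = X ` {..<card (verts (C i))}"
    "\<And>a u. a \<in> {1..<card (verts (C i))} \<Longrightarrow> u \<notin> D (X a) \<Longrightarrow>
      chips G (X a) u = (if u = X (a - 1) \<or> u = X (Suc a) then 1 else 0)"
proof -
  let ?k = "card (verts (C i))"
  have "\<not> is_single_edge (C i)"
  proof
    assume "is_single_edge (C i)"
    then obtain x y where "x \<noteq> y" "verts (C i) = {x, y}" unfolding is_single_edge_def by blast
    then show False using k by simp
  qed
  then have "is_cycle (C i)" using cactus block[OF i] unfolding cactus_def by blast
  then obtain X E where X: "X 0 = p i" "X ?k = p i" "inj_on X {..<?k}"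
    "verts (C i) = X ` {..<?k}" "inj_on E {..<?k}" "edges (C i) = E ` {..<?k}"
    "\<And>b. b < ?k \<Longrightarrow> ends (C i) (E b) = {X b, X (Suc b)}"
    using cycle_parametrization[OF _ p_in_C(1)[OF i]] by blast
  have ends: "ends G (E b) = {X b, X (Suc b)}" if "b < ?k" for b
    using X(7)[OF that] is_blockD(4)[OF block[OF i]] by simp
  \<comment> \<open>X repeats a value only at the two ends 0 and k, both equal to p i.\<close>
  have Xeq: "X a = X b \<longleftrightarrow> a = b \<or> (a = 0 \<and> b = ?k) \<or> (a = ?k \<and> b = 0)" if "a \<le> ?k" "b \<le> ?k" for a b
  proof -
    consider "a < ?k" "b < ?k" | "a < ?k" "b = ?k" | "a = ?k" "b < ?k" | "a = ?k" "b = ?k"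
      using \<open>a \<le> ?k\<close> \<open>b \<le> ?k\<close> by linarith
    then show ?thesis
    proof cases
      case 1
      then show ?thesis using inj_on_eq_iff[OF X(3)] by auto
    next
      case 2
      then show ?thesis using inj_on_eq_iff[OF X(3), of a 0] X(1,2) k by auto
    next
      case 3
      then show ?thesis using inj_on_eq_iff[OF X(3), of 0 b] X(1,2) k by auto
    qed auto
  qed
  have "chips G (X a) u = (if u = X (a - 1) \<or> u = X (Suc a) then 1 else 0)"
    if a: "a \<in> {1..<?k}" and u: "u \<notin> D (X a)" for a u
  proof -
    have Xa: "X a \<in> verts (C i)" "X a \<noteq> p i"
      using a X(4) Xeq[of a 0] X(1) by auto
    have uX: "u \<noteq> X a" using u D_self C_verts[OF i] Xa(1) by blast
    have Eb: "E b \<in> edges G" if "b < ?k" for b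
      using that X(6) is_blockD(1)[OF block[OF i]] unfolding subgraph_def by auto
    have set: "{e \<in> edges G. ends G e = {X a, u}} = E ` {b. b < ?k \<and> {X b, X (Suc b)} = {X a, u}}"
    proof (intro set_eqI iffI)
      fix e assume "e \<in> {e \<in> edges G. ends G e = {X a, u}}"
      then have e: "e \<in> edges G" "ends G e = {X a, u}" by auto
      then have "e \<in> edges (C i)" using edge_leaving_D[OF i Xa _ _ u] by blast
      then obtain b where "b < ?k" "e = E b" using X(6) by auto
      then show "e \<in> E ` {b. b < ?k \<and> {X b, X (Suc b)} = {X a, u}}" using e(2) ends by auto
    next
      fix e assume "e \<in> E ` {b. b < ?k \<and> {X b, X (Suc b)} = {X a, u}}"
      then show "e \<in> {e \<in> edges G. ends G e = {X a, u}}" using Eb ends by auto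
    qed
    have b_iff: "b < ?k \<and> {X b, X (Suc b)} = {X a, u} \<longleftrightarrow>
        (b = a \<and> u = X (Suc a)) \<or> (b = a - 1 \<and> u = X (a - 1))" for b
    proof
      assume b: "b < ?k \<and> {X b, X (Suc b)} = {X a, u}"
      then consider "X b = X a" "X (Suc b) = u" | "X b = u" "X (Suc b) = X a"
        using uX by (metis doubleton_eq_iff)
      then show "(b = a \<and> u = X (Suc a)) \<or> (b = a - 1 \<and> u = X (a - 1))"
      proof cases
        case 1
        then show ?thesis using Xeq[of b a] a b by auto
      next
        case 2
        then show ?thesis using Xeq[of "Suc b" a] a b by auto
      qed
    next
      assume "(b = a \<and> u = X (Suc a)) \<or> (b = a - 1 \<and> u = X (a - 1))"
      then show "b < ?k \<and> {X b, X (Suc b)} = {X a, u}" using a by (auto simp: insert_commute)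
    qed
    have "X (a - 1) \<noteq> X (Suc a)"
    proof -
      have "a - 1 \<le> ?k" "Suc a \<le> ?k" using a by auto
      then show ?thesis using Xeq[of "a - 1" "Suc a"] a k by auto
    qed
    then have "{b. b < ?k \<and> {X b, X (Suc b)} = {X a, u}}
        = (if u = X (Suc a) then {a} else if u = X (a - 1) then {a - 1} else {})"
      unfolding b_iff by auto
    then show ?thesis unfolding chips_def set using uX by simp
  qed
  then show ?thesis using that X(1-4) by blast
qed

section \<open>Lower bounds for the diameter of a decoration\<close>

lemma adjacent_decoration:
  assumes "x \<in> verts G"
  shows "adjacent (decoration G x) a b \<longleftrightarrow> adjacent G a b \<and> a \<in> D x \<and> b \<in> D x"
proof -
  define S where "S = insert x (\<Union>{S \<in> graph_components (delete_verts G {x}). finite S})"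
  have dec: "decoration G x = \<lparr>verts = verts G \<inter> S, edges = {e \<in> edges G. ends G e \<subseteq> S}, ends = ends G\<rparr>"
    unfolding decoration_def induced_def S_def by simp
  show ?thesis
    using adjacent_verts[OF wf, of a b] unfolding dec adjacent_def by auto
qed

lemma graph_dist_ge:
  assumes x: "x \<in> verts G" and ab: "a \<in> D x" "b \<in> D x"
    and ge: "\<And>n. (adjacent (decoration G x) ^^ n) a b \<Longrightarrow> m \<le> n"
  shows "m \<le> graph_diam (decoration G x)"
proof -
  let ?Q = "decoration G x"
  have "adjacent ?Q = (\<lambda>a b. adjacent G a b \<and> a \<in> D x \<and> b \<in> D x)"
    by (intro ext) (rule adjacent_decoration[OF x])
  then have toX: "(adjacent ?Q)\<^sup>*\<^sup>* w x" if "w \<in> D x" for w using D_connected[OF x that] by simp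
  have "(adjacent ?Q)\<^sup>*\<^sup>* a b" using toX[OF ab(1)] rtranclp_adjacent_sym[OF toX[OF ab(2)]] by simp
  then obtain n where "(adjacent ?Q ^^ n) a b" by (meson rtranclp_imp_relpowp)
  then have "(adjacent ?Q ^^ graph_dist ?Q a b) a b" unfolding graph_dist_def by (rule LeastI)
  then have "m \<le> graph_dist ?Q a b" by (rule ge)
  also have "\<dots> \<le> graph_diam ?Q"
    unfolding graph_diam_def
  proof (rule Max_ge)
    have "{graph_dist ?Q x' y' |x' y'. x' \<in> D x \<and> y' \<in> D x} = (\<lambda>(x', y'). graph_dist ?Q x' y') ` (D x \<times> D x)"
      by auto
    then show "finite {graph_dist ?Q x' y' |x' y'. x' \<in> D x \<and> y' \<in> D x}" using finite_D[OF x] by simp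
  qed (use ab in auto)
  finally show ?thesis .
qed

text \<open>A walk leaves \<open>D (p m)\<close> only through p m, so each step gains at most one
  level. Hence the diameters tend to infinity, which later forces long cycles.\<close>

lemma diam_ge_index:
  assumes i: "1 \<le> i"
  shows "i - 1 \<le> graph_diam (decoration G (p i))"
proof (rule graph_dist_ge[OF p_verts[OF i] v_in_D(1)[OF i] D_self[OF p_verts[OF i]]])
  fix n assume n: "(adjacent (decoration G (p i)) ^^ n) v (p i)"
  have "y \<in> D (p (Suc n))" if "(adjacent (decoration G (p i)) ^^ n) v y" for n y
    using that
  proof (induction n arbitrary: y)
    case 0
    then show ?case using v_in_D(1)[of "Suc 0"] by simp
  next
    case (Suc n)
    then obtain z where z: "(adjacent (decoration G (p i)) ^^ n) v z" "adjacent (decoration G (p i)) z y"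
      by auto
    have zD: "z \<in> D (p (Suc n))" by (rule Suc.IH[OF z(1)])
    have "z \<in> D (p (Suc (Suc n)))" "z \<noteq> p (Suc (Suc n))"
      using zD p_D_step[of "Suc n"] by auto
    then show ?case using D_closed[OF p_verts] z(2) adjacent_decoration[OF p_verts[OF i]] by simp
  qed
  then have "p i \<in> D (p (Suc n))" using n by blast
  then have "\<not> Suc n < i" using p_notin_earlier_D[of "Suc n" i] by auto
  then show "i - 1 \<le> n" by linarith
qed

text \<open>Branches are entered only through their cycle vertices, so a walk to the position
  opposite to p i has to pass half of the cycle.\<close>

lemma cycle_le_diam:
  assumes i: "1 \<le> i" and k: "2 < card (verts (C i))"
  shows "card (verts (C i)) \<le> 2 * graph_diam (decoration G (p i)) + 1"
proof -
  let ?k = "card (verts (C i))" and ?Q = "decoration G (p i)"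
  obtain X where X: "X 0 = p i" "X ?k = p i" "inj_on X {..<?k}" "verts (C i) = X ` {..<?k}"
    "\<And>a u. a \<in> {1..<?k} \<Longrightarrow> u \<notin> D (X a) \<Longrightarrow>
      chips G (X a) u = (if u = X (a - 1) \<or> u = X (Suc a) then 1 else 0)"
    using cycle_branches[OF i k] by blast
  have Xa: "X a \<in> verts (C i)" "X a \<noteq> p i" "X a \<in> verts G" if "a \<in> {1..<?k}" for a
    using that X(4) inj_onD[OF X(3), of a 0] X(1) C_verts[OF i] by auto
  \<comment> \<open>Stated for whole branches instead of cycle vertices, so that steps inside a
    branch are harmless in the induction.\<close>
  have key: "min a (?k - a) \<le> n" if "(adjacent ?Q ^^ n) (p i) y" "a \<in> {1..<?k}" "y \<in> D (X a)" for n y a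
    using that
  proof (induction n arbitrary: y a)
    case 0
    then show ?case using p_notin_D_cycle[OF i Xa(1,2)] by auto
  next
    case (Suc n)
    then obtain z where z: "(adjacent ?Q ^^ n) (p i) z" "adjacent ?Q z y" by auto
    have adj: "adjacent G y z"
      using z(2) adjacent_decoration[OF p_verts[OF i], of z y] adjacent_sym[of G z y] by simp
    show ?case
    proof (cases "z \<in> D (X a)")
      case True
      then show ?thesis using Suc.IH[OF z(1) Suc.prems(2)] by simp
    next
      case False
      then have yX: "y = X a" using D_closed[OF Xa(3)[OF Suc.prems(2)] Suc.prems(3) _ adj] by blast
      have "chips G (X a) z \<noteq> 0"
      proof -
        obtain e where e: "e \<in> edges G" "ends G e = {X a, z}" using adj yX unfolding adjacent_def by blast
        have "finite {e \<in> edges G. ends G e = {X a, z}}"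
          by (rule finite_subset[OF _ finite_incident[of "X a"]]) auto
        then have "card {e \<in> edges G. ends G e = {X a, z}} \<noteq> 0" using e by (auto simp: card_eq_0_iff)
        then show ?thesis unfolding chips_def by simp
      qed
      then have "z = X (a - 1) \<or> z = X (Suc a)" using X(5)[OF Suc.prems(2) False] by (auto split: if_splits)
      then obtain b where b: "z = X b" "b = a - 1 \<or> b = Suc a" by blast
      show ?thesis
      proof (cases "b \<in> {1..<?k}")
        case True
        have "z \<in> D (X b)" using D_self[OF Xa(3)[OF True]] b(1) by simp
        then have "min b (?k - b) \<le> n" by (rule Suc.IH[OF z(1) True])
        then show ?thesis using b(2) by auto
      next
        case False
        then have "a = 1 \<or> ?k = Suc a" using b(2) Suc.prems(2) by auto
        then show ?thesis by auto
      qed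
    qed
  qed
  have half: "?k div 2 \<in> {1..<?k}" using k by auto
  have "?k div 2 \<le> graph_diam ?Q"
  proof (rule graph_dist_ge[OF p_verts[OF i] D_self[OF p_verts[OF i]]])
    show "X (?k div 2) \<in> D (p i)" using C_subset_D[OF i] Xa(1)[OF half] by blast
    fix n assume "(adjacent ?Q ^^ n) (p i) (X (?k div 2))"
    then have "min (?k div 2) (?k - ?k div 2) \<le> n" using key half D_self[OF Xa(3)[OF half]] by blast
    then show "?k div 2 \<le> n" by linarith
  qed
  then show ?thesis by linarith
qed

end

section \<open>The sandpile model on the exhaustion\<close>

locale cactus_exhaustion = cactus_path +
  fixes H :: "nat \<Rightarrow> ('a, 'b) multigraph" and b :: "nat \<Rightarrow> 'a"
  assumes exhaustion: "exhaustion G H" and v_in_H: "v \<in> verts (H n)"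
    and boundary: "internal_boundary G (H n) = {b n}"
begin

sublocale wgraph "chips G" "vdegree G"
  by (rule chips_wgraph[OF wf lf])

abbreviation dec :: "nat \<Rightarrow> 'a set" where "dec i \<equiv> D (p i) - {p i}"

lemma H_subgraph: "subgraph (H n) G" "finite (verts (H n))" "graph_connected (H n)"
  using exhaustion unfolding exhaustion_def by auto

lemma H_mono: "m \<le> n \<Longrightarrow> verts (H m) \<subseteq> verts (H n) \<and> edges (H m) \<subseteq> edges (H n)"
proof (induction n rule: dec_induct)
  case (step n)
  have "subgraph (H n) (H (Suc n))" using exhaustion unfolding exhaustion_def by blast
  then show ?case using step.IH unfolding subgraph_def by auto
qed simp

lemma finite_eventually_subset:
  assumes "finite S" "S \<subseteq> (\<Union>n. A n)" and mono: "\<And>m n. m \<le> n \<Longrightarrow> A m \<subseteq> A n"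
  shows "\<forall>\<^sub>F n in sequentially. S \<subseteq> A (n :: nat)"
  using assms(1,2)
proof (induction S rule: finite_induct)
  case (insert x S)
  then obtain m where "x \<in> A m" by auto
  then have "\<forall>\<^sub>F n in sequentially. x \<in> A n"
    unfolding eventually_sequentially using mono by blast
  moreover have "\<forall>\<^sub>F n in sequentially. S \<subseteq> A n" using insert by simp
  ultimately show ?case by eventually_elim simp
qed simp

text \<open>Edges that merely touch the decoration are included, so that degrees agree with those of
  the whole graph, and \<open>b n\<close>, which has an edge leaving \<open>H n\<close>, lies
  outside the decoration.\<close>

definition covered :: "nat \<Rightarrow> nat \<Rightarrow> bool" where
  "covered n i \<longleftrightarrow> D (p i) \<subseteq> verts (H n) \<and> {e \<in> edges G. ends G e \<inter> D (p i) \<noteq> {}} \<subseteq> edges (H n)"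

lemma covered_eventually:
  assumes i: "1 \<le> i"
  shows "\<forall>\<^sub>F n in sequentially. covered n i"
proof -
  have fin: "finite (D (p i))" by (rule finite_D[OF p_verts[OF i]])
  have "{e \<in> edges G. ends G e \<inter> D (p i) \<noteq> {}} = (\<Union>x\<in>D (p i). {e \<in> edges G. x \<in> ends G e})" by blast
  then have finE: "finite {e \<in> edges G. ends G e \<inter> D (p i) \<noteq> {}}" using fin finite_incident by simp
  have U: "(\<Union>n. verts (H n)) = verts G" "(\<Union>n. edges (H n)) = edges G"
    using exhaustion unfolding exhaustion_def by auto
  have "\<forall>\<^sub>F n in sequentially. D (p i) \<subseteq> verts (H n)"
    by (rule finite_eventually_subset[OF fin]) (use U(1) D_verts[OF p_verts[OF i]] H_mono in auto)
  moreover have "\<forall>\<^sub>F n in sequentially. {e \<in> edges G. ends G e \<inter> D (p i) \<noteq> {}} \<subseteq> edges (H n)"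
    by (rule finite_eventually_subset[OF finE]) (use U(2) H_mono in auto)
  ultimately show ?thesis unfolding covered_def by eventually_elim simp
qed

lemma H_wf: "wf_multigraph (H n)" "ends (H n) = ends G" "edges (H n) \<subseteq> edges G"
  using H_subgraph(1)[of n] unfolding subgraph_def by auto

lemma b_notin:
  assumes "covered n i"
  shows "b n \<notin> D (p i)"
proof
  assume bD: "b n \<in> D (p i)"
  have "b n \<in> internal_boundary G (H n)" using boundary by simp
  then obtain y e where y: "y \<in> verts G - verts (H n)" and e: "e \<in> edges G" "ends G e = {b n, y}"
    unfolding internal_boundary_def adjacent_def by blast
  then have "e \<in> edges (H n)" using assms bD unfolding covered_def by auto
  then have "y \<in> verts (H n)" using H_wf[of n] e(2) unfolding wf_multigraph_def by auto
  then show False using y by simp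
qed

lemma covered_chips:
  assumes "covered n i" "w \<in> D (p i)"
  shows "chips (H n) w = chips G w" "vdegree (H n) w = vdegree G w"
proof -
  have inc: "e \<in> edges (H n)" if "e \<in> edges G" "w \<in> ends G e" for e
    using assms that unfolding covered_def by auto
  have "{e \<in> edges (H n). ends (H n) e = {w, u}} = {e \<in> edges G. ends G e = {w, u}}" for u
    using inc H_wf[of n] by auto
  then show "chips (H n) w = chips G w" unfolding chips_def by (intro ext) simp
  have "{e \<in> edges (H n). w \<in> ends (H n) e} = {e \<in> edges G. w \<in> ends G e}"
    "{e \<in> edges (H n). ends (H n) e = {w}} = {e \<in> edges G. ends G e = {w}}"
    using inc H_wf[of n] by auto
  then show "vdegree (H n) w = vdegree G w" unfolding vdegree_def by simp
qed

lemma sandpile_H: "sandpile (H n)"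
proof
  show "locally_finite (H n)"
    unfolding locally_finite_def
  proof
    fix x
    have "{e \<in> edges (H n). x \<in> ends (H n) e} \<subseteq> {e \<in> edges G. x \<in> ends G e}" using H_wf[of n] by auto
    then show "finite {e \<in> edges (H n). x \<in> ends (H n) e}" using finite_incident finite_subset by blast
  qed
qed (use H_wf H_subgraph in auto)

text \<open>The distance to the dissipative vertex serves as rank.\<close>

lemma superharmonic_H:
  "\<exists>h. wgraph.superharmonic (chips (H n)) (vdegree (H n)) (verts (H n) - {b n}) h"
proof -
  interpret S: sandpile "H n" "{b n}" by (rule sandpile_H)
  define \<rho> where "\<rho> w = (LEAST m. (adjacent (H n) ^^ m) w (b n))" for w
  have bH: "b n \<in> verts (H n)" using boundary[of n] unfolding internal_boundary_def by blast
  have "\<exists>y. chips (H n) w y \<noteq> 0 \<and> (y \<notin> S.V0 \<or> \<rho> y < \<rho> w)" if w: "w \<in> S.V0" for w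
  proof -
    have "(adjacent (H n))\<^sup>*\<^sup>* w (b n)"
      using H_subgraph(3)[of n] w bH unfolding graph_connected_def by blast
    then obtain m where "(adjacent (H n) ^^ m) w (b n)" by (meson rtranclp_imp_relpowp)
    then have \<rho>: "(adjacent (H n) ^^ \<rho> w) w (b n)" unfolding \<rho>_def by (rule LeastI)
    have "\<rho> w \<noteq> 0"
    proof
      assume "\<rho> w = 0"
      then have "w = b n" using \<rho> by simp
      then show False using w by simp
    qed
    then obtain l where l: "\<rho> w = Suc l" using not0_implies_Suc by blast
    then have "(adjacent (H n) ^^ Suc l) w (b n)" using \<rho> by simp
    then obtain y where y: "adjacent (H n) w y" "(adjacent (H n) ^^ l) y (b n)"
      by (metis relpowp_Suc_E2)
    have "\<rho> y \<le> l" unfolding \<rho>_def by (rule Least_le) (rule y(2))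
    moreover have "chips (H n) w y \<noteq> 0"
    proof -
      obtain e where e: "e \<in> edges (H n)" "ends (H n) e = {w, y}" using y(1) unfolding adjacent_def by blast
      have "finite {e \<in> edges (H n). ends (H n) e = {w, y}}"
        by (rule finite_subset[OF _ finite_incident[of w]]) (use H_wf[of n] in auto)
      then have "card {e \<in> edges (H n). ends (H n) e = {w, y}} \<noteq> 0" using e by (auto simp: card_eq_0_iff)
      then show ?thesis unfolding chips_def by simp
    qed
    ultimately show ?thesis using l by (intro exI[of _ y]) auto
  qed
  then show ?thesis using S.superharmonic_exists[OF S.finite_V0] by blast
qed

lemma dec_subset_V0:
  assumes "1 \<le> i" "covered n i"
  shows "dec i \<subseteq> verts (H n) - {b n}"
  using assms b_notin[OF assms(2)] unfolding covered_def by blast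

text \<open>The function is taken from a finite \<open>H n\<close> that covers the decoration, where
  weights and degrees are the same.\<close>

lemma superharmonic_dec:
  assumes i: "1 \<le> i"
  shows "\<exists>h. superharmonic (dec i) h"
proof -
  obtain n where n: "covered n i" using eventually_happens'[OF _ covered_eventually[OF i]] by auto
  interpret S: sandpile "H n" "{b n}" by (rule sandpile_H)
  obtain h where "S.superharmonic S.V0 h" using superharmonic_H by blast
  then have h: "S.superharmonic (dec i) h"
    by (rule S.superharmonic_subset[OF _ dec_subset_V0[OF i n] S.finite_V0])
  have "inflow (dec i) h w < vdegree G w * h w" if w: "w \<in> dec i" for w
  proof -
    have "w \<in> D (p i)" using w by blast
    note eq = covered_chips[OF n this]
    have "S.inflow (dec i) h w < vdegree (H n) w * h w"
      using h w unfolding S.superharmonic_def by blast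
    then show ?thesis unfolding inflow_def S.inflow_def eq .
  qed
  then have "superharmonic (dec i) h" unfolding superharmonic_def by blast
  then show ?thesis by blast
qed

lemma chips_nonadjacent:
  assumes "\<not> adjacent G x y"
  shows "chips G x y = 0"
proof -
  have "{e \<in> edges G. ends G e = {x, y}} = {}" using assms unfolding adjacent_def by blast
  then show ?thesis unfolding chips_def by (simp only: card.empty mult_0_right)
qed

lemma D_chips:
  assumes x: "x \<in> verts G" and w: "w \<in> D x" "w \<noteq> x" and u: "u \<notin> D x"
  shows "chips G w u = 0"
  by (rule chips_nonadjacent) (use D_closed[OF x w, of u] u in blast)

lemma cut_off_D:
  assumes x: "x \<in> verts G"
  shows "cut_off (D x - {x}) x"
  unfolding cut_off_def using finite_D[OF x] D_chips[OF x] by auto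

lemma insert_dec: "1 \<le> i \<Longrightarrow> insert (p i) (dec i) = D (p i)"
  using D_self[OF p_verts] by auto

text \<open>The branch of a cycle vertex is its own decoration. The entry position is that of p (i -
  1), whose decoration is the entire previous piece with its root.\<close>

lemma chain_ring_exists:
  assumes i: "2 \<le> i" and k: "2 < card (verts (C i))"
  shows "\<exists>X t. chain_ring (chips G) (vdegree G) (dec i) (p i) (card (verts (C i))) X (\<lambda>a. D (X a))
    (dec (i - 1)) (p (i - 1)) t"
proof -
  let ?k = "card (verts (C i))"
  have i1: "1 \<le> i" "1 \<le> i - 1" using i by auto
  obtain X where X: "X 0 = p i" "X ?k = p i" "inj_on X {..<?k}" "verts (C i) = X ` {..<?k}"
    "\<And>a u. a \<in> {1..<?k} \<Longrightarrow> u \<notin> D (X a) \<Longrightarrow>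
      chips G (X a) u = (if u = X (a - 1) \<or> u = X (Suc a) then 1 else 0)"
    using cycle_branches[OF i1(1) k] by blast
  have Xa: "X a \<in> verts (C i)" "X a \<noteq> p i" "X a \<in> verts G" if "a \<in> {1..<?k}" for a
    using that X(4) inj_onD[OF X(3), of a 0] X(1) C_verts[OF i1(1)] by auto
  have pC: "p (i - 1) \<in> verts (C i)" using p_in_C(2)[OF i1(2)] i by simp
  then obtain t where t: "t < ?k" "p (i - 1) = X t" using X(4) by auto
  have pne: "p (i - 1) \<noteq> p i" using p_neq[OF i1(2), of i] i by simp
  have t1: "t \<in> {1..<?k}" using t pne X(1) by (cases t) auto
  have "chain_ring (chips G) (vdegree G) (dec i) (p i) ?k X (\<lambda>a. D (X a)) (dec (i - 1)) (p (i - 1)) t"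
  proof unfold_locales
    show "ring (dec i) (p i) ?k X (\<lambda>a. D (X a))"
      unfolding ring_def
    proof (intro conjI ballI)
      show "3 \<le> ?k" "X 0 = p i" "X ?k = p i" using k X by auto
      show "cut_off (dec i) (p i)" by (rule cut_off_D[OF p_verts[OF i1(1)]])
      fix a assume a: "a \<in> {1..<?k}"
      show "X a \<in> D (X a)" by (rule D_self[OF Xa(3)[OF a]])
      show "D (X a) \<subseteq> dec i"
        using D_subset_D[OF i1(1) Xa(1,2)[OF a]] p_notin_D_cycle[OF i1(1) Xa(1,2)[OF a]] by auto
      show "a \<noteq> c \<longrightarrow> D (X a) \<inter> D (X c) = {}" if c: "c \<in> {1..<?k}" for c
      proof
        assume "a \<noteq> c"
        then have "X a \<noteq> X c" using inj_onD[OF X(3), of a c] a c by auto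
        then show "D (X a) \<inter> D (X c) = {}" by (rule D_disjoint[OF i1(1) Xa(1,2)[OF a] Xa(1,2)[OF c]])
      qed
      show "\<forall>u. u \<notin> D (X a) \<longrightarrow> chips G w u = 0" if "w \<in> D (X a) - {X a}" for w
        using D_chips[OF Xa(3)[OF a], of w] that by auto
      show "\<forall>u. u \<notin> D (X a) \<longrightarrow> chips G (X a) u = (if u = X (a - 1) \<or> u = X (Suc a) then 1 else 0)"
        using X(5)[OF a] by blast
    qed
    show "cut_off (dec (i - 1)) (p (i - 1))" by (rule cut_off_D[OF p_verts[OF i1(2)]])
    show "t \<in> {1..<?k}" by (rule t1)
    show "X t = p (i - 1)" using t by simp
    show "D (X t) = insert (p (i - 1)) (dec (i - 1))" unfolding t(2)[symmetric] insert_dec[OF i1(2)] ..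
  qed
  then show ?thesis by blast
qed

lemma ring_chain_exists:
  assumes J0: "1 \<le> J0" and k: "\<And>i. J0 < i \<Longrightarrow> 2 < card (verts (C i))"
  shows "\<exists>X t. ring_chain (chips G) (vdegree G) v p dec J0 (\<lambda>i. card (verts (C i))) X (\<lambda>i a. D (X i a)) t"
proof -
  have "\<exists>X t. J0 < i \<longrightarrow> chain_ring (chips G) (vdegree G) (dec i) (p i) (card (verts (C i))) X (\<lambda>a. D (X a))
    (dec (i - 1)) (p (i - 1)) t" for i
    using chain_ring_exists[of i] k[of i] J0 by (cases "J0 < i") auto
  then obtain X t where Xt: "\<And>i. J0 < i \<Longrightarrow> chain_ring (chips G) (vdegree G) (dec i) (p i) (card (verts (C i)))
      (X i) (\<lambda>a. D (X i a)) (dec (i - 1)) (p (i - 1)) (t i)"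
    by metis
  have "ring_chain (chips G) (vdegree G) v p dec J0 (\<lambda>i. card (verts (C i))) X (\<lambda>i a. D (X i a)) t"
  proof (intro ring_chain.intro ring_chain_axioms.intro wgraph_axioms J0)
    fix i :: nat
    assume i: "1 \<le> i"
    show "cut_off (dec i) (p i)" by (rule cut_off_D[OF p_verts[OF i]])
    show "v \<in> dec i" using v_in_D[OF i] by auto
    show "insert (p i) (dec i) \<subseteq> dec (Suc i)" unfolding insert_dec[OF i] using p_D_step[OF i] by auto
    show "\<exists>h. superharmonic (dec i) h" by (rule superharmonic_dec[OF i])
  next
    fix i :: nat assume "J0 < i"
    then show "chain_ring (chips G) (vdegree G) (dec i) (p i) (card (verts (C i))) (X i) (\<lambda>a. D (X i a))
      (dec (i - 1)) (p (i - 1)) (t i)" by (rule Xt)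
  qed
  then show ?thesis by blast
qed

lemma recurrent_configs_H:
  "recurrent_configs (H n) {b n} =
    wgraph.rec_set (chips (H n)) (vdegree (H n)) (verts (H n) - {b n})"
  if "covered n 1"
proof -
  interpret S: sandpile "H n" "{b n}" by (rule sandpile_H)
  obtain h where h: "S.superharmonic S.V0 h" using superharmonic_H by blast
  have "v \<in> S.V0" using dec_subset_V0[OF order.refl that] v_in_D[of 1] by auto
  then show ?thesis using S.recurrent_configs_eq[OF h] by blast
qed

lemma covered_mono:
  assumes "1 \<le> i" "i \<le> j" "covered n j"
  shows "covered n i"
proof -
  have "D (p i) \<subseteq> D (p j)" by (rule p_D_mono[OF assms(1,2)])
  then show ?thesis using assms(3) unfolding covered_def by blast
qed

lemma avalanche_mass_H:
  assumes n: "covered n 1" and c: "c \<in> recurrent_configs (H n) {b n}"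
  shows "avalanche_mass (H n) {b n} c v =
    card {w. wgraph.odometer (chips (H n)) (vdegree (H n)) (verts (H n) - {b n}) (add_chip c v) w \<noteq> 0}"
proof -
  interpret S: sandpile "H n" "{b n}" by (rule sandpile_H)
  obtain h where h: "S.superharmonic S.V0 h" using superharmonic_H by blast
  obtain u where u: "S.stab_vec S.V0 (add_chip c v) u" using S.stab_vec_exists[OF h S.finite_V0] .
  have vV: "v \<in> S.V0" using dec_subset_V0[OF order.refl n] v_in_D[of 1] by auto
  have "c \<in> S.rec_set S.V0" using c unfolding recurrent_configs_H[OF n] .
  from S.rec_setD(2)[OF this] show ?thesis by (rule S.avalanche_mass_eq[OF u _ vV])
qed

text \<open>The right-hand side is free of n, so the limit is attained as soon as \<open>H n\<close>
  covers the decoration of p (i + 1).\<close>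

lemma avalanche_prob_eq:
  assumes i: "1 \<le> i" and n: "covered n (Suc i)" and M: "M < card (D (p i))"
  shows "avalanche_prob (H n) {b n} v M
    = card (stopped v (dec i) (p i) (dec (Suc i)) M) / card (rec_set (dec (Suc i)))"
proof -
  interpret S: sandpile "H n" "{b n}" by (rule sandpile_H)
  obtain h where h: "S.superharmonic S.V0 h" using superharmonic_H by blast
  have n1: "covered n 1" by (rule covered_mono[OF _ _ n]) auto
  let ?R = "recurrent_configs (H n) {b n}"
  have R: "?R = S.rec_set S.V0" by (rule recurrent_configs_H[OF n1])
  have finR: "finite ?R" unfolding R by (rule S.finite_rec_set[OF S.finite_V0])
  have neR: "?R \<noteq> {}" unfolding R using S.max_config_in_rec_set[OF h S.finite_V0] by blast
  have Dn: "w \<in> D (p (Suc i))" if "w \<in> dec (Suc i)" for w using that by blast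
  have agree: "chips G w = chips (H n) w \<and> vdegree G w = vdegree (H n) w" if "w \<in> dec (Suc i)" for w
    using covered_chips[OF n Dn[OF that]] by simp
  have sub: "insert (p i) (dec i) \<subseteq> dec (Suc i)" unfolding insert_dec[OF i] using p_D_step[OF i] by auto
  have cong: "rec_set (dec (Suc i)) = S.rec_set (dec (Suc i))"
    "stopped v (dec i) (p i) (dec (Suc i)) M = S.stopped v (dec i) (p i) (dec (Suc i)) M"
    by (rule stopped_cong[OF wgraph_axioms S.wgraph_axioms agree sub], assumption)+
  have cutS: "S.cut_off (dec j) (p j)" if j: "1 \<le> j" "j \<le> Suc i" for j
  proof -
    have "chips (H n) w u = chips G w u" if "w \<in> dec j" for w u
      using covered_chips(1)[OF covered_mono[OF j n]] that by auto
    then show ?thesis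
      using cut_off_D[OF p_verts[OF j(1)]] unfolding cut_off_def S.cut_off_def by auto
  qed
  have "avalanche_prob (H n) {b n} v M = card (?R \<inter> {c. avalanche_mass (H n) {b n} c v = M}) / card ?R"
    unfolding avalanche_prob_def by (rule measure_pmf_of_set[OF neR finR])
  also have "?R \<inter> {c. avalanche_mass (H n) {b n} c v = M}
      = {c\<in>S.rec_set S.V0. card {w. S.odometer S.V0 (add_chip c v) w \<noteq> 0} = M}"
    using avalanche_mass_H[OF n1] unfolding R by auto
  also have "card \<dots> / card ?R
      = card (S.stopped v (dec i) (p i) (dec (Suc i)) M) / card (S.rec_set (dec (Suc i)))"
    unfolding R
  proof (rule S.mass_fraction[OF cutS[OF i] cutS sub _ S.finite_V0 _ h])
    show "dec (Suc i) \<subseteq> S.V0" by (rule dec_subset_V0[OF _ n]) simp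
    show "v \<in> dec i" using v_in_D[OF i] by auto
    show "M < card (insert (p i) (dec i))" unfolding insert_dec[OF i] by (rule M)
  qed auto
  finally show ?thesis unfolding cong .
qed

theorem avalanche_limits:
  assumes J0: "1 \<le> J0" and k: "\<And>i. J0 < i \<Longrightarrow> 2 < card (verts (C i))"
    and tail: "\<And>m. (\<Sum>l\<in>{J0<..m}. 1 / real (card (verts (C l)))) \<le> 1 / 4"
  shows "\<exists>\<kappa>>0. \<exists>J\<ge>J0. \<forall>i>J. \<forall>M. card (D (p (i - 1))) \<le> M \<and> M < card (D (p i)) \<and> realizable_mass H b v M \<longrightarrow>
    (\<exists>L. (\<lambda>n. avalanche_prob (H n) {b n} v M) \<longlonglongrightarrow> L \<and>
       \<kappa> / (real (card (verts (C i))) * real (card (verts (C (Suc i))))) \<le> L \<and>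
       L \<le> 2 / (real (card (verts (C i))) * real (card (verts (C (Suc i))))))"
proof -
  let ?k = "\<lambda>i. card (verts (C i))"
  obtain X t where "ring_chain (chips G) (vdegree G) v p dec J0 ?k X (\<lambda>i a. D (X i a)) t"
    using ring_chain_exists[OF J0 k] by blast
  then interpret r: ring_chain "chips G" "vdegree G" v p dec J0 ?k X "\<lambda>i a. D (X i a)" t .
  define level where "level i M \<longleftrightarrow> J0 < i \<and> card (D (p (i - 1))) \<le> M \<and> M < card (D (p i)) \<and> realizable_mass H b v M" for i M
  have prob: "\<forall>\<^sub>F n in sequentially. avalanche_prob (H n) {b n} v M = r.frac (Suc i) (r.stop i M)"
    if "level i M" for i M
  proof -
    have i: "1 \<le> i" "M < card (D (p i))" using that J0 unfolding level_def by auto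
    have "\<forall>\<^sub>F n in sequentially. covered n (Suc i)" by (rule covered_eventually) simp
    then show ?thesis
      by eventually_elim (use avalanche_prob_eq[OF i(1) _ i(2)] in \<open>simp add: r.frac_def\<close>)
  qed
  \<comment> \<open>With an empty event the probability would vanish for all large n, although a
    realizable mass has positive probability for infinitely many n.\<close>
  have nonempty: "r.stop i M \<noteq> {}" if l: "level i M" for i M
  proof
    assume e: "r.stop i M = {}"
    have "\<forall>\<^sub>F n in sequentially. covered n 1" by (rule covered_eventually) simp
    then have "\<forall>\<^sub>F n in sequentially. \<not> (\<exists>c \<in> recurrent_configs (H n) {b n}. avalanche_mass (H n) {b n} c v = M)"
      using prob[OF l]
    proof eventually_elim
      case (elim n)
      interpret S: sandpile "H n" "{b n}" by (rule sandpile_H)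
      let ?R = "recurrent_configs (H n) {b n}"
      have finR: "finite ?R" unfolding recurrent_configs_H[OF elim(1)] by (rule S.finite_rec_set[OF S.finite_V0])
      show ?case
      proof
        assume "\<exists>c\<in>?R. avalanche_mass (H n) {b n} c v = M"
        then obtain c where c: "c \<in> ?R" "avalanche_mass (H n) {b n} c v = M" by blast
        then have ne: "?R \<noteq> {}" by blast
        have "0 < card (?R \<inter> {c. avalanche_mass (H n) {b n} c v = M})" "0 < card ?R"
          using c finR ne by (auto simp only: card_gt_0_iff)
        then have "0 < real (card (?R \<inter> {c. avalanche_mass (H n) {b n} c v = M})) / real (card ?R)"
          by simp
        also have "\<dots> = avalanche_prob (H n) {b n} v M"
          unfolding avalanche_prob_def by (rule measure_pmf_of_set[OF ne finR, symmetric])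
        also have "\<dots> = 0" using elim(2) e unfolding r.frac_def by simp
        finally show False by simp
      qed
    qed
    moreover have "realizable_mass H b v M" using l unfolding level_def by blast
    ultimately show False unfolding realizable_mass_def frequently_def by blast
  qed
  have M_le: "card (insert (p (i - 1)) (dec (i - 1))) \<le> M" if "level i M" for i M
    using that insert_dec[of "i - 1"] J0 unfolding level_def by auto
  \<comment> \<open>An avalanche stopped before p i delivers exactly one chip there
    (\<open>stopD\<close>), so one realizable mass makes the good fraction positive at its
    level.\<close>
  have good_nonempty: "0 < r.good_frac i" if l: "level i M" for i M
  proof -
    have i: "J0 < i" "1 \<le> i" using l J0 unfolding level_def by auto
    obtain c where "c \<in> r.stop i M" using nonempty[OF l] by blast
    then have "good v (dec i) (p i) \<noteq> {}" using r.stopD(1)[OF i(1) M_le[OF l]] by blast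
    moreover have "finite (good v (dec i) (p i))"
      using finite_subset[OF r.good_subset finite_rec_set[OF r.finite_I[OF i(2)]]] .
    ultimately show ?thesis
      unfolding r.frac_def using r.card_rec_set_I_pos[OF i(2)] by (simp add: card_gt_0_iff)
  qed
  \<comment> \<open>Chosen once and for all, so that \<kappa> depends neither on i nor on M. If no
    level is occupied, the claim is vacuous and any positive \<kappa> will do.\<close>
  define J where "J = (if \<exists>i M. level i M then (SOME i. \<exists>M. level i M) else J0)"
  define \<kappa> where "\<kappa> = (if \<exists>i M. level i M then r.good_frac J / 2 else 1)"
  have J: "J0 \<le> J \<and> 0 < \<kappa>"
  proof (cases "\<exists>i M. level i M")
    case True
    then have "\<exists>M. level J M" unfolding J_def using someI_ex[of "\<lambda>i. \<exists>M. level i M"] by simp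
    then show ?thesis using good_nonempty True unfolding \<kappa>_def level_def by auto
  qed (simp_all add: J_def \<kappa>_def)
  have "\<exists>L. (\<lambda>n. avalanche_prob (H n) {b n} v M) \<longlonglongrightarrow> L \<and>
       \<kappa> / (real (?k i) * real (?k (Suc i))) \<le> L \<and> L \<le> 2 / (real (?k i) * real (?k (Suc i)))"
    if iM: "J < i" "card (D (p (i - 1))) \<le> M" "M < card (D (p i))" "realizable_mass H b v M" for i M
  proof (intro exI[of _ "r.frac (Suc i) (r.stop i M)"] conjI)
    have l: "level i M" and iJ: "J0 < i" using iM J unfolding level_def by auto
    have ex: "\<exists>i M. level i M" using l by blast
    show "(\<lambda>n. avalanche_prob (H n) {b n} v M) \<longlonglongrightarrow> r.frac (Suc i) (r.stop i M)"
      by (rule tendsto_eventually[OF prob[OF l]])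
    show "r.frac (Suc i) (r.stop i M) \<le> 2 / (real (?k i) * real (?k (Suc i)))"
      by (rule r.stop_frac_le[OF iJ M_le[OF l]])
    obtain c where c: "c \<in> r.stop i M" using nonempty[OF l] by blast
    obtain j where j: "j \<in> {1..<?k i}" "j \<noteq> t i" "card (arc (\<lambda>a. D (X i a)) (?k i) (t i) j) = M"
      using r.stopD(3)[OF iJ M_le[OF l] c] by blast
    have "i - 1 = J + (i - 1 - J)" using iM(1) by simp
    then have "r.good_frac J * (1 - (\<Sum>l\<in>{J<..i - 1}. 2 / real (?k l))) \<le> r.good_frac (i - 1)"
      using r.good_frac_ge[of J "i - 1 - J"] J by simp
    \<comment> \<open>The tail bound 1/4, doubled; the factor 1/2 in \<kappa> comes from
      here.\<close>
    moreover have "(\<Sum>l\<in>{J<..i - 1}. 2 / real (?k l)) \<le> 1 / 2"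
    proof -
      have "(\<Sum>l\<in>{J<..i - 1}. 2 / real (?k l)) \<le> (\<Sum>l\<in>{J0<..i - 1}. 2 / real (?k l))"
        using J by (intro sum_mono2) auto
      also have "\<dots> = 2 * (\<Sum>l\<in>{J0<..i - 1}. 1 / real (?k l))" by (simp add: sum_distrib_left)
      finally show ?thesis using tail[of "i - 1"] by linarith
    qed
    ultimately have "\<kappa> \<le> r.good_frac (i - 1)"
      using mult_left_mono[of "1 / 2" "1 - (\<Sum>l\<in>{J<..i - 1}. 2 / real (?k l))" "r.good_frac J"]
        r.frac_nonneg[of J] ex unfolding \<kappa>_def by auto
    then have "\<kappa> / (real (?k i) * real (?k (Suc i))) \<le> r.good_frac (i - 1) / (real (?k i) * real (?k (Suc i)))"
      by (intro divide_right_mono) auto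
    also have "\<dots> \<le> r.frac (Suc i) (r.stop i M)" by (rule r.stop_frac_ge[OF iJ j])
    finally show "\<kappa> / (real (?k i) * real (?k (Suc i))) \<le> r.frac (Suc i) (r.stop i M)" .
  qed
  then show ?thesis using J by (intro exI[of _ \<kappa>]) auto
qed

end

section \<open>Growth of the decorations\<close>

text \<open>By the limsup, d i is eventually below the power \<beta> + \<epsilon> of the diameter,
  and the diameter is at most c times the cycle length.\<close>

lemma upper_growth:
  fixes d m k :: "nat \<Rightarrow> nat" and \<beta> \<epsilon> c :: real
  assumes le: "\<forall>\<^sub>F i in sequentially. real (m i) \<le> c * real (k i)"
    and sup: "limsup (\<lambda>i. ereal (ln (real (d i)) / ln (real (m i)))) = ereal \<beta>"
    and \<epsilon>: "0 < \<epsilon>" "0 < \<beta> + \<epsilon>" and m2: "\<forall>\<^sub>F i in sequentially. 2 \<le> m i"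
  shows "\<forall>\<^sub>F i in sequentially. \<forall>M. 1 \<le> M \<and> M < d i \<longrightarrow> real M powr (1 / (\<beta> + \<epsilon>)) \<le> c * real (k i)"
proof -
  have "\<forall>\<^sub>F i in sequentially. ereal (ln (real (d i)) / ln (real (m i))) < ereal (\<beta> + \<epsilon>)"
    by (rule Limsup_lessD) (use sup \<epsilon> in simp)
  then show ?thesis
    using le m2
  proof eventually_elim
    case (elim i)
    show ?case
    proof (intro allI impI)
      fix M assume M: "1 \<le> M \<and> M < d i"
      have "ln (real (d i)) < (\<beta> + \<epsilon>) * ln (real (m i))"
        using elim(1,3) by (simp add: divide_less_eq)
      moreover have "ln (real M) \<le> ln (real (d i))" using M by simp
      ultimately have "(1 / (\<beta> + \<epsilon>)) * ln (real M) \<le> ln (real (m i))"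
        using \<epsilon> by (simp add: field_simps)
      then have "exp ((1 / (\<beta> + \<epsilon>)) * ln (real M)) \<le> exp (ln (real (m i)))" by simp
      then have "real M powr (1 / (\<beta> + \<epsilon>)) \<le> real (m i)"
        using M elim(3) by (simp add: powr_def)
      then show "real M powr (1 / (\<beta> + \<epsilon>)) \<le> c * real (k i)" using elim(2) by linarith
    qed
  qed
qed

text \<open>M is compared with d (i - 1), while the cycles i and i + 1 are governed by d i and d (i
  + 1). The ratio hypothesis bridges at most two index steps, each at the cost of a factor \<theta>
  in the exponent.\<close>

lemma lower_growth:
  fixes d m k :: "nat \<Rightarrow> nat" and \<beta>' \<epsilon> :: real
  assumes k: "\<forall>\<^sub>F i in sequentially. k i \<le> 3 * m i"
    and inf: "liminf (\<lambda>i. ereal (ln (real (d i)) / ln (real (m i)))) = ereal \<beta>'"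
    and ratio: "(\<lambda>i. ln (real (d (i - 1))) / ln (real (d i))) \<longlonglongrightarrow> 1"
    and \<epsilon>: "0 < \<epsilon>" "\<epsilon> < \<beta>'" and m2: "\<forall>\<^sub>F i in sequentially. 2 \<le> m i"
    and d2: "\<forall>\<^sub>F i in sequentially. 2 \<le> d i"
  shows "\<forall>\<^sub>F i in sequentially. \<forall>M. d (i - 1) \<le> M \<longrightarrow>
    real (k i) \<le> 3 * real M powr (1 / (\<beta>' - \<epsilon>)) \<and> real (k (Suc i)) \<le> 3 * real M powr (1 / (\<beta>' - \<epsilon>))"
proof -
  \<comment> \<open>Half of \<epsilon> is spent on the liminf, the other half on two factors
    \<theta>, chosen such that \<theta> * \<theta> * q = \<beta>' - \<epsilon>.\<close>
  define q where "q = \<beta>' - \<epsilon> / 2"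
  define \<theta> where "\<theta> = sqrt ((\<beta>' - \<epsilon>) / q)"
  have q: "0 < q" "\<beta>' - \<epsilon> < q" using \<epsilon> unfolding q_def by auto
  have \<theta>: "0 < \<theta>" "\<theta> < 1" "\<theta> * \<theta> * q = \<beta>' - \<epsilon>"
    using q \<epsilon> unfolding \<theta>_def by auto
  have "\<forall>\<^sub>F i in sequentially. ereal q < ereal (ln (real (d i)) / ln (real (m i)))"
    by (rule less_LiminfD) (use inf \<epsilon> in \<open>simp add: q_def\<close>)
  then have 1: "\<forall>\<^sub>F i in sequentially. q * ln (real (m i)) \<le> ln (real (d i))"
    using m2 by eventually_elim (simp add: less_divide_eq)
  have "\<forall>\<^sub>F i in sequentially. \<theta> < ln (real (d (i - 1))) / ln (real (d i))"
    by (rule order_tendstoD(1)[OF ratio \<theta>(2)])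
  then have 2: "\<forall>\<^sub>F i in sequentially. \<theta> * ln (real (d i)) \<le> ln (real (d (i - 1)))"
    using d2 by eventually_elim (simp add: less_divide_eq)
  have shift: "\<forall>\<^sub>F i in sequentially. P (Suc i)" if "\<forall>\<^sub>F i in sequentially. P i" for P
    using that by (subst eventually_sequentially_Suc)
  have d2': "\<forall>\<^sub>F i in sequentially. 2 \<le> d (i - 1)"
    using d2 unfolding eventually_sequentially by (meson diff_le_mono le_add2 le_diff_conv add_le_imp_le_diff)
  show ?thesis
    using 1 2 shift[OF 1] shift[OF 2] k shift[OF k] m2 shift[OF m2] d2 shift[OF d2] d2'
  proof eventually_elim
    case (elim i)
    show ?case
    proof (intro allI impI)
      fix M assume M: "d (i - 1) \<le> M"
      have "real (d (i - 1)) \<le> real M" "2 \<le> real (d (i - 1))" using M elim(11) by auto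
      then have lnM: "ln (real (d (i - 1))) \<le> ln (real M)" and M0: "0 < real M" by auto
      have pos: "0 \<le> ln (real (d i))" using elim(9) by simp
      have key: "real x \<le> 3 * real M powr (1 / (\<beta>' - \<epsilon>))"
        if "q * ln (real y) \<le> z" "\<theta> * \<theta> * z \<le> ln (real (d (i - 1)))" "x \<le> 3 * y" "2 \<le> y" for x y :: nat and z
      proof -
        have "(\<beta>' - \<epsilon>) * ln (real y) = \<theta> * \<theta> * (q * ln (real y))" by (simp only: \<theta>(3)[symmetric] mult.assoc)
        also have "\<dots> \<le> \<theta> * \<theta> * z" using that(1) \<theta>(1) by (intro mult_left_mono) auto
        also have "\<dots> \<le> ln (real M)" using that(2) lnM by linarith
        finally have "ln (real y) \<le> (1 / (\<beta>' - \<epsilon>)) * ln (real M)"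
          using \<epsilon> by (simp add: pos_le_divide_eq mult.commute)
        then have "exp (ln (real y)) \<le> exp ((1 / (\<beta>' - \<epsilon>)) * ln (real M))" by simp
        then have "real y \<le> real M powr (1 / (\<beta>' - \<epsilon>))" using that(4) M0 by (simp add: powr_def)
        moreover have "real x \<le> 3 * real y" using that(3) by linarith
        ultimately show ?thesis by linarith
      qed
      have "\<theta> * (\<theta> * ln (real (d i))) \<le> 1 * (\<theta> * ln (real (d i)))"
        using \<theta> pos by (intro mult_right_mono) auto
      then have "\<theta> * \<theta> * ln (real (d i)) \<le> ln (real (d (i - 1)))"
        using elim(2) by (simp add: mult.assoc)
      moreover have "\<theta> * (\<theta> * ln (real (d (Suc i)))) \<le> \<theta> * ln (real (d i))"
        using elim(4) \<theta>(1) by (intro mult_left_mono) auto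
      then have "\<theta> * \<theta> * ln (real (d (Suc i))) \<le> ln (real (d (i - 1)))"
        using elim(2) by (simp add: mult.assoc)
      ultimately show "real (k i) \<le> 3 * real M powr (1 / (\<beta>' - \<epsilon>)) \<and>
          real (k (Suc i)) \<le> 3 * real M powr (1 / (\<beta>' - \<epsilon>))"
        using key elim by blast
    qed
  qed
qed

lemma exponents_close:
  fixes \<beta> \<epsilon> :: real
  assumes "0 < \<beta>" "0 < \<epsilon>"
  obtains \<epsilon>' where "0 < \<epsilon>'" "\<epsilon>' < \<beta>" "2 / (\<beta> - \<epsilon>') \<le> 2 / \<beta> + \<epsilon>" "2 / \<beta> - \<epsilon> \<le> 2 / (\<beta> + \<epsilon>')"
proof -
  \<comment> \<open>With \<epsilon>' at most \<beta> / 2 both denominators are at least \<beta> *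
    (\<beta> / 2), so both errors are at most 4 * \<epsilon>' / (\<beta> * \<beta>).\<close>
  define \<epsilon>' where "\<epsilon>' = min (\<beta> / 2) (\<epsilon> * \<beta>\<^sup>2 / 4)"
  have pos: "0 < \<epsilon>'" "\<epsilon>' \<le> \<beta> / 2" "4 * \<epsilon>' \<le> \<epsilon> * \<beta>\<^sup>2" using assms unfolding \<epsilon>'_def by (auto simp: min_def)
  have "2 / (\<beta> - \<epsilon>') - 2 / \<beta> = 2 * \<epsilon>' / (\<beta> * (\<beta> - \<epsilon>'))" using pos assms by (simp add: field_simps)
  also have "\<dots> \<le> 2 * \<epsilon>' / (\<beta> * (\<beta> / 2))" using pos assms by (intro divide_left_mono mult_left_mono) auto
  also have "\<dots> \<le> \<epsilon>" using pos assms by (simp add: field_simps power2_eq_square)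
  finally have 1: "2 / (\<beta> - \<epsilon>') \<le> 2 / \<beta> + \<epsilon>" by simp
  have "2 / \<beta> - 2 / (\<beta> + \<epsilon>') = 2 * \<epsilon>' / (\<beta> * (\<beta> + \<epsilon>'))" using pos assms by (simp add: field_simps)
  also have "\<dots> \<le> 2 * \<epsilon>' / (\<beta> * (\<beta> / 2))" using pos assms by (intro divide_left_mono mult_left_mono) auto
  also have "\<dots> \<le> \<epsilon>" using pos assms by (simp add: field_simps power2_eq_square)
  finally have 2: "2 / \<beta> - \<epsilon> \<le> 2 / (\<beta> + \<epsilon>')" by simp
  show ?thesis using that[OF pos(1) _ 1 2] pos assms by auto
qed

lemma bounded_sums_tail:
  fixes f :: "nat \<Rightarrow> real"
  assumes f: "\<And>j. 0 \<le> f j" and bd: "\<And>m. (\<Sum>j\<in>{1..m}. f j) \<le> K" and e: "0 < e"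
  obtains N where "\<And>J m. N \<le> J \<Longrightarrow> (\<Sum>l\<in>{J<..m}. f l) \<le> e"
proof -
  have "(\<Sum>i\<le>n. f i) \<le> f 0 + K" for n
  proof -
    have "{..n} = insert 0 {1..n}" by auto
    then show ?thesis using bd[of n] by simp
  qed
  then have "summable f"
    by (intro bounded_imp_summable[of f "f 0 + K"]) (use f in auto)
  then obtain N where N: "\<And>m n. N \<le> m \<Longrightarrow> norm (sum f {m..<n}) < e"
    unfolding summable_Cauchy using e by blast
  have "(\<Sum>l\<in>{J<..m}. f l) \<le> e" if "N \<le> J" for J m
  proof -
    have "{J<..m} = {Suc J..<Suc m}" by auto
    then show ?thesis using N[of "Suc J" "Suc m"] that by (simp add: abs_less_iff)
  qed
  then show ?thesis using that by blast
qed

section \<open>Path lengths and sizes of decorations\<close>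

context cactus_exhaustion
begin

text \<open>The dissipative vertex lies outside \<open>D (p i)\<close>, which contains the first i
  blocks. So the lengths r tend to infinity, and the summability hypothesis reaches all
  blocks.\<close>

lemma path_length_gt:
  assumes r: "v \<noteq> b n \<Longrightarrow> joining_block_path (H n) v (b n) (map C [1..<r + 1])"
    and i: "1 \<le> i" and n: "covered n i"
  shows "i < r"
proof (rule ccontr)
  assume "\<not> i < r"
  then have ri: "r \<le> i" by simp
  have "v \<noteq> b n" using v_in_D(1)[OF i] b_notin[OF n] by auto
  then have bp: "block_path_between (H n) v (b n) (map C [1..<r + 1])"
    using r unfolding joining_block_path_def by blast
  then have r1: "1 \<le> r" unfolding block_path_between_def block_path_def by (cases r) auto
  have "b n \<in> verts (C r)"
    using bp hd_last_C(2)[OF r1] unfolding block_path_between_def by simp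
  also have "\<dots> \<subseteq> D (p r)" by (rule C_subset_D[OF r1])
  also have "\<dots> \<subseteq> D (p i)" by (rule p_D_mono[OF r1 ri])
  finally show False using b_notin[OF n] by blast
qed

lemma card_D_strict_mono:
  assumes "1 \<le> i"
  shows "card (D (p i)) < card (D (p (Suc i)))"
  using p_D_step[OF assms] D_self[OF p_verts[of "Suc i"]] finite_D[OF p_verts[of "Suc i"]]
  by (intro psubset_card_mono) auto

lemma card_D_ge:
  assumes "1 \<le> i"
  shows "i \<le> card (D (p i))"
  using assms
proof (induction i rule: dec_induct)
  case base
  have "0 < card (D (p 1))"
    using D_self[OF p_verts[of 1]] finite_D[OF p_verts[of 1]] by (auto simp: card_gt_0_iff)
  then show ?case by simp
next
  case (step i)
  then show ?case using card_D_strict_mono[of i] by simp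
qed

text \<open>The sizes of the decorations increase strictly, so every large mass falls between two
  consecutive ones.\<close>

lemma level_exists:
  assumes J: "1 \<le> J" and M: "card (D (p J)) \<le> M"
  obtains i where "J < i" "card (D (p (i - 1))) \<le> M" "M < card (D (p i))"
proof -
  define i where "i = (LEAST i. J \<le> i \<and> M < card (D (p i)))"
  have "J \<le> J + Suc M \<and> M < card (D (p (J + Suc M)))"
    using card_D_ge[of "J + Suc M"] by simp
  then have i: "J \<le> i \<and> M < card (D (p i))" unfolding i_def by (rule LeastI)
  then have "i \<noteq> J" using M by auto
  then have Ji: "J < i" using i by simp
  have "\<not> (J \<le> i - 1 \<and> M < card (D (p (i - 1))))"
    using not_less_Least[of "i - 1" "\<lambda>i. J \<le> i \<and> M < card (D (p i))"] Ji unfolding i_def by force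
  then have "card (D (p (i - 1))) \<le> M" using Ji by auto
  then show ?thesis using that Ji i by blast
qed

end

theorem theorem8p1p1:
  fixes \<Gamma> :: "('v, 'e) multigraph" and v :: 'v
    and H :: "nat \<Rightarrow> ('v, 'e) multigraph" and b :: "nat \<Rightarrow> 'v"
    and C :: "nat \<Rightarrow> ('v, 'e) multigraph" and p :: "nat \<Rightarrow> 'v" and r :: "nat \<Rightarrow> nat"
    and d diam :: "nat \<Rightarrow> nat" and \<beta> \<beta>' :: real
  assumes "cactus \<Gamma>" and "infinite (verts \<Gamma>)" and "one_ended \<Gamma>" and "v \<in> verts \<Gamma>"
    and "exhaustion \<Gamma> H" and "\<And>n. v \<in> verts (H n)"
    and "\<And>n. internal_boundary \<Gamma> (H n) = {b n}"
    and "infinite_block_path \<Gamma> v C p"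
    and "\<And>n. v \<noteq> b n \<Longrightarrow> joining_block_path (H n) v (b n) (map C [1..<r n + 1])"
    and "convergent (\<lambda>n. \<Sum>j | j \<in> {1..r n} \<and> card (verts (C j)) > 2. 1 / real (card (verts (C j))))"
    and "\<And>i. d i = card (verts (decoration \<Gamma> (p i)))"
    and "\<And>i. diam i = graph_diam (decoration \<Gamma> (p i))"
    and "\<exists>c>0. \<forall>\<^sub>F i in sequentially. real (diam i) \<le> c * real (card (verts (C i)))"
    and "(\<lambda>i. ln (real (d (i - 1))) / ln (real (d i))) \<longlonglongrightarrow> 1"
    and "limsup (\<lambda>i. ereal (ln (real (d i)) / ln (real (diam i)))) = ereal \<beta>"
    and "liminf (\<lambda>i. ereal (ln (real (d i)) / ln (real (diam i)))) = ereal \<beta>'"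
  shows "(\<exists>C1>0. \<exists>C2>0. \<forall>\<epsilon>. 0 < \<epsilon> \<and> \<epsilon> < \<beta>' \<longrightarrow>
            (\<exists>M0. \<forall>M>M0. realizable_mass H b v M \<longrightarrow>
               (\<exists>L. (\<lambda>n. avalanche_prob (H n) {b n} v M) \<longlonglongrightarrow> L \<and>
                  C1 * real M powr (- (2 / (\<beta>' - \<epsilon>))) \<le> L \<and>
                  L \<le> C2 * real M powr (- (2 / (\<beta> + \<epsilon>))))))
       \<and> (\<beta> = \<beta>' \<longrightarrow> critical_with_exponent H b v (2 / \<beta>))"
proof -
  interpret cactus_exhaustion \<Gamma> v C p H b
    by unfold_locales (use assms in auto)
  let ?k = "\<lambda>i. card (verts (C i))"
  have d: "card (verts (decoration \<Gamma> (p i))) = d i" for i using assms(11) by simp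
  obtain c where c: "0 < c" "\<forall>\<^sub>F i in sequentially. real (diam i) \<le> c * real (?k i)"
    using assms(13) by blast
  have diam_ge: "i - 1 \<le> diam i" if "1 \<le> i" for i using diam_ge_index[OF that] assms(12) by simp
  have diam_large: "\<forall>\<^sub>F i in sequentially. x \<le> real (diam i)" for x
  proof -
    have "\<forall>\<^sub>F i in sequentially. Suc (nat \<lceil>x\<rceil>) \<le> i" by (rule eventually_ge_at_top)
    then show ?thesis
    proof eventually_elim
      case (elim i)
      then have "nat \<lceil>x\<rceil> \<le> diam i" using diam_ge[of i] by linarith
      then show ?case using real_nat_ceiling_ge[of x] by linarith
    qed
  qed
  \<comment> \<open>The diameters tend to infinity and are at most c times the block sizes, so from
    some index on all blocks have more than two vertices, and the sum in the hypothesis omits only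
    finitely many blocks.\<close>
  have "\<forall>\<^sub>F i in sequentially. 2 < ?k i"
    using c(2) diam_large[of "3 * c"]
  proof eventually_elim
    case (elim i)
    then have "c * 3 \<le> c * real (?k i)" by (simp add: mult.commute)
    then show ?case using c(1) by simp
  qed
  then obtain J1 where J1: "\<And>i. J1 \<le> i \<Longrightarrow> 2 < ?k i" unfolding eventually_sequentially by blast
  define f where "f j = (if 2 < ?k j then 1 / real (?k j) else 0)" for j
  have sum_f: "(\<Sum>j | j \<in> {1..m} \<and> ?k j > 2. 1 / real (?k j)) = (\<Sum>j\<in>{1..m}. f j)" for m
    unfolding f_def by (subst sum.inter_filter[symmetric]) auto
  have "Bseq (\<lambda>n. \<Sum>j\<in>{1..r n}. f j)"
    using assms(10) unfolding sum_f by (rule convergent_imp_Bseq)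
  then obtain K where K: "\<And>n. norm (\<Sum>j\<in>{1..r n}. f j) \<le> K" unfolding Bseq_def by blast
  have f0: "0 \<le> f j" for j unfolding f_def by simp
  \<comment> \<open>Convergence is given along \<open>r n\<close> only; the terms are nonnegative
    and some \<open>r n\<close> exceeds m, so all partial sums are bounded.\<close>
  have "(\<Sum>j\<in>{1..m}. f j) \<le> K" for m
  proof -
    obtain n where "covered n (Suc m)"
      using eventually_happens'[OF _ covered_eventually[of "Suc m"]] by auto
    then have "Suc m < r n" using path_length_gt[OF assms(9)] by auto
    then have "(\<Sum>j\<in>{1..m}. f j) \<le> (\<Sum>j\<in>{1..r n}. f j)" using f0 by (intro sum_mono2) auto
    then show ?thesis using K[of n] by simp
  qed
  then obtain N where N: "\<And>J m. N \<le> J \<Longrightarrow> (\<Sum>l\<in>{J<..m}. f l) \<le> 1 / 4"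
    using bounded_sums_tail[of f K "1 / 4"] f0 by auto
  define J0 where "J0 = max 1 (max J1 N)"
  have J0: "1 \<le> J0" "\<And>i. J0 < i \<Longrightarrow> 2 < ?k i" unfolding J0_def using J1 by auto
  have "(\<Sum>l\<in>{J0<..m}. 1 / real (?k l)) \<le> 1 / 4" for m
  proof -
    have "(\<Sum>l\<in>{J0<..m}. 1 / real (?k l)) = (\<Sum>l\<in>{J0<..m}. f l)"
      using J0(2) unfolding f_def by (intro sum.cong) auto
    moreover have "N \<le> J0" unfolding J0_def by simp
    ultimately show ?thesis using N[of J0 m] by simp
  qed
  from avalanche_limits[OF J0 this, unfolded d] obtain \<kappa> J where \<kappa>: "0 < \<kappa>" "J0 \<le> J"
    and limits: "\<forall>i>J. \<forall>M. d (i - 1) \<le> M \<and> M < d i \<and> realizable_mass H b v M \<longrightarrow>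
      (\<exists>L. (\<lambda>n. avalanche_prob (H n) {b n} v M) \<longlonglongrightarrow> L \<and>
       \<kappa> / (real (?k i) * real (?k (Suc i))) \<le> L \<and> L \<le> 2 / (real (?k i) * real (?k (Suc i))))"
    by blast
  have m2: "\<forall>\<^sub>F i in sequentially. 2 \<le> diam i" using diam_large[of 2] by eventually_elim simp
  have d2: "\<forall>\<^sub>F i in sequentially. 2 \<le> d i"
    using eventually_ge_at_top[of "2 :: nat"]
  proof eventually_elim
    case (elim i)
    then show ?case using card_D_ge[of i] unfolding d by linarith
  qed
  \<comment> \<open>The 3 absorbs the summand 1 of \<open>cycle_le_diam\<close>; squared, it becomes
    the 9 in the lower constant.\<close>
  have k3: "\<forall>\<^sub>F i in sequentially. ?k i \<le> 3 * diam i"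
    using m2 eventually_gt_at_top[of J0]
  proof eventually_elim
    case (elim i)
    then show ?case using cycle_le_diam[OF _ J0(2)[OF elim(2)]] J0(1) assms(12)[of i] by simp
  qed
  \<comment> \<open>Both constants are fixed before \<epsilon>; only the threshold M0 depends on
    it.\<close>
  have bounds: "\<exists>M0. \<forall>M>M0. realizable_mass H b v M \<longrightarrow>
      (\<exists>L. (\<lambda>n. avalanche_prob (H n) {b n} v M) \<longlonglongrightarrow> L \<and>
        \<kappa> / 9 * real M powr (- (2 / (\<beta>' - \<epsilon>))) \<le> L \<and> L \<le> 2 * c\<^sup>2 * real M powr (- (2 / (\<beta> + \<epsilon>))))"
    if \<epsilon>: "0 < \<epsilon>" "\<epsilon> < \<beta>'" for \<epsilon>
  proof -
    have "ereal \<beta>' \<le> ereal \<beta>"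
      using Liminf_le_Limsup[of sequentially "\<lambda>i. ereal (ln (real (d i)) / ln (real (diam i)))"] assms(15,16)
      by simp
    then have \<beta>\<epsilon>: "0 < \<beta> + \<epsilon>" using \<epsilon> by simp
    have "\<forall>\<^sub>F i in sequentially.
       (\<forall>M. 1 \<le> M \<and> M < d i \<longrightarrow> real M powr (1 / (\<beta> + \<epsilon>)) \<le> c * real (?k i)) \<and>
       (\<forall>M. 1 \<le> M \<and> M < d (Suc i) \<longrightarrow> real M powr (1 / (\<beta> + \<epsilon>)) \<le> c * real (?k (Suc i))) \<and>
       (\<forall>M. d (i - 1) \<le> M \<longrightarrow> real (?k i) \<le> 3 * real M powr (1 / (\<beta>' - \<epsilon>)) \<and>
          real (?k (Suc i)) \<le> 3 * real M powr (1 / (\<beta>' - \<epsilon>)))"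
    proof (intro eventually_conj)
      show up: "\<forall>\<^sub>F i in sequentially. \<forall>M. 1 \<le> M \<and> M < d i \<longrightarrow> real M powr (1 / (\<beta> + \<epsilon>)) \<le> c * real (?k i)"
        by (rule upper_growth[OF c(2) assms(15) \<epsilon>(1) \<beta>\<epsilon> m2])
      \<comment> \<open>A mass below d i is also below d (i + 1), so the same bound serves for the
        cycle i + 1.\<close>
      show "\<forall>\<^sub>F i in sequentially. \<forall>M. 1 \<le> M \<and> M < d (Suc i) \<longrightarrow> real M powr (1 / (\<beta> + \<epsilon>)) \<le> c * real (?k (Suc i))"
        using up by (subst eventually_sequentially_Suc)
      show "\<forall>\<^sub>F i in sequentially. \<forall>M. d (i - 1) \<le> M \<longrightarrow> real (?k i) \<le> 3 * real M powr (1 / (\<beta>' - \<epsilon>)) \<and>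
          real (?k (Suc i)) \<le> 3 * real M powr (1 / (\<beta>' - \<epsilon>))"
        by (rule lower_growth[OF k3 assms(16,14) \<epsilon> m2 d2])
    qed
    then obtain N where N: "\<And>i M. N \<le> i \<Longrightarrow> 1 \<le> M \<Longrightarrow> M < d i \<Longrightarrow> real M powr (1 / (\<beta> + \<epsilon>)) \<le> c * real (?k i)"
      "\<And>i M. N \<le> i \<Longrightarrow> 1 \<le> M \<Longrightarrow> M < d (Suc i) \<Longrightarrow> real M powr (1 / (\<beta> + \<epsilon>)) \<le> c * real (?k (Suc i))"
      "\<And>i M. N \<le> i \<Longrightarrow> d (i - 1) \<le> M \<Longrightarrow> real (?k i) \<le> 3 * real M powr (1 / (\<beta>' - \<epsilon>))"
      "\<And>i M. N \<le> i \<Longrightarrow> d (i - 1) \<le> M \<Longrightarrow> real (?k (Suc i)) \<le> 3 * real M powr (1 / (\<beta>' - \<epsilon>))"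
      unfolding eventually_sequentially by blast
    define J' where "J' = max J N"
    have J': "1 \<le> J'" using \<kappa>(2) J0(1) unfolding J'_def by auto
    show ?thesis
    proof (intro exI[of _ "d J'"] allI impI)
      fix M assume M: "d J' < M" and real: "realizable_mass H b v M"
      obtain i where i: "J' < i" "d (i - 1) \<le> M" "M < d i"
        using level_exists[OF J', unfolded d, of M] M by (metis less_imp_le)
      have iN: "N \<le> i" "J < i" "1 \<le> i" using i(1) unfolding J'_def by auto
      have M1: "1 \<le> M" using M by simp
      have MS: "M < d (Suc i)" using card_D_strict_mono[OF iN(3)] i(3) unfolding d by simp
      obtain L where L: "(\<lambda>n. avalanche_prob (H n) {b n} v M) \<longlonglongrightarrow> L"
        "\<kappa> / (real (?k i) * real (?k (Suc i))) \<le> L" "L \<le> 2 / (real (?k i) * real (?k (Suc i)))"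
        using limits[rule_format, OF iN(2), of M] i(2,3) real by blast
      have kpos: "0 < real (?k i)" "0 < real (?k (Suc i))"
        using J0(2)[of i] J0(2)[of "Suc i"] iN(2) \<kappa>(2) by auto
      have sq: "real M powr x * real M powr x = real M powr (2 * x)" for x
        by (simp add: powr_add[symmetric])
      define y where "y = real M powr (1 / (\<beta> + \<epsilon>))"
      define z where "z = real M powr (1 / (\<beta>' - \<epsilon>))"
      have yz: "0 < y" "0 < z" using M1 unfolding y_def z_def by auto
      have y2: "real M powr (- (2 / (\<beta> + \<epsilon>))) = 1 / (y * y)"
        unfolding y_def sq by (simp add: powr_minus divide_inverse)
      have z2: "real M powr (- (2 / (\<beta>' - \<epsilon>))) = 1 / (z * z)"
        unfolding z_def sq by (simp add: powr_minus divide_inverse)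
      have up: "y \<le> c * real (?k i)" "y \<le> c * real (?k (Suc i))"
        using N(1)[OF iN(1) M1 i(3)] N(2)[OF iN(1) M1 MS] unfolding y_def by auto
      have low: "real (?k i) \<le> 3 * z" "real (?k (Suc i)) \<le> 3 * z"
        using N(3,4)[OF iN(1) i(2)] unfolding z_def by auto
      have "y * y \<le> (c * real (?k i)) * (c * real (?k (Suc i)))"
        using up yz c(1) by (intro mult_mono) auto
      then have "2 / (real (?k i) * real (?k (Suc i))) \<le> 2 * c\<^sup>2 * (1 / (y * y))"
        using kpos yz c(1) by (simp add: field_simps power2_eq_square)
      moreover have "real (?k i) * real (?k (Suc i)) \<le> (3 * z) * (3 * z)"
        using low yz by (intro mult_mono) auto
      then have "\<kappa> / 9 * (1 / (z * z)) \<le> \<kappa> / (real (?k i) * real (?k (Suc i)))"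
        using kpos yz \<kappa>(1) by (simp add: field_simps)
      ultimately show "\<exists>L. (\<lambda>n. avalanche_prob (H n) {b n} v M) \<longlonglongrightarrow> L \<and>
        \<kappa> / 9 * real M powr (- (2 / (\<beta>' - \<epsilon>))) \<le> L \<and> L \<le> 2 * c\<^sup>2 * real M powr (- (2 / (\<beta> + \<epsilon>)))"
        unfolding y2 z2 using L by (intro exI[of _ L]) auto
    qed
  qed
  have C12: "0 < \<kappa> / 9" "0 < 2 * c\<^sup>2" using \<kappa>(1) c(1) by auto
  \<comment> \<open>The diameter is at most c * d i; once it is at least the square of c, it is at
    most the square of d i, so the ratio of logarithms is at least 1/2.\<close>
  have \<beta>'_pos: "0 < \<beta>'"
  proof -
    have "\<forall>\<^sub>F i in sequentially. ereal (1 / 2) \<le> ereal (ln (real (d i)) / ln (real (diam i)))"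
      using c(2) m2 diam_large[of "c\<^sup>2"] eventually_gt_at_top[of J0]
    proof eventually_elim
      case (elim i)
      have i: "1 \<le> i" and k: "2 < ?k i" using elim(4) J0 by auto
      have "?k i \<le> d i"
        using card_mono[OF finite_D[OF p_verts[OF i]] C_subset_D[OF i]] unfolding d .
      then have "real (diam i) \<le> c * real (d i)"
        using elim(1) c(1) by (meson mult_left_mono of_nat_mono less_imp_le order.trans)
      then have "real (diam i) * real (diam i) \<le> (c * real (d i)) * (c * real (d i))"
        using c(1) by (intro mult_mono) auto
      also have "\<dots> = c\<^sup>2 * (real (d i))\<^sup>2" by (simp add: power2_eq_square)
      also have "\<dots> \<le> real (diam i) * (real (d i))\<^sup>2" using elim(3) by (intro mult_right_mono) auto
      finally have "real (diam i) \<le> (real (d i))\<^sup>2" using elim(2) by simp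
      moreover have "0 < d i" using \<open>?k i \<le> d i\<close> k by simp
      ultimately have "ln (real (diam i)) \<le> ln ((real (d i))\<^sup>2)" using elim(2) by (subst ln_le_cancel_iff) auto
      also have "\<dots> = 2 * ln (real (d i))" using \<open>0 < d i\<close> by (simp add: ln_realpow)
      finally show ?case using elim(2) by (simp add: le_divide_eq)
    qed
    then have "ereal (1 / 2) \<le> ereal \<beta>'" using Liminf_bounded assms(16) by metis
    then show ?thesis by simp
  qed
  have crit: "critical_with_exponent H b v (2 / \<beta>)" if eq: "\<beta> = \<beta>'"
    unfolding critical_with_exponent_def
  proof (rule conjI, goal_cases)
    case 1
    show ?case using \<beta>'_pos eq by simp
  next
    case 2
    have \<beta>: "0 < \<beta>" using \<beta>'_pos eq by simp
    show ?case
    proof (rule exI[of _ "\<kappa> / 9"], rule conjI[OF C12(1)], rule exI[of _ "2 * c\<^sup>2"],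
        rule conjI[OF C12(2)], intro allI impI)
      fix \<epsilon> :: real assume "0 < \<epsilon>"
      \<comment> \<open>Trades the error inside the denominators for an additive error in the
        exponent.\<close>
      obtain \<epsilon>' where \<epsilon>': "0 < \<epsilon>'" "\<epsilon>' < \<beta>" "2 / (\<beta> - \<epsilon>') \<le> 2 / \<beta> + \<epsilon>" "2 / \<beta> - \<epsilon> \<le> 2 / (\<beta> + \<epsilon>')"
        using exponents_close[OF \<beta> \<open>0 < \<epsilon>\<close>] by blast
      obtain M0 where M0: "\<And>M. M0 < M \<Longrightarrow> realizable_mass H b v M \<Longrightarrow>
        (\<exists>L. (\<lambda>n. avalanche_prob (H n) {b n} v M) \<longlonglongrightarrow> L \<and>
          \<kappa> / 9 * real M powr (- (2 / (\<beta> - \<epsilon>'))) \<le> L \<and> L \<le> 2 * c\<^sup>2 * real M powr (- (2 / (\<beta> + \<epsilon>'))))"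
        using bounds[OF \<epsilon>'(1), unfolded eq[symmetric], OF \<epsilon>'(2)] by blast
      show "\<exists>M\<^sub>\<epsilon>\<ge>1. \<forall>M>M\<^sub>\<epsilon>. realizable_mass H b v M \<longrightarrow>
          (\<exists>L. (\<lambda>n. avalanche_prob (H n) {b n} v M) \<longlonglongrightarrow> L \<and>
             \<kappa> / 9 * real M powr (- (2 / \<beta>) - \<epsilon>) \<le> L \<and> L \<le> 2 * c\<^sup>2 * real M powr (- (2 / \<beta>) + \<epsilon>))"
      proof (intro exI[of _ "max 1 M0"] conjI allI impI)
        fix M assume M: "max 1 M0 < M" and real: "realizable_mass H b v M"
        then obtain L where L: "(\<lambda>n. avalanche_prob (H n) {b n} v M) \<longlonglongrightarrow> L"
          "\<kappa> / 9 * real M powr (- (2 / (\<beta> - \<epsilon>'))) \<le> L" "L \<le> 2 * c\<^sup>2 * real M powr (- (2 / (\<beta> + \<epsilon>')))"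
          using M0[of M] by auto
        have "real M powr (- (2 / \<beta>) - \<epsilon>) \<le> real M powr (- (2 / (\<beta> - \<epsilon>')))"
          using M \<epsilon>'(3) by (intro powr_mono) auto
        then have "\<kappa> / 9 * real M powr (- (2 / \<beta>) - \<epsilon>) \<le> \<kappa> / 9 * real M powr (- (2 / (\<beta> - \<epsilon>')))"
          using C12(1) by (intro mult_left_mono) auto
        moreover have "real M powr (- (2 / (\<beta> + \<epsilon>'))) \<le> real M powr (- (2 / \<beta>) + \<epsilon>)"
          using M \<epsilon>'(4) by (intro powr_mono) auto
        then have "2 * c\<^sup>2 * real M powr (- (2 / (\<beta> + \<epsilon>'))) \<le> 2 * c\<^sup>2 * real M powr (- (2 / \<beta>) + \<epsilon>)"
          using C12(2) by (intro mult_left_mono) auto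
        ultimately show "\<exists>L. (\<lambda>n. avalanche_prob (H n) {b n} v M) \<longlonglongrightarrow> L \<and>
             \<kappa> / 9 * real M powr (- (2 / \<beta>) - \<epsilon>) \<le> L \<and> L \<le> 2 * c\<^sup>2 * real M powr (- (2 / \<beta>) + \<epsilon>)"
          using L by (intro exI[of _ L]) auto
      qed simp
    qed
  qed
  show ?thesis
  proof (rule conjI, rule exI[of _ "\<kappa> / 9"], rule conjI[OF C12(1)], rule exI[of _ "2 * c\<^sup>2"],
      rule conjI[OF C12(2)], intro allI impI)
    fix \<epsilon> assume "0 < \<epsilon> \<and> \<epsilon> < \<beta>'"
    then show "\<exists>M0. \<forall>M>M0. realizable_mass H b v M \<longrightarrow>
      (\<exists>L. (\<lambda>n. avalanche_prob (H n) {b n} v M) \<longlonglongrightarrow> L \<and>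
        \<kappa> / 9 * real M powr (- (2 / (\<beta>' - \<epsilon>))) \<le> L \<and> L \<le> 2 * c\<^sup>2 * real M powr (- (2 / (\<beta> + \<epsilon>))))"
      using bounds[of \<epsilon>] by blast
  qed (use crit in blast)
qed

end
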